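(* Let $\Bbbk$ be an algebraically closed field of characteristic zero, $N > 1$ an odd integer, $q \in \Bbbk$ a primitive $N$-th root of unity, and $\alpha,\beta \in \Bbbk$. Put $\tilde F = (q-q^{-1})KF$ and $u = E + \alpha\tilde F + \beta K$ in $\overline{U}_q(\mathfrak{sl}_2)$, and let $\langle u \rangle^\dagger = \{ f \in \overline{\mathcal{O}}_q(SL_2) \mid f \leftharpoonup h = \varepsilon(h) f \text{ for all } h \in \langle u \rangle\}$, where $\langle u\rangle$ is the unital subalgebra generated by $u$. Let $y_{\alpha,\beta}, z_{\alpha,\beta} \in \overline{\mathcal{O}}_q(SL_2)$ be the elements defined in the context. Then there is an isomorphism of algebras $$T_{N,N}(q^{2}) \to \langle u \rangle^\dagger, \quad \mathtt{x} \mapsto y_{\alpha,\beta}, \quad \mathtt{g} \mapsto z_{\alpha,\beta}.$$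
   Context: $\overline{U}_q(\mathfrak{sl}_2)$ is the algebra generated by $K, E, F$ subject to $K^N = 1$, $KE = q^2 EK$, $KF = q^{-2}FK$, $E^N = F^N = 0$, $EF - FE = (K - K^{-1})/(q - q^{-1})$; it is a Hopf algebra with $\Delta(K) = K \otimes K$, $\Delta(E) = E \otimes K + 1 \otimes E$, $\Delta(F) = F \otimes 1 + K^{-1} \otimes F$, $\varepsilon(K)=1$, $\varepsilon(E)=\varepsilon(F)=0$. $\overline{\mathcal{O}}_q(SL_2)$ is the algebra generated by $a,b,c,d$ subject to $ba = qab$, $ca = qac$, $bc = cb$, $db = qbd$, $dc = qcd$, $ad - q^{-1}bc = da - qbc = a^N = d^N = 1$, $b^N = c^N = 0$; it is a Hopf algebra with $\Delta(a) = a\otimes a + b \otimes c$, $\Delta(b) = a \otimes b + b \otimes d$, $\Delta(c) = c \otimes a + d \otimes c$, $\Delta(d) = c \otimes b + d \otimes d$. There is a unique isomorphism of Hopf algebras $\phi : \overline{\mathcal{O}}_q(SL_2) \to \overline{U}_q(\mathfrak{sl}_2)^*$ such that $\begin{pmatrix} \langle\phi(a),h\rangle & \langle\phi(b),h\rangle \\ \langle\phi(c),h\rangle & \langle\phi(d),h\rangle \end{pmatrix} = \rho(h)$, where $\rho$ is the representation with $\rho(E) = \begin{pmatrix} 0&1\\0&0\end{pmatrix}$, $\rho(F) = \begin{pmatrix} 0&0\\1&0\end{pmatrix}$, $\rho(K) = \begin{pmatrix} q&0\\0&q^{-1}\end{pmatrix}$. Put $(f,h) = \langle \phi(f), h\rangle$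 and $f \leftharpoonup h = (f_{(1)}, h) f_{(2)}$, a right action of $\overline{U}_q(\mathfrak{sl}_2)$ on $\overline{\mathcal{O}}_q(SL_2)$. The minimal polynomial of $u$ is $\phi_{\alpha,\beta}(X) = (X-\beta)\psi(X)$ with $\psi(X) = \prod_{k=1}^{(N-1)/2}\left( X^2 - \beta(q^{2k}+q^{-2k})X + \beta^2 + \frac{(q^{2k}-q^{-2k})^2}{1-q^2}\alpha\right)$. Put $\Lambda_{\alpha,\beta} = \psi(u)$, $x = bd^{-1}$, $y = cd$, $z = d^2$ (where $d^{-1}=d^{N-1}$), and $$y_{\alpha,\beta} = \frac{q^{-1}}{(N-1)_{q^2}!}(x^{N-1}y \leftharpoonup \Lambda_{\alpha,\beta}), \qquad z_{\alpha,\beta} = \frac{q^{-1}}{(N-1)_{q^2}!}(x^{N-1}z \leftharpoonup \Lambda_{\alpha,\beta}),$$ where $(m)_t = 1 + t + \cdots + t^{m-1}$ and $(m)_t! = (1)_t(2)_t\cdots(m)_t$. For a positive integer $m$, a positive divisor $n$ of $m$ and a root of unity $\xi \in \Bbbk$ of order $n$, $T_{m,n}(\xi)$ is the algebra generated by $\mathtt{x}$ and $\mathtt{g}$ subject to $\mathtt{x}^m = 0$, $\mathtt{g}^n = 1$, $\mathtt{g}\mathtt{x} = \xi\,\mathtt{x}\mathtt{g}$. *)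

theory Defs
  imports
    "HOL-Algebra.QuotRing"
    "HOL-Algebra.Module"
    "HOL-Library.Poly_Mapping"
    "HOL-Library.Product_Plus"
    "HOL-Library.FuncSet"
    "HOL-Computational_Algebra.Polynomial"
    "HOL-Analysis.Cartesian_Space"
begin

section \<open>Algebras given by generators and relations\<close>

text \<open>
  Words over an alphabet are lists with concatenation, written additively. The free algebra on
  \<open>'g\<close> over \<open>'k\<close> is then the type \<open>'g list \<Rightarrow>\<^sub>0 'k\<close> with its convolution product, and the tensor
  product of the free algebras on \<open>'g\<close> and \<open>'h\<close> is \<open>('g list \<times> 'h list) \<Rightarrow>\<^sub>0 'k\<close>, the pair
  \<open>(v, w)\<close> of words standing for the pure tensor of \<open>v\<close> and \<open>w\<close>.
\<close>

instantiation list :: (type) monoid_add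
begin

definition zero_list :: "'a list" where "zero_list = []"
definition plus_list :: "'a list \<Rightarrow> 'a list \<Rightarrow> 'a list" where "plus_list v w = v @ w"

instance
  by standard (simp_all add: zero_list_def plus_list_def)

end

definition scal :: "'k \<Rightarrow> 'm::monoid_add \<Rightarrow>\<^sub>0 'k::field" where
  "scal c = Poly_Mapping.single 0 c"

definition gen :: "'g \<Rightarrow> 'g list \<Rightarrow>\<^sub>0 'k::field" where
  "gen g = Poly_Mapping.single [g] 1"

definition monoid_alg :: "('m::monoid_add \<Rightarrow>\<^sub>0 'k::field) ring" where
  "monoid_alg = \<lparr>carrier = UNIV, monoid.mult = (*), one = 1, zero = 0, add = (+)\<rparr>"

text \<open>The two-sided ideal generated by a set of relators, and the class of an element modulo it.\<close>

definition rel_ideal :: "('m::monoid_add \<Rightarrow>\<^sub>0 'k::field) set \<Rightarrow> ('m \<Rightarrow>\<^sub>0 'k) set" where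
  "rel_ideal R = genideal monoid_alg R"

definition cls :: "('m::monoid_add \<Rightarrow>\<^sub>0 'k::field) set \<Rightarrow> ('m \<Rightarrow>\<^sub>0 'k) \<Rightarrow> ('m \<Rightarrow>\<^sub>0 'k) set" where
  "cls R p = rel_ideal R +>\<^bsub>monoid_alg\<^esub> p"

text \<open>
  \<open>k\<close>-algebras are records of type \<open>('k, 'a) module\<close>: the multiplication is the ring
  multiplication, and the scalar action is the field \<open>smult\<close>. (The library's locale
  \<open>algebra\<close> is restricted to commutative algebras.)
\<close>

definition pres_alg :: "('m::monoid_add \<Rightarrow>\<^sub>0 'k::field) set \<Rightarrow> ('k, ('m \<Rightarrow>\<^sub>0 'k) set) module" where
  "pres_alg R = ring.extend (monoid_alg Quot rel_ideal R)
     (module.fields (\<lambda>c X. cls R (scal c) \<otimes>\<^bsub>monoid_alg Quot rel_ideal R\<^esub> X))"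

definition alg_iso :: "('k, 'a, 'c) module_scheme \<Rightarrow> ('k, 'b, 'd) module_scheme \<Rightarrow> ('a \<Rightarrow> 'b) set" where
  "alg_iso A B = {h \<in> ring_iso A B. \<forall>c. \<forall>x \<in> carrier A. h (c \<odot>\<^bsub>A\<^esub> x) = c \<odot>\<^bsub>B\<^esub> h x}"

definition unital_subalg :: "('k, 'a, 'c) module_scheme \<Rightarrow> 'a set \<Rightarrow> bool" where
  "unital_subalg A B \<longleftrightarrow> B \<subseteq> carrier A \<and> \<one>\<^bsub>A\<^esub> \<in> B \<and>
     (\<forall>x \<in> B. \<forall>y \<in> B. x \<oplus>\<^bsub>A\<^esub> y \<in> B \<and> x \<otimes>\<^bsub>A\<^esub> y \<in> B) \<and> (\<forall>c. \<forall>x \<in> B. c \<odot>\<^bsub>A\<^esub> x \<in> B)"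

definition gen_subalg :: "('k, 'a, 'c) module_scheme \<Rightarrow> 'a set \<Rightarrow> 'a set" where
  "gen_subalg A S = \<Inter>{B. unital_subalg A B \<and> S \<subseteq> B}"

text \<open>
  The algebra map out of a free algebra with prescribed values \<open>f\<close> on the generators; \<open>\<iota>\<close> embeds
  the scalars in the target.
\<close>

definition free_hom :: "('k::field \<Rightarrow> 'b::ring_1) \<Rightarrow> ('g \<Rightarrow> 'b) \<Rightarrow> ('g list \<Rightarrow>\<^sub>0 'k) \<Rightarrow> 'b" where
  "free_hom \<iota> f p =
     (\<Sum>w \<in> Poly_Mapping.keys p. \<iota> (Poly_Mapping.lookup p w) * prod_list (map f w))"


section \<open>Bialgebra structures on presented algebras\<close>

text \<open>
  A map on a quotient algebra induced by a map \<open>h\<close> on representatives is written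
  \<open>the_elem (h ` X)\<close>, the common value of \<open>h\<close> on the coset \<open>X\<close>.
\<close>

definition ptensor :: "('g list \<Rightarrow>\<^sub>0 'k::field) \<Rightarrow> ('h list \<Rightarrow>\<^sub>0 'k) \<Rightarrow> ('g list \<times> 'h list) \<Rightarrow>\<^sub>0 'k" where
  "ptensor p r = (\<Sum>v \<in> Poly_Mapping.keys p. \<Sum>w \<in> Poly_Mapping.keys r.
     Poly_Mapping.single (v, w) (Poly_Mapping.lookup p v * Poly_Mapping.lookup r w))"

text \<open>
  The tensor product of the algebras presented by \<open>R\<close> and \<open>S\<close> is the quotient of the tensor product
  of the free algebras by the ideal generated by the following relators.
\<close>

definition tensor_rels :: "('g list \<Rightarrow>\<^sub>0 'k::field) set \<Rightarrow> ('h list \<Rightarrow>\<^sub>0 'k) set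
    \<Rightarrow> (('g list \<times> 'h list) \<Rightarrow>\<^sub>0 'k) set" where
  "tensor_rels R S = (\<lambda>r. ptensor r 1) ` R \<union> (\<lambda>s. ptensor 1 s) ` S"

definition comult :: "('g list \<Rightarrow>\<^sub>0 'k::field) set \<Rightarrow> ('g \<Rightarrow> ('g list \<times> 'g list) \<Rightarrow>\<^sub>0 'k)
    \<Rightarrow> ('g list \<Rightarrow>\<^sub>0 'k) set \<Rightarrow> (('g list \<times> 'g list) \<Rightarrow>\<^sub>0 'k) set" where
  "comult R \<delta> X = the_elem ((\<lambda>p. cls (tensor_rels R R) (free_hom scal \<delta> p)) ` X)"

definition counit :: "('g \<Rightarrow> 'k::field) \<Rightarrow> ('g list \<Rightarrow>\<^sub>0 'k) set \<Rightarrow> 'k" where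
  "counit e X = the_elem (free_hom (\<lambda>c. c) e ` X)"

text \<open>
  For linear functionals \<open>f\<close>, \<open>g\<close> on the algebras presented by \<open>R\<close>, \<open>S\<close>: the functional
  \<open>f \<otimes> g\<close> on the tensor product, and the map \<open>f \<otimes> id\<close> to the algebra presented by \<open>S\<close>.
\<close>

definition tensor_fun :: "('g list \<Rightarrow>\<^sub>0 'k::field) set \<Rightarrow> ('h list \<Rightarrow>\<^sub>0 'k) set
    \<Rightarrow> (('g list \<Rightarrow>\<^sub>0 'k) set \<Rightarrow> 'k) \<Rightarrow> (('h list \<Rightarrow>\<^sub>0 'k) set \<Rightarrow> 'k)
    \<Rightarrow> (('g list \<times> 'h list) \<Rightarrow>\<^sub>0 'k) set \<Rightarrow> 'k" where
  "tensor_fun R S f g T = the_elem ((\<lambda>t. \<Sum>(v, w) \<in> Poly_Mapping.keys t. Poly_Mapping.lookup t (v, w) *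
      f (cls R (Poly_Mapping.single v 1)) * g (cls S (Poly_Mapping.single w 1))) ` T)"

definition tensor_left :: "('g list \<Rightarrow>\<^sub>0 'k::field) set \<Rightarrow> ('h list \<Rightarrow>\<^sub>0 'k) set
    \<Rightarrow> (('g list \<Rightarrow>\<^sub>0 'k) set \<Rightarrow> 'k)
    \<Rightarrow> (('g list \<times> 'h list) \<Rightarrow>\<^sub>0 'k) set \<Rightarrow> ('h list \<Rightarrow>\<^sub>0 'k) set" where
  "tensor_left R S f T = the_elem ((\<lambda>t. cls S (\<Sum>(v, w) \<in> Poly_Mapping.keys t.
      Poly_Mapping.single w (Poly_Mapping.lookup t (v, w) * f (cls R (Poly_Mapping.single v 1))))) ` T)"

text \<open>
  The dual algebra of a bialgebra presented by \<open>R\<close>, \<open>\<delta>\<close>, \<open>e\<close>: linear functionals with the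
  convolution product \<open>(f g)(h) = f(h\<^sub>(\<^sub>1\<^sub>)) g(h\<^sub>(\<^sub>2\<^sub>))\<close> and unit the counit.
\<close>

definition dual_alg :: "('g list \<Rightarrow>\<^sub>0 'k::field) set \<Rightarrow> ('g \<Rightarrow> ('g list \<times> 'g list) \<Rightarrow>\<^sub>0 'k) \<Rightarrow> ('g \<Rightarrow> 'k)
    \<Rightarrow> ('k, ('g list \<Rightarrow>\<^sub>0 'k) set \<Rightarrow> 'k) module" where
  "dual_alg R \<delta> e =
     \<lparr>carrier = {f \<in> extensional (carrier (pres_alg R)).
         (\<forall>x \<in> carrier (pres_alg R). \<forall>y \<in> carrier (pres_alg R). f (x \<oplus>\<^bsub>pres_alg R\<^esub> y) = f x + f y) \<and>
         (\<forall>c. \<forall>x \<in> carrier (pres_alg R). f (c \<odot>\<^bsub>pres_alg R\<^esub> x) = c * f x)},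
      monoid.mult = (\<lambda>f g. \<lambda>x \<in> carrier (pres_alg R). tensor_fun R R f g (comult R \<delta> x)),
      one = (\<lambda>x \<in> carrier (pres_alg R). counit e x),
      zero = (\<lambda>x \<in> carrier (pres_alg R). 0),
      add = (\<lambda>f g. \<lambda>x \<in> carrier (pres_alg R). f x + g x),
      module.smult = (\<lambda>c f. \<lambda>x \<in> carrier (pres_alg R). c * f x)\<rparr>"

text \<open>
  Isomorphisms of Hopf algebras from the algebra presented by \<open>R\<close> onto the dual of the
  (finite-dimensional) one presented by \<open>R'\<close>. The coproduct of the dual, as a functional on the
  tensor square, is \<open>\<Delta>(f)(h \<otimes> h') = f(h h')\<close>, and its counit is \<open>f \<mapsto> f(1)\<close>. Bialgebra maps between
  Hopf algebras automatically commute with the antipodes.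
\<close>

definition hopf_iso_dual :: "('g list \<Rightarrow>\<^sub>0 'k::field) set \<Rightarrow> ('g \<Rightarrow> ('g list \<times> 'g list) \<Rightarrow>\<^sub>0 'k) \<Rightarrow> ('g \<Rightarrow> 'k)
    \<Rightarrow> ('h list \<Rightarrow>\<^sub>0 'k) set \<Rightarrow> ('h \<Rightarrow> ('h list \<times> 'h list) \<Rightarrow>\<^sub>0 'k) \<Rightarrow> ('h \<Rightarrow> 'k)
    \<Rightarrow> (('g list \<Rightarrow>\<^sub>0 'k) set \<Rightarrow> ('h list \<Rightarrow>\<^sub>0 'k) set \<Rightarrow> 'k) \<Rightarrow> bool" where
  "hopf_iso_dual R \<delta> e R' \<delta>' e' \<phi> \<longleftrightarrow>
     \<phi> \<in> alg_iso (pres_alg R) (dual_alg R' \<delta>' e') \<and>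
     (\<forall>x \<in> carrier (pres_alg R). \<forall>h \<in> carrier (pres_alg R'). \<forall>h' \<in> carrier (pres_alg R').
        tensor_fun R R (\<lambda>f. \<phi> f h) (\<lambda>f. \<phi> f h') (comult R \<delta> x) = \<phi> x (h \<otimes>\<^bsub>pres_alg R'\<^esub> h')) \<and>
     (\<forall>x \<in> carrier (pres_alg R). counit e x = \<phi> x \<one>\<^bsub>pres_alg R'\<^esub>)"


section \<open>The small quantum group of \<open>sl\<^sub>2\<close>\<close>

datatype ugen = UK | UE | UF

definition U_rels :: "nat \<Rightarrow> 'k::field \<Rightarrow> (ugen list \<Rightarrow>\<^sub>0 'k) set" where
  "U_rels N q = (let K = gen UK; E = gen UE; F = gen UF in
     {K ^ N - 1,
      K * E - scal (q\<^sup>2) * E * K,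
      K * F - scal (inverse (q\<^sup>2)) * F * K,
      E ^ N, F ^ N,
      E * F - F * E - scal (inverse (q - inverse q)) * (K - K ^ (N - 1))})"

abbreviation Uq :: "nat \<Rightarrow> 'k::field \<Rightarrow> ('k, (ugen list \<Rightarrow>\<^sub>0 'k) set) module" where
  "Uq N q \<equiv> pres_alg (U_rels N q)"

fun U_delta :: "nat \<Rightarrow> ugen \<Rightarrow> (ugen list \<times> ugen list) \<Rightarrow>\<^sub>0 'k::field" where
  "U_delta N UK = ptensor (gen UK) (gen UK)"
| "U_delta N UE = ptensor (gen UE) (gen UK) + ptensor 1 (gen UE)"
| "U_delta N UF = ptensor (gen UF) 1 + ptensor (gen UK ^ (N - 1)) (gen UF)"

fun U_eps :: "ugen \<Rightarrow> 'k::field" where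
  "U_eps UK = 1"
| "U_eps UE = 0"
| "U_eps UF = 0"

fun rho_gen :: "'k::field \<Rightarrow> ugen \<Rightarrow> 'k^2^2" where
  "rho_gen q UE = vector [vector [0, 1], vector [0, 0]]"
| "rho_gen q UF = vector [vector [0, 0], vector [1, 0]]"
| "rho_gen q UK = vector [vector [q, 0], vector [0, inverse q]]"

definition rho :: "'k::field \<Rightarrow> (ugen list \<Rightarrow>\<^sub>0 'k) set \<Rightarrow> 'k^2^2" where
  "rho q X = the_elem ((\<lambda>p. \<chi> i j. \<Sum>w \<in> Poly_Mapping.keys p.
     Poly_Mapping.lookup p w * foldr (\<lambda>g M. rho_gen q g ** M) w (mat 1) $ i $ j) ` X)"


section \<open>The small quantized coordinate algebra of \<open>SL\<^sub>2\<close>\<close>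

datatype ogen = Oa | Ob | Oc | Od

definition O_rels :: "nat \<Rightarrow> 'k::field \<Rightarrow> (ogen list \<Rightarrow>\<^sub>0 'k) set" where
  "O_rels N q = (let a = gen Oa; b = gen Ob; c = gen Oc; d = gen Od in
     {b * a - scal q * a * b,
      c * a - scal q * a * c,
      b * c - c * b,
      d * b - scal q * b * d,
      d * c - scal q * c * d,
      a * d - scal (inverse q) * b * c - 1,
      d * a - scal q * b * c - 1,
      a ^ N - 1, d ^ N - 1, b ^ N, c ^ N})"

abbreviation Oq :: "nat \<Rightarrow> 'k::field \<Rightarrow> ('k, (ogen list \<Rightarrow>\<^sub>0 'k) set) module" where
  "Oq N q \<equiv> pres_alg (O_rels N q)"

fun O_delta :: "ogen \<Rightarrow> (ogen list \<times> ogen list) \<Rightarrow>\<^sub>0 'k::field" where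
  "O_delta Oa = ptensor (gen Oa) (gen Oa) + ptensor (gen Ob) (gen Oc)"
| "O_delta Ob = ptensor (gen Oa) (gen Ob) + ptensor (gen Ob) (gen Od)"
| "O_delta Oc = ptensor (gen Oc) (gen Oa) + ptensor (gen Od) (gen Oc)"
| "O_delta Od = ptensor (gen Oc) (gen Ob) + ptensor (gen Od) (gen Od)"

fun O_eps :: "ogen \<Rightarrow> 'k::field" where
  "O_eps Oa = 1"
| "O_eps Ob = 0"
| "O_eps Oc = 0"
| "O_eps Od = 1"

text \<open>The property characterizing the Hopf algebra isomorphism \<open>\<phi>\<close>.\<close>

definition is_phi :: "nat \<Rightarrow> 'k::field \<Rightarrow> ((ogen list \<Rightarrow>\<^sub>0 'k) set \<Rightarrow> (ugen list \<Rightarrow>\<^sub>0 'k) set \<Rightarrow> 'k) \<Rightarrow> bool" where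
  "is_phi N q \<phi> \<longleftrightarrow>
     hopf_iso_dual (O_rels N q) O_delta O_eps (U_rels N q) (U_delta N) U_eps \<phi> \<and>
     (\<forall>h \<in> carrier (Uq N q).
        vector [vector [\<phi> (cls (O_rels N q) (gen Oa)) h, \<phi> (cls (O_rels N q) (gen Ob)) h],
                vector [\<phi> (cls (O_rels N q) (gen Oc)) h, \<phi> (cls (O_rels N q) (gen Od)) h]] = rho q h)"

definition ract :: "nat \<Rightarrow> 'k::field \<Rightarrow> ((ogen list \<Rightarrow>\<^sub>0 'k) set \<Rightarrow> (ugen list \<Rightarrow>\<^sub>0 'k) set \<Rightarrow> 'k)
    \<Rightarrow> (ogen list \<Rightarrow>\<^sub>0 'k) set \<Rightarrow> (ugen list \<Rightarrow>\<^sub>0 'k) set \<Rightarrow> (ogen list \<Rightarrow>\<^sub>0 'k) set" where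
  "ract N q \<phi> f h = tensor_left (O_rels N q) (O_rels N q) (\<lambda>f'. \<phi> f' h) (comult (O_rels N q) O_delta f)"

definition dagger :: "nat \<Rightarrow> 'k::field \<Rightarrow> ((ogen list \<Rightarrow>\<^sub>0 'k) set \<Rightarrow> (ugen list \<Rightarrow>\<^sub>0 'k) set \<Rightarrow> 'k)
    \<Rightarrow> (ugen list \<Rightarrow>\<^sub>0 'k) set set \<Rightarrow> (ogen list \<Rightarrow>\<^sub>0 'k) set set" where
  "dagger N q \<phi> B = {f \<in> carrier (Oq N q). \<forall>h \<in> B. ract N q \<phi> f h = counit U_eps h \<odot>\<^bsub>Oq N q\<^esub> f}"


section \<open>The elements \<open>u\<close>, \<open>\<Lambda>\<close>, \<open>y\<close> and \<open>z\<close>\<close>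

text \<open>Elements of a presented algebra are given as classes of expressions in the free algebra.\<close>

definition u_rep :: "'k::field \<Rightarrow> 'k \<Rightarrow> 'k \<Rightarrow> ugen list \<Rightarrow>\<^sub>0 'k" where
  "u_rep q \<alpha> \<beta> = gen UE + scal \<alpha> * (scal (q - inverse q) * gen UK * gen UF) + scal \<beta> * gen UK"

definition u_elt :: "nat \<Rightarrow> 'k::field \<Rightarrow> 'k \<Rightarrow> 'k \<Rightarrow> (ugen list \<Rightarrow>\<^sub>0 'k) set" where
  "u_elt N q \<alpha> \<beta> = cls (U_rels N q) (u_rep q \<alpha> \<beta>)"

definition psi_poly :: "nat \<Rightarrow> 'k::field \<Rightarrow> 'k \<Rightarrow> 'k \<Rightarrow> 'k poly" where
  "psi_poly N q \<alpha> \<beta> = (\<Prod>k = 1..(N - 1) div 2.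
     [: \<beta>\<^sup>2 + (q ^ (2 * k) - inverse q ^ (2 * k))\<^sup>2 / (1 - q\<^sup>2) * \<alpha>,
        - (\<beta> * (q ^ (2 * k) + inverse q ^ (2 * k))), 1 :])"

definition Lambda :: "nat \<Rightarrow> 'k::field \<Rightarrow> 'k \<Rightarrow> 'k \<Rightarrow> (ugen list \<Rightarrow>\<^sub>0 'k) set" where
  "Lambda N q \<alpha> \<beta> = cls (U_rels N q)
     (\<Sum>i \<le> degree (psi_poly N q \<alpha> \<beta>). scal (poly.coeff (psi_poly N q \<alpha> \<beta>) i) * u_rep q \<alpha> \<beta> ^ i)"

definition q_num :: "'k::field \<Rightarrow> nat \<Rightarrow> 'k" where
  "q_num t m = (\<Sum>i < m. t ^ i)"

definition q_fact :: "'k::field \<Rightarrow> nat \<Rightarrow> 'k" where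
  "q_fact t m = (\<Prod>i = 1..m. q_num t i)"

definition x_rep :: "nat \<Rightarrow> ogen list \<Rightarrow>\<^sub>0 'k::field" where
  "x_rep N = gen Ob * gen Od ^ (N - 1)"

definition y_elt :: "nat \<Rightarrow> 'k::field \<Rightarrow> ((ogen list \<Rightarrow>\<^sub>0 'k) set \<Rightarrow> (ugen list \<Rightarrow>\<^sub>0 'k) set \<Rightarrow> 'k)
    \<Rightarrow> 'k \<Rightarrow> 'k \<Rightarrow> (ogen list \<Rightarrow>\<^sub>0 'k) set" where
  "y_elt N q \<phi> \<alpha> \<beta> = (inverse q / q_fact (q\<^sup>2) (N - 1)) \<odot>\<^bsub>Oq N q\<^esub>
     ract N q \<phi> (cls (O_rels N q) (x_rep N ^ (N - 1) * (gen Oc * gen Od))) (Lambda N q \<alpha> \<beta>)"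

definition z_elt :: "nat \<Rightarrow> 'k::field \<Rightarrow> ((ogen list \<Rightarrow>\<^sub>0 'k) set \<Rightarrow> (ugen list \<Rightarrow>\<^sub>0 'k) set \<Rightarrow> 'k)
    \<Rightarrow> 'k \<Rightarrow> 'k \<Rightarrow> (ogen list \<Rightarrow>\<^sub>0 'k) set" where
  "z_elt N q \<phi> \<alpha> \<beta> = (inverse q / q_fact (q\<^sup>2) (N - 1)) \<odot>\<^bsub>Oq N q\<^esub>
     ract N q \<phi> (cls (O_rels N q) (x_rep N ^ (N - 1) * gen Od ^ 2)) (Lambda N q \<alpha> \<beta>)"


section \<open>Generalized Taft algebras\<close>

datatype tgen = Tx | Tg

definition T_rels :: "nat \<Rightarrow> nat \<Rightarrow> 'k::field \<Rightarrow> (tgen list \<Rightarrow>\<^sub>0 'k) set" where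
  "T_rels m n \<xi> = {gen Tx ^ m, gen Tg ^ n - 1, gen Tg * gen Tx - scal \<xi> * gen Tx * gen Tg}"

end

theory Submission
  imports Defs
begin

text \<open>
  Since \<open>\<Delta>(u) = u \<otimes> K + 1 \<otimes> (u - \<beta> K)\<close>, the algebra \<open>\<langle>u\<rangle>\<^sup>\<dagger>\<close> is the \<open>\<beta>\<close>-eigenspace of the action of
  \<open>u\<close>, and left multiplication by an eigenvector of eigenvalue \<open>\<lambda>\<close> turns \<open>u\<close> into the same element with
  \<open>\<beta>\<close> replaced by \<open>\<lambda>\<close>. Write \<open>\<beta> = s + t\<close> and \<open>\<alpha> = s t (1 - q\<^sup>2)\<close>. Products of eigenvectors in the
  spans of \<open>b, d\<close> and of \<open>a, c\<close> have eigenvalues \<open>s q\<^sup>n + t q\<^sup>-\<^sup>n\<close>, and such a product times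
  \<open>b\<^sup>N\<^sup>-\<^sup>1\<close> generates a flag on which \<open>u\<close> is triangular with the roots of \<open>(X - \<beta>) \<psi>(X)\<close> on the diagonal.
  This annihilates \<open>x\<^sup>N\<^sup>-\<^sup>1 y\<close> and \<open>x\<^sup>N\<^sup>-\<^sup>1 z\<close>, so that \<open>y\<^sub>\<alpha>\<^sub>\<beta>\<close> and \<open>z\<^sub>\<alpha>\<^sub>\<beta>\<close> lie in \<open>\<langle>u\<rangle>\<^sup>\<dagger>\<close>.
  Restriction to the Borel subalgebra generated by \<open>K\<close> and \<open>F\<close> is injective on \<open>\<langle>u\<rangle>\<^sup>\<dagger>\<close>, because
  \<open>E\<close> acts there as \<open>\<beta> - \<beta> K - \<alpha> (q - q\<^sup>-\<^sup>1) K F\<close>. It sends \<open>y\<^sub>\<alpha>\<^sub>\<beta>, z\<^sub>\<alpha>\<^sub>\<beta>\<close> to the restrictions of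
  \<open>y = c d\<close> and \<open>z = d\<^sup>2\<close>, which generate the restriction of the whole coordinate algebra and satisfy
  exactly the relations of the Taft algebra.
\<close>

section \<open>Linear maps out of monoid algebras\<close>

text \<open>Elements of both algebras are cosets, so \<open>\<phi>\<close> is used to turn them into
  functions on words; injectivity of \<open>\<phi>\<close> also yields that the coproduct of the
  coordinate algebra is well defined. The choice \<open>\<alpha> = s t (1 - q^2)\<close> is what
  makes \<open>v = d + s (q - q^-1) b\<close> an eigenvector. The next operator belongs to
  \<open>(s q, t q^-1)\<close>, a pair with the same product, so factors of this kind can be
  multiplied indefinitely. Against \<open>b^(N-1)\<close> such a factor counts as \<open>d\<close>,
  because \<open>b^N = 0\<close>; this turns products of eigenvectors into monomials. On the other
  side, \<open>u\<close> is \<open>E\<close> plus terms that preserve the order of vanishing in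
  \<open>x\<close>. Since \<open>\<psi>\<close> is monic of degree \<open>N - 1\<close>, only
  \<open>E^(N-1)\<close> contributes to the restriction of \<open>\<psi>(u)\<close> applied to
  \<open>x^(N-1) g\<close>, and the scalar in \<open>y_elt\<close> and \<open>z_elt\<close>
  normalises that contribution to \<open>g\<close>. Oddness of \<open>N\<close> makes
  \<open>d\<close> a power of \<open>d^2\<close>, so that \<open>z\<close> recovers \<open>d\<close>
  on the Borel part.\<close>

lemma pm_induct [case_names single add]:
  assumes "\<And>w c. P (Poly_Mapping.single w c)"
    and "\<And>a b. P a \<Longrightarrow> P b \<Longrightarrow> P (a + b)"
  shows "P (p :: 'm \<Rightarrow>\<^sub>0 'k::ab_group_add)"
proof (induction p rule: update_induct)
  case const
  \<comment> \<open>Zero is a monomial with coefficient 0, whatever the word.\<close>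
  then show ?case using assms(1)[of undefined 0] by simp
next
  case (update f a b)
  have "Poly_Mapping.update a b f = f + Poly_Mapping.single a b"
    using update(1) by (intro poly_mapping_eqI)
      (auto simp: lookup_update lookup_add lookup_single when_def in_keys_iff)
  then show ?case using assms update(3) by metis
qed

lemma pm_ext:
  assumes "Modules.additive g" "Modules.additive h"
    and "\<And>w c. g (Poly_Mapping.single w c) = h (Poly_Mapping.single w c)"
  shows "g p = h p"
  by (induction p rule: pm_induct) (simp_all add: assms additive.add[OF assms(1)] additive.add[OF assms(2)])

text \<open>The linear extensions used below all have this shape. It isolates the one condition,
  \<open>F 0 w = 0\<close>, under which the sum may run over any larger finite set; additivity rests
  on that.\<close>

definition psum :: "('k::zero \<Rightarrow> 'm \<Rightarrow> 'v::comm_monoid_add) \<Rightarrow> ('m \<Rightarrow>\<^sub>0 'k) \<Rightarrow> 'v" where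
  "psum F p = (\<Sum>w \<in> Poly_Mapping.keys p. F (Poly_Mapping.lookup p w) w)"

lemma psum_superset:
  assumes "\<And>w. F 0 w = 0" "finite A" "Poly_Mapping.keys p \<subseteq> A"
  shows "psum F p = (\<Sum>w \<in> A. F (Poly_Mapping.lookup p w) w)"
  unfolding psum_def using assms by (intro sum.mono_neutral_left) (auto simp: in_keys_iff)

lemma psum_add:
  assumes "\<And>w. F 0 w = 0" "\<And>a b w. F (a + b) w = F a w + F b w"
  shows "psum F (p + r) = psum F p + psum F r"
proof -
  let ?A = "Poly_Mapping.keys p \<union> Poly_Mapping.keys r"
  have "Poly_Mapping.keys (p + r) \<subseteq> ?A" by (rule keys_add)
  then show ?thesis
    using psum_superset[of F ?A p] psum_superset[of F ?A r] psum_superset[of F ?A "p + r"] assms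
    by (simp add: lookup_add sum.distrib)
qed

lemma psum_single: "(\<And>w. F 0 w = 0) \<Longrightarrow> psum F (Poly_Mapping.single w c) = F c w"
  by (cases "c = 0") (simp_all add: psum_def)

lemma additive_psum:
  "(\<And>a b w. F (a + b) w = F a w + F b w) \<Longrightarrow>
    Modules.additive (psum F :: ('m \<Rightarrow>\<^sub>0 'k::ab_group_add) \<Rightarrow> 'v::ab_group_add)"
  by (intro additive.intro psum_add) (metis add_cancel_right_right)+

lemma single_word: "Poly_Mapping.single w c = scal c * prod_list (map gen w)"
proof (induction w arbitrary: c rule: rev_induct)
  case Nil
  then show ?case by (simp add: scal_def zero_list_def)
next
  case (snoc g w)
  have "Poly_Mapping.single (w @ [g]) c = Poly_Mapping.single w c * gen g"
    by (simp add: gen_def mult_single plus_list_def)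
  then show ?case by (simp add: snoc mult.assoc)
qed

lemma scal_mult_single: "scal c * Poly_Mapping.single w d = Poly_Mapping.single w (c * d)"
  by (simp add: scal_def mult_single)

lemma scal_0 [simp]: "scal 0 = 0" and scal_1 [simp]: "scal 1 = 1"
  and scal_add: "scal (c + d) = scal c + scal d"
  and scal_mult: "scal (c * d) = scal c * scal d"
  by (simp_all add: scal_def single_add mult_single)

lemma scal_minus: "scal (- c) = - scal c"
  by (simp add: scal_def single_uminus)

lemma scal_central: "p * scal c = scal c * p"
proof (induction p rule: pm_induct)
  case (single w d)
  then show ?case by (simp add: scal_def mult_single mult.commute)
next
  case (add a b)
  then show ?case by (simp add: distrib_left distrib_right)
qed

lemma scal_central_left: "p * (scal c * r) = scal c * (p * r)"
  by (metis scal_central mult.assoc)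

text \<open>Centrality of the scalars makes the linear extension of a map on words multiplicative
  even when the target is a noncommutative ring.\<close>

locale scalar_emb =
  fixes \<iota> :: "'k::field \<Rightarrow> 'b::ring_1"
  assumes one: "\<iota> 1 = 1" and add: "\<iota> (c + d) = \<iota> c + \<iota> d"
    and mult: "\<iota> (c * d) = \<iota> c * \<iota> d" and central: "x * \<iota> c = \<iota> c * x"
begin

lemma zero: "\<iota> 0 = 0"
  using add[of 0 0] by simp

lemma free_hom_psum: "free_hom \<iota> f = psum (\<lambda>c w. \<iota> c * prod_list (map f w))"
  by (simp add: fun_eq_iff free_hom_def psum_def)

lemma free_hom_add: "free_hom \<iota> f (p + r) = free_hom \<iota> f p + free_hom \<iota> f r"
  unfolding free_hom_psum by (intro psum_add) (simp_all add: zero add distrib_right)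

lemma additive_free_hom: "Modules.additive (free_hom \<iota> f)"
  by (simp add: additive.intro free_hom_add)

lemma free_hom_single: "free_hom \<iota> f (Poly_Mapping.single w c) = \<iota> c * prod_list (map f w)"
  unfolding free_hom_psum by (simp add: psum_single zero)

lemma free_hom_mult: "free_hom \<iota> f (p * r) = free_hom \<iota> f p * free_hom \<iota> f r"
proof (induction p rule: pm_induct)
  case (single w c)
  show ?case
  proof (induction r rule: pm_induct)
    case (single v d)
    have "free_hom \<iota> f (Poly_Mapping.single w c * Poly_Mapping.single v d)
      = \<iota> c * (\<iota> d * prod_list (map f w)) * prod_list (map f v)"
      by (simp add: mult_single free_hom_single plus_list_def mult mult.assoc)
    also have "\<dots> = \<iota> c * (prod_list (map f w) * \<iota> d) * prod_list (map f v)"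
      by (simp only: central)
    finally show ?case by (simp add: free_hom_single mult.assoc)
  next
    case (add a b)
    then show ?case by (simp add: free_hom_add distrib_left)
  qed
next
  case (add a b)
  then show ?case by (simp add: free_hom_add distrib_right)
qed

lemma free_hom_scal: "free_hom \<iota> f (scal c) = \<iota> c"
  by (simp add: scal_def free_hom_single zero_list_def)

lemma free_hom_one: "free_hom \<iota> f 1 = 1"
  using free_hom_scal[of f 1] by (simp add: one)

lemma free_hom_gen: "free_hom \<iota> f (gen g) = f g"
  by (simp add: gen_def free_hom_single one)

lemma free_hom_diff: "free_hom \<iota> f (p - r) = free_hom \<iota> f p - free_hom \<iota> f r"
  using additive.diff[OF additive_free_hom] .

lemma free_hom_power: "free_hom \<iota> f (p ^ n) = free_hom \<iota> f p ^ n"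
  by (induction n) (simp_all add: free_hom_one free_hom_mult)

lemmas free_hom_simps = free_hom_add free_hom_mult free_hom_scal free_hom_one free_hom_gen
  free_hom_diff free_hom_power

end

interpretation scal: scalar_emb scal
  by standard (rule scal_1 scal_add scal_mult scal_central)+

interpretation scal_id: scalar_emb "\<lambda>c. c :: 'k::field"
  by standard simp_all

section \<open>Presented algebras\<close>

text \<open>Ideals of the record \<open>monoid_alg\<close>, restated for the ring type itself so
  that closure arguments use type class arithmetic.\<close>

definition two_sided :: "'a::ring_1 set \<Rightarrow> bool" where
  "two_sided I \<longleftrightarrow> 0 \<in> I \<and> (\<forall>a \<in> I. \<forall>b \<in> I. a + b \<in> I) \<and> (\<forall>a \<in> I. \<forall>r. r * a \<in> I \<and> a * r \<in> I)"

lemma two_sidedD: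
  assumes "two_sided I"
  shows "0 \<in> I" "a \<in> I \<Longrightarrow> b \<in> I \<Longrightarrow> a + b \<in> I" "a \<in> I \<Longrightarrow> r * a \<in> I" "a \<in> I \<Longrightarrow> a * r \<in> I"
    "a \<in> I \<Longrightarrow> - a \<in> I" "a \<in> I \<Longrightarrow> b \<in> I \<Longrightarrow> a - b \<in> I"
proof -
  show 1: "0 \<in> I" "a \<in> I \<Longrightarrow> b \<in> I \<Longrightarrow> a + b \<in> I" "a \<in> I \<Longrightarrow> r * a \<in> I" "a \<in> I \<Longrightarrow> a * r \<in> I" for a b r
    using assms by (simp_all add: two_sided_def)
  show 2: "a \<in> I \<Longrightarrow> - a \<in> I" for a
    using 1(3)[of a "-1"] by simp
  show "a \<in> I \<Longrightarrow> b \<in> I \<Longrightarrow> a - b \<in> I"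
    using 1(2)[of a "- b"] 2[of b] by simp
qed

lemma ring_monoid_alg: "ring (monoid_alg :: ('m::monoid_add \<Rightarrow>\<^sub>0 'k::field) ring)"
proof (rule ringI)
  show "abelian_group (monoid_alg :: ('m \<Rightarrow>\<^sub>0 'k) ring)"
    by (rule abelian_groupI) (auto simp: monoid_alg_def add.assoc add.commute intro: exI[of _ "- _"])
  show "Group.monoid (monoid_alg :: ('m \<Rightarrow>\<^sub>0 'k) ring)"
    by (rule monoidI) (auto simp: monoid_alg_def mult.assoc)
qed (auto simp: monoid_alg_def distrib_left distrib_right)

lemma ideal_monoid_alg: "ideal I (monoid_alg :: ('m::monoid_add \<Rightarrow>\<^sub>0 'k::field) ring) \<longleftrightarrow> two_sided I"
proof
  assume "ideal I (monoid_alg :: ('m \<Rightarrow>\<^sub>0 'k) ring)"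
  then interpret ideal I "monoid_alg :: ('m \<Rightarrow>\<^sub>0 'k) ring" .
  show "two_sided I"
    using a_subgroup I_l_closed I_r_closed
    unfolding two_sided_def subgroup_def by (auto simp: monoid_alg_def)
next
  assume I: "two_sided I"
  interpret ring "monoid_alg :: ('m \<Rightarrow>\<^sub>0 'k) ring" by (rule ring_monoid_alg)
  have "\<ominus>\<^bsub>monoid_alg\<^esub> a = - a" for a :: "'m \<Rightarrow>\<^sub>0 'k"
    by (rule minus_equality) (auto simp: monoid_alg_def)
  then have inv: "inv\<^bsub>add_monoid monoid_alg\<^esub> a = - a" for a :: "'m \<Rightarrow>\<^sub>0 'k"
    by (simp add: a_inv_def)
  have "subgroup I (add_monoid (monoid_alg :: ('m \<Rightarrow>\<^sub>0 'k) ring))"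
    unfolding subgroup_def inv using two_sidedD[OF I] by (auto simp: monoid_alg_def)
  then show "ideal I (monoid_alg :: ('m \<Rightarrow>\<^sub>0 'k) ring)"
    by (rule idealI[OF ring_monoid_alg]) (use two_sidedD[OF I] in \<open>auto simp: monoid_alg_def\<close>)
qed

lemma ideal_rel_ideal: "ideal (rel_ideal R) monoid_alg"
  unfolding rel_ideal_def by (intro ring.genideal_ideal ring_monoid_alg) (simp add: monoid_alg_def)

lemma two_sided_rel_ideal: "two_sided (rel_ideal R)"
  using ideal_rel_ideal ideal_monoid_alg by blast

lemmas rel_ideal_closed = two_sidedD[OF two_sided_rel_ideal]

lemma rel_ideal_self: "r \<in> R \<Longrightarrow> r \<in> rel_ideal R"
  unfolding rel_ideal_def genideal_def by auto

lemma rel_ideal_minimal: "two_sided I \<Longrightarrow> R \<subseteq> I \<Longrightarrow> rel_ideal R \<subseteq> I"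
  unfolding rel_ideal_def genideal_def using ideal_monoid_alg by auto

lemma rel_ideal_hom:
  assumes add: "\<And>p r. h (p + r) = h p + h r" and mult: "\<And>p r. h (p * r) = h p * h r"
    and I: "two_sided I" and R: "\<And>r. r \<in> R \<Longrightarrow> h r \<in> I" and p: "p \<in> rel_ideal R"
  shows "h p \<in> I"
proof -
  have "h 0 = 0" using add[of 0 0] by simp
  then have "two_sided {p. h p \<in> I}"
    unfolding two_sided_def using two_sidedD[OF I] by (auto simp: add mult)
  from rel_ideal_minimal[OF this, of R] show ?thesis using R p by auto
qed

text \<open>For a map that is merely additive the preimage of \<open>I\<close> need not be an ideal;
  keeping only those \<open>p\<close> all of whose multiples \<open>a * p * b\<close> land in
  \<open>I\<close> repairs this.\<close>

lemma two_sided_additive: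
  assumes F: "Modules.additive F" and I: "0 \<in> I" "\<And>a b. a \<in> I \<Longrightarrow> b \<in> I \<Longrightarrow> a + b \<in> I"
  shows "two_sided {p. \<forall>a b. F (a * p * b) \<in> I}"
  unfolding two_sided_def
proof (intro conjI ballI allI)
  fix p r assume p: "p \<in> {p. \<forall>a b. F (a * p * b) \<in> I}"
  have "F (a * (r * p) * b) \<in> I" "F (a * (p * r) * b) \<in> I" for a b
  proof -
    have "F ((a * r) * p * b) \<in> I" "F (a * p * (r * b)) \<in> I" using p by auto
    then show "F (a * (r * p) * b) \<in> I" "F (a * (p * r) * b) \<in> I" by (simp_all add: mult.assoc)
  qed
  then show "r * p \<in> {p. \<forall>a b. F (a * p * b) \<in> I}" "p * r \<in> {p. \<forall>a b. F (a * p * b) \<in> I}"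
    by simp_all
qed (auto simp: distrib_left distrib_right additive.add[OF F] additive.zero[OF F] I)

text \<open>Scalars are central, so the multiples of a relator by words, with a single coefficient
  on the left, span all multiples that have to be tested.\<close>

lemma rel_ideal_additive_zero:
  assumes F: "Modules.additive F"
    and R: "\<And>r m c n. r \<in> R \<Longrightarrow> F (Poly_Mapping.single m c * r * Poly_Mapping.single n 1) = 0"
    and p: "p \<in> rel_ideal R"
  shows "F p = 0"
proof -
  interpret Modules.additive F by fact
  let ?I = "{p. \<forall>a b. F (a * p * b) \<in> {0}}"
  have "two_sided ?I" by (rule two_sided_additive[OF F]) auto
  moreover have "R \<subseteq> ?I"
  proof (rule subsetI, rule CollectI, intro allI)
    fix r a b assume r: "r \<in> R"
    have "F (Poly_Mapping.single m c * r * b) = 0" for m c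
    proof (induction b rule: pm_induct)
      case (single w d)
      have "Poly_Mapping.single m c * r * Poly_Mapping.single w d
        = Poly_Mapping.single m (c * d) * r * Poly_Mapping.single w 1"
      proof -
        have "Poly_Mapping.single w d = scal d * Poly_Mapping.single w 1"
          by (simp add: scal_mult_single)
        moreover have "Poly_Mapping.single m (c * d) = scal d * Poly_Mapping.single m c"
          by (simp add: scal_mult_single mult.commute)
        ultimately show ?thesis by (simp only: mult.assoc scal_central_left)
      qed
      then show ?case using R[OF r] by simp
    qed (simp add: distrib_left add)
    then show "F (a * r * b) \<in> {0}"
      by (induction a rule: pm_induct) (simp_all add: distrib_right add)
  qed
  ultimately have "p \<in> ?I" using rel_ideal_minimal p by blast
  then have "F (1 * p * 1) \<in> {0}" by blast
  then show ?thesis by simp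
qed

lemma cls_eq_image: "cls R p = (\<lambda>i. i + p) ` rel_ideal R"
  unfolding cls_def a_r_coset_def' by (auto simp: monoid_alg_def)

lemma cls_eq_iff: "cls R p = cls R r \<longleftrightarrow> p - r \<in> rel_ideal R"
proof
  assume "cls R p = cls R r"
  moreover have "p \<in> cls R p" unfolding cls_eq_image using rel_ideal_closed(1) by force
  ultimately obtain i where "i \<in> rel_ideal R" "p = i + r" by (auto simp: cls_eq_image)
  then show "p - r \<in> rel_ideal R" by simp
next
  assume d: "p - r \<in> rel_ideal R"
  have "i + p \<in> (\<lambda>i. i + r) ` rel_ideal R" if "i \<in> rel_ideal R" for i
    using rel_ideal_closed(2)[OF that d] by (auto intro!: image_eqI[of _ _ "i + (p - r)"])
  moreover have "i + r \<in> (\<lambda>i. i + p) ` rel_ideal R" if "i \<in> rel_ideal R" for i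
    using rel_ideal_closed(6)[OF that d] by (auto intro!: image_eqI[of _ _ "i - (p - r)"])
  ultimately show "cls R p = cls R r" by (auto simp: cls_eq_image)
qed

lemma cls_eq_0_iff: "cls R p = cls R 0 \<longleftrightarrow> p \<in> rel_ideal R"
  by (simp add: cls_eq_iff)

lemma cls_cong: "p - r \<in> rel_ideal R \<Longrightarrow> cls R p = cls R r"
  by (simp add: cls_eq_iff)

lemma the_elem_cls:
  assumes "\<And>i. i \<in> rel_ideal R \<Longrightarrow> h (i + p) = h p"
  shows "the_elem (h ` cls R p) = h p"
  using rel_ideal_closed(1)[of R] assms by (intro the_elem_image_unique) (auto simp: cls_eq_image)

lemma the_elem_cls_additive:
  assumes "Modules.additive h" "\<And>i. i \<in> rel_ideal R \<Longrightarrow> h i = 0"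
  shows "the_elem (h ` cls R p) = h p"
  using assms by (intro the_elem_cls) (simp add: additive.add)

lemma carrier_pres_alg: "carrier (pres_alg R) = range (cls R)"
  unfolding pres_alg_def ring.defs module.defs FactRing_def cls_def A_RCOSETS_def'
  by (auto simp: monoid_alg_def)

lemma cls_carrier [simp, intro]: "cls R p \<in> carrier (pres_alg R)"
  by (simp add: carrier_pres_alg)

lemma pres_alg_mult [simp]: "cls R p \<otimes>\<^bsub>pres_alg R\<^esub> cls R r = cls R (p * r)"
  using ideal.rcoset_mult_add[OF ideal_rel_ideal[of R], of p r]
  by (simp add: pres_alg_def ring.defs module.defs FactRing_def cls_def monoid_alg_def)

lemma pres_alg_add [simp]: "cls R p \<oplus>\<^bsub>pres_alg R\<^esub> cls R r = cls R (p + r)"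
proof -
  have "cls R p \<oplus>\<^bsub>pres_alg R\<^esub> cls R r = (\<Union>x\<in>cls R p. \<Union>y\<in>cls R r. {x + y})"
    by (simp add: pres_alg_def ring.defs module.defs FactRing_def set_add_def')
      (simp add: monoid_alg_def)
  also have "\<dots> = cls R (p + r)"
  proof -
    have "i + p + (j + r) \<in> cls R (p + r)" if "i \<in> rel_ideal R" "j \<in> rel_ideal R" for i j
      unfolding cls_eq_image using rel_ideal_closed(2)[OF that]
      by (auto intro!: image_eqI[of _ _ "i + j"])
    moreover have "\<exists>j\<in>rel_ideal R. \<exists>k\<in>rel_ideal R. i + (p + r) = j + p + (k + r)"
      if "i \<in> rel_ideal R" for i
      using that rel_ideal_closed(1)[of R] by (intro bexI[of _ i] bexI[of _ 0]) simp_all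
    ultimately show ?thesis by (auto simp: cls_eq_image)
  qed
  finally show ?thesis .
qed

lemma pres_alg_one [simp]: "\<one>\<^bsub>pres_alg R\<^esub> = cls R 1"
  by (simp add: pres_alg_def ring.defs module.defs FactRing_def cls_def monoid_alg_def)

lemma pres_alg_smult [simp]: "c \<odot>\<^bsub>pres_alg R\<^esub> cls R p = cls R (scal c * p)"
  using pres_alg_mult[of R "scal c" p]
  by (simp add: pres_alg_def ring.defs module.defs FactRing_def)

text \<open>Functionals are total functions on sets of polynomials; linearity is demanded only at
  classes \<open>cls R p\<close>, and values elsewhere stay arbitrary.\<close>

definition lin_fun :: "('m::monoid_add \<Rightarrow>\<^sub>0 'k::field) set \<Rightarrow> (('m \<Rightarrow>\<^sub>0 'k) set \<Rightarrow> 'k) \<Rightarrow> bool" where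
  "lin_fun R f \<longleftrightarrow> (\<forall>p r. f (cls R (p + r)) = f (cls R p) + f (cls R r)) \<and>
     (\<forall>c p. f (cls R (scal c * p)) = c * f (cls R p))"

lemma lin_funD:
  assumes "lin_fun R f"
  shows "f (cls R (p + r)) = f (cls R p) + f (cls R r)" "f (cls R (scal c * p)) = c * f (cls R p)"
    "f (cls R 0) = 0" "f (cls R (Poly_Mapping.single w c)) = c * f (cls R (Poly_Mapping.single w 1))"
    "f (cls R (p - r)) = f (cls R p) - f (cls R r)"
proof -
  show 1: "f (cls R (p + r)) = f (cls R p) + f (cls R r)" "f (cls R (scal c * p)) = c * f (cls R p)"
    for p r c using assms by (simp_all add: lin_fun_def)
  show "f (cls R 0) = 0" using 1(2)[of 0 0] by simp
  show "f (cls R (Poly_Mapping.single w c)) = c * f (cls R (Poly_Mapping.single w 1))"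
    using 1(2)[of c "Poly_Mapping.single w 1"] by (simp add: scal_mult_single)
  show "f (cls R (p - r)) = f (cls R p) - f (cls R r)"
    using 1(1)[of "p - r" r] by simp
qed

lemma lin_fun_mult_left: "lin_fun R f \<Longrightarrow> lin_fun R (\<lambda>X. f (cls R x \<otimes>\<^bsub>pres_alg R\<^esub> X))"
  by (simp add: lin_fun_def distrib_left scal_central_left)

subsection \<open>Tensor products\<close>

lemma ptensor_psum: "ptensor p r = psum (\<lambda>a v. psum (\<lambda>b w. Poly_Mapping.single (v, w) (a * b)) r) p"
  by (simp add: ptensor_def psum_def)

lemma ptensor_add_right: "ptensor p (r + s) = ptensor p r + ptensor p s"
  unfolding ptensor_psum
  by (subst psum_add) (simp_all add: single_add distrib_left psum_def sum.distrib)

lemma ptensor_add_left: "ptensor (p + r) s = ptensor p s + ptensor r s"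
  unfolding ptensor_psum
  by (subst psum_add) (simp_all add: single_add distrib_right psum_def sum.distrib)

lemma ptensor_single: "ptensor (Poly_Mapping.single v a) (Poly_Mapping.single w b) = Poly_Mapping.single (v, w) (a * b)"
  by (cases "a = 0"; cases "b = 0") (simp_all add: ptensor_def)

lemma ptensor_mult: "ptensor p r * ptensor p' r' = ptensor (p * p') (r * r')"
proof -
  have 1: "ptensor p (Poly_Mapping.single w b) * ptensor (Poly_Mapping.single v' a') (Poly_Mapping.single w' b')
    = ptensor (p * Poly_Mapping.single v' a') (Poly_Mapping.single w b * Poly_Mapping.single w' b')" for p w b v' a' w' b'
    by (induction p rule: pm_induct)
      (simp_all add: ptensor_single mult_single ptensor_add_left distrib_right mult_ac)
  have 2: "ptensor p r * ptensor (Poly_Mapping.single v' a') (Poly_Mapping.single w' b')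
    = ptensor (p * Poly_Mapping.single v' a') (r * Poly_Mapping.single w' b')" for p r v' a' w' b'
    by (induction r rule: pm_induct) (simp_all add: 1 ptensor_add_right distrib_right)
  have 3: "ptensor p r * ptensor p' (Poly_Mapping.single w' b')
    = ptensor (p * p') (r * Poly_Mapping.single w' b')" for p r p' w' b'
    by (induction p' rule: pm_induct) (simp_all add: 2 ptensor_add_left distrib_left)
  show ?thesis
    by (induction r' rule: pm_induct) (simp_all add: 3 ptensor_add_right distrib_left)
qed

lemma ptensor_1_1: "ptensor 1 1 = 1"
  using ptensor_single[of 0 1 0 1] by (simp flip: zero_prod_def)

lemma ptensor_0 [simp]: "ptensor 0 r = 0" "ptensor p 0 = 0"
  using ptensor_add_left[of 0 0 r] ptensor_add_right[of p 0 0] by simp_all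

lemma ptensor_minus: "ptensor (- p) r = - ptensor p r" "ptensor p (- r) = - ptensor p r"
  using ptensor_add_left[of p "- p" r] ptensor_add_right[of p r "- r"]
  by (simp_all add: eq_neg_iff_add_eq_0 add.commute)

lemma ptensor_diff: "ptensor (p - p') r = ptensor p r - ptensor p' r" "ptensor p (r - r') = ptensor p r - ptensor p r'"
  using ptensor_add_left[of p "- p'" r] ptensor_add_right[of p r "- r'"] by (simp_all add: ptensor_minus)

lemma scal_ptensor: "scal c = ptensor (scal c) 1" "scal c = ptensor 1 (scal c)"
  using ptensor_single[of 0 c 0 1, symmetric] ptensor_single[of 0 1 0 c, symmetric]
  by (simp_all add: scal_def flip: zero_prod_def)

lemma ptensor_scal: "ptensor (scal c * p) r = scal c * ptensor p r" "ptensor p (scal c * r) = scal c * ptensor p r"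
  by (subst scal_ptensor(1), simp add: ptensor_mult) (subst scal_ptensor(2), simp add: ptensor_mult)

lemma ptensor_power: "ptensor p r ^ n = ptensor (p ^ n) (r ^ n)"
  by (induction n) (simp_all add: ptensor_mult ptensor_1_1)

text \<open>Tensoring with 1 is multiplicative and sends relators to tensor relators; a factor
  \<open>ptensor 1 r\<close> then reaches the general case.\<close>

lemma ptensor_rel_left:
  assumes "p \<in> rel_ideal R"
  shows "ptensor p r \<in> rel_ideal (tensor_rels R S)"
proof -
  have "ptensor p 1 \<in> rel_ideal (tensor_rels R S)"
    using assms by (rule rel_ideal_hom[of "\<lambda>p. ptensor p 1", rotated 4])
      (auto simp: ptensor_add_left ptensor_mult tensor_rels_def two_sided_rel_ideal intro: rel_ideal_self)
  then have "ptensor p 1 * ptensor 1 r \<in> rel_ideal (tensor_rels R S)" by (rule rel_ideal_closed)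
  then show ?thesis by (simp add: ptensor_mult)
qed

lemma ptensor_rel_right:
  assumes "r \<in> rel_ideal S"
  shows "ptensor p r \<in> rel_ideal (tensor_rels R S)"
proof -
  have "ptensor 1 r \<in> rel_ideal (tensor_rels R S)"
    using assms by (rule rel_ideal_hom[of "\<lambda>p. ptensor 1 p", rotated 4])
      (auto simp: ptensor_add_right ptensor_mult tensor_rels_def two_sided_rel_ideal intro: rel_ideal_self)
  then have "ptensor p 1 * ptensor 1 r \<in> rel_ideal (tensor_rels R S)" by (rule rel_ideal_closed)
  then show ?thesis by (simp add: ptensor_mult)
qed

lemma rel_ideal_tensor_zero:
  fixes R :: "('g list \<Rightarrow>\<^sub>0 'k::field) set" and S :: "('h list \<Rightarrow>\<^sub>0 'k) set"
  assumes F: "Modules.additive F"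
    and z: "\<And>p r. p \<in> rel_ideal R \<or> r \<in> rel_ideal S \<Longrightarrow> F (ptensor p r) = 0"
    and t: "t \<in> rel_ideal (tensor_rels R S)"
  shows "F t = 0"
proof (rule rel_ideal_additive_zero[OF F _ t])
  fix r and m n :: "'g list \<times> 'h list" and c :: 'k
  assume r: "r \<in> tensor_rels R S"
  obtain v w v' w' where mn: "m = (v, w)" "n = (v', w')" by force
  have s: "Poly_Mapping.single m c = ptensor (Poly_Mapping.single v c) (Poly_Mapping.single w 1)"
    "Poly_Mapping.single n 1 = ptensor (Poly_Mapping.single v' 1) (Poly_Mapping.single w' 1)"
    by (simp_all add: mn ptensor_single)
  show "F (Poly_Mapping.single m c * r * Poly_Mapping.single n 1) = 0"
    unfolding s using r
    by (auto simp: tensor_rels_def ptensor_mult rel_ideal_closed rel_ideal_self intro!: z)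
qed

definition tfun :: "('g list \<Rightarrow>\<^sub>0 'k::field) set \<Rightarrow> ('h list \<Rightarrow>\<^sub>0 'k) set
    \<Rightarrow> (('g list \<Rightarrow>\<^sub>0 'k) set \<Rightarrow> 'k) \<Rightarrow> (('h list \<Rightarrow>\<^sub>0 'k) set \<Rightarrow> 'k)
    \<Rightarrow> (('g list \<times> 'h list) \<Rightarrow>\<^sub>0 'k) \<Rightarrow> 'k" where
  "tfun R S f g = psum (\<lambda>c (v, w). c * f (cls R (Poly_Mapping.single v 1)) * g (cls S (Poly_Mapping.single w 1)))"

lemma additive_tfun: "Modules.additive (tfun R S f g)"
  unfolding tfun_def by (intro additive_psum) (auto simp: distrib_right)

lemma tfun_ptensor:
  assumes "lin_fun R f" "lin_fun S g"
  shows "tfun R S f g (ptensor p r) = f (cls R p) * g (cls S r)"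
proof -
  have 1: "tfun R S f g (ptensor p (Poly_Mapping.single w b)) = f (cls R p) * g (cls S (Poly_Mapping.single w b))" for p w b
  proof (induction p rule: pm_induct)
    case (single v a)
    show ?case
      by (subst lin_funD(4)[OF assms(1)], subst lin_funD(4)[OF assms(2)])
        (simp add: ptensor_single tfun_def psum_single)
  qed (simp add: ptensor_add_left additive.add[OF additive_tfun] distrib_right lin_funD(1)[OF assms(1)])
  show ?thesis
    by (induction r rule: pm_induct)
      (simp_all add: 1 ptensor_add_right additive.add[OF additive_tfun] distrib_left lin_funD(1)[OF assms(2)])
qed

lemma tfun_zero:
  assumes "lin_fun R f" "lin_fun S g" "t \<in> rel_ideal (tensor_rels R S)"
  shows "tfun R S f g t = 0"
proof (rule rel_ideal_tensor_zero[OF additive_tfun _ assms(3)])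
  fix p r assume "p \<in> rel_ideal R \<or> r \<in> rel_ideal S"
  then have "cls R p = cls R 0 \<or> cls S r = cls S 0" by (simp add: cls_eq_0_iff)
  then have "f (cls R p) = 0 \<or> g (cls S r) = 0" using lin_funD(3)[OF assms(1)] lin_funD(3)[OF assms(2)] by metis
  then show "tfun R S f g (ptensor p r) = 0"
    by (auto simp: tfun_ptensor[OF assms(1,2)])
qed

lemma tensor_fun_cls:
  assumes "lin_fun R f" "lin_fun S g"
  shows "tensor_fun R S f g (cls (tensor_rels R S) t) = tfun R S f g t"
proof -
  have "tensor_fun R S f g T = the_elem (tfun R S f g ` T)" for T
    by (simp add: tensor_fun_def tfun_def psum_def case_prod_beta')
  then show ?thesis
    using the_elem_cls_additive[OF additive_tfun tfun_zero[OF assms]] by simp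
qed

definition tleft :: "('g list \<Rightarrow>\<^sub>0 'k::field) set \<Rightarrow> (('g list \<Rightarrow>\<^sub>0 'k) set \<Rightarrow> 'k)
    \<Rightarrow> (('g list \<times> 'h list) \<Rightarrow>\<^sub>0 'k) \<Rightarrow> 'h list \<Rightarrow>\<^sub>0 'k" where
  "tleft R f = psum (\<lambda>c (v, w). Poly_Mapping.single w (c * f (cls R (Poly_Mapping.single v 1))))"

lemma additive_tleft: "Modules.additive (tleft R f)"
  unfolding tleft_def by (intro additive_psum) (auto simp: distrib_right single_add)

lemma tleft_ptensor:
  assumes "lin_fun R f"
  shows "tleft R f (ptensor p r) = scal (f (cls R p)) * r"
proof -
  have 1: "tleft R f (ptensor p (Poly_Mapping.single w b)) = scal (f (cls R p)) * Poly_Mapping.single w b" for p w b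
  proof (induction p rule: pm_induct)
    case (single v a)
    show ?case
      by (subst lin_funD(4)[OF assms])
        (simp add: ptensor_single tleft_def psum_single scal_mult_single mult_ac)
  qed (simp add: ptensor_add_left additive.add[OF additive_tleft] distrib_right lin_funD(1)[OF assms] scal_add)
  show ?thesis
    by (induction r rule: pm_induct)
      (simp_all add: 1 ptensor_add_right additive.add[OF additive_tleft] distrib_left)
qed

lemma tensor_left_cls:
  assumes "lin_fun R f"
  shows "tensor_left R S f (cls (tensor_rels R S) t) = cls S (tleft R f t)"
proof -
  have *: "tensor_left R S f T = the_elem ((\<lambda>t. cls S (tleft R f t)) ` T)" for T
    by (simp add: tensor_left_def tleft_def psum_def case_prod_beta')
  let ?I = "rel_ideal S"
  have "tleft R f i \<in> ?I" if i: "i \<in> rel_ideal (tensor_rels R S)" for i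
  proof -
    let ?J = "{t. \<forall>a b. tleft R f (a * t * b) \<in> ?I}"
    \<comment> \<open>Pure tensors span, so it suffices to test multiples by pure tensors, where
      \<open>tleft\<close> can be evaluated.\<close>
    have gen: "tleft R f (a * t * b) \<in> ?I"
      if t: "\<And>p r p' r'. tleft R f (ptensor p r * t * ptensor p' r') \<in> ?I" for a b t
    proof -
      have "tleft R f (ptensor p r * t * b) \<in> ?I" for p r
      proof (induction b rule: pm_induct)
        case (single n c)
        then show ?case
          using t[of p r "Poly_Mapping.single (fst n) c" "Poly_Mapping.single (snd n) 1"]
          by (simp add: ptensor_single)
      qed (simp add: distrib_left additive.add[OF additive_tleft] rel_ideal_closed)
      note 1 = this
      show ?thesis
      proof (induction a rule: pm_induct)
        case (single n c)
        then show ?case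
          using 1[of "Poly_Mapping.single (fst n) c" "Poly_Mapping.single (snd n) 1"]
          by (simp add: ptensor_single)
      qed (simp add: distrib_right additive.add[OF additive_tleft] rel_ideal_closed)
    qed
    have "two_sided ?J"
      by (rule two_sided_additive[OF additive_tleft]) (simp_all add: rel_ideal_closed)
    moreover have "tensor_rels R S \<subseteq> ?J"
    proof (rule subsetI, rule CollectI, intro allI, rule gen)
      fix t and p :: "'a list \<Rightarrow>\<^sub>0 'b" and r :: "'c list \<Rightarrow>\<^sub>0 'b" and p' r' assume t: "t \<in> tensor_rels R S"
      have "cls R (a * r * b) = cls R 0" if "r \<in> R" for a r b
        using that by (simp add: cls_eq_0_iff rel_ideal_closed rel_ideal_self)
      then have "f (cls R (a * r * b)) = 0" if "r \<in> R" for a r b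
        using that lin_funD(3)[OF assms] by metis
      then show "tleft R f (ptensor p r * t * ptensor p' r') \<in> ?I"
        using t by (auto simp: tensor_rels_def ptensor_mult tleft_ptensor[OF assms]
            rel_ideal_closed rel_ideal_self)
    qed
    ultimately have "i \<in> ?J" using rel_ideal_minimal i by blast
    then have "tleft R f (1 * i * 1) \<in> ?I" by blast
    then show ?thesis by simp
  qed
  then show ?thesis
    unfolding * by (intro the_elem_cls) (simp add: additive.add[OF additive_tleft] cls_eq_iff)
qed

lemma comult_cls:
  assumes "\<And>r. r \<in> R \<Longrightarrow> free_hom scal \<delta> r \<in> rel_ideal (tensor_rels R R)"
  shows "comult R \<delta> (cls R p) = cls (tensor_rels R R) (free_hom scal \<delta> p)"
proof -
  have "free_hom scal \<delta> i \<in> rel_ideal (tensor_rels R R)" if "i \<in> rel_ideal R" for i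
    using that by (rule rel_ideal_hom[of "free_hom scal \<delta>", rotated 4])
      (auto simp: scal.free_hom_simps two_sided_rel_ideal assms)
  then show ?thesis
    unfolding comult_def by (intro the_elem_cls) (simp add: cls_eq_iff scal.free_hom_add)
qed

lemma counit_cls:
  assumes "\<And>r. r \<in> R \<Longrightarrow> free_hom (\<lambda>c. c) e r = 0"
  shows "counit e (cls R p) = free_hom (\<lambda>c. c) e p"
proof -
  have "free_hom (\<lambda>c. c) e i \<in> {0}" if "i \<in> rel_ideal R" for i
    using that by (rule rel_ideal_hom[of "free_hom (\<lambda>c. c) e", rotated 4])
      (auto simp: scal_id.free_hom_simps two_sided_def assms)
  then show ?thesis
    unfolding counit_def by (intro the_elem_cls_additive scal_id.additive_free_hom) simp
qed

section \<open>The dual of a free bialgebra\<close>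

text \<open>
  The free algebra on a grouplike letter \<open>LK\<close> and two skew-primitive letters \<open>LE\<close>, \<open>LG\<close> with
  coproduct \<open>l \<otimes> LK + 1 \<otimes> l\<close> is a bialgebra that maps onto the small quantum group
  (\<open>LG\<close> standing for \<open>K F\<close>). Its linear dual consists of all functions on words, so its convolution
  product makes a fixed type into a ring, in which the quantized coordinate algebra embeds. This
  reduces calculations in quotients to equations in a ring type.
\<close>

datatype letter = LK | LE | LG

datatype 'r wdual = WD (ev: "letter list \<Rightarrow> 'r")

lemma wdual_eqI: "(\<And>w. ev X w = ev Y w) \<Longrightarrow> X = Y"
  by (cases X; cases Y) auto

text \<open>The coproduct of \<open>l # w\<close> is that of \<open>l\<close> times that of
  \<open>w\<close>, so the two tensor factors of each term for \<open>l\<close> are prepended to the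
  arguments of \<open>f\<close> and \<open>g\<close>.\<close>

fun conv :: "(letter list \<Rightarrow> 'r::ring_1) \<Rightarrow> (letter list \<Rightarrow> 'r) \<Rightarrow> letter list \<Rightarrow> 'r" where
  "conv f g [] = f [] * g []"
| "conv f g (LK # w) = conv (\<lambda>v. f (LK # v)) (\<lambda>v. g (LK # v)) w"
| "conv f g (LE # w) = conv (\<lambda>v. f (LE # v)) (\<lambda>v. g (LK # v)) w + conv f (\<lambda>v. g (LE # v)) w"
| "conv f g (LG # w) = conv (\<lambda>v. f (LG # v)) (\<lambda>v. g (LK # v)) w + conv f (\<lambda>v. g (LG # v)) w"

lemma conv_add_left: "conv (\<lambda>v. f v + f' v) g w = conv f g w + conv f' g w"
proof (induction w arbitrary: f f' g)
  case (Cons l w)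
  then show ?case by (cases l) (simp_all add: add_ac)
qed (simp add: distrib_right)

lemma conv_add_right: "conv f (\<lambda>v. g v + g' v) w = conv f g w + conv f g' w"
proof (induction w arbitrary: f g g')
  case (Cons l w)
  then show ?case by (cases l) (simp_all add: add_ac)
qed (simp add: distrib_left)

lemma conv_assoc: "conv (conv f g) h w = conv f (conv g h) w"
proof (induction w arbitrary: f g h)
  case (Cons l w)
  then show ?case by (cases l) (simp_all add: conv_add_left conv_add_right add_ac)
qed (simp add: mult.assoc)

lemma conv_0_left: "conv (\<lambda>_. 0) g w = 0"
proof (induction w arbitrary: g)
  case (Cons l w)
  then show ?case by (cases l) simp_all
qed simp

lemma conv_0_right: "conv g (\<lambda>_. 0) w = 0"
proof (induction w arbitrary: g)
  case (Cons l w)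
  then show ?case by (cases l) simp_all
qed simp

definition weps :: "letter list \<Rightarrow> 'r::ring_1" where
  "weps w = (if set w \<subseteq> {LK} then 1 else 0)"

lemma weps_simps [simp]: "weps [] = 1" "weps (LK # w) = weps w" "weps (LE # w) = 0" "weps (LG # w) = 0"
  by (simp_all add: weps_def)

lemma conv_eps_left: "conv weps g w = g w"
proof (induction w arbitrary: g)
  case (Cons l w)
  then show ?case by (cases l) (simp_all add: conv_0_left)
qed simp

lemma conv_eps_right: "conv g weps w = g w"
proof (induction w arbitrary: g)
  case (Cons l w)
  then show ?case by (cases l) (simp_all add: conv_0_right)
qed simp

instantiation wdual :: (ring_1) ring_1
begin

definition "0 = WD (\<lambda>_. 0)"
definition "1 = WD weps"
definition "X + Y = WD (\<lambda>w. ev X w + ev Y w)"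
definition "X - Y = WD (\<lambda>w. ev X w - ev Y w)"
definition "- X = WD (\<lambda>w. - ev X w)"
definition "X * Y = WD (conv (ev X) (ev Y))"

instance
proof
  fix a b c :: "'a wdual"
  show "a * b * c = a * (b * c)"
    by (simp add: times_wdual_def conv_assoc fun_eq_iff)
  show "1 * a = a" "a * 1 = a"
    by (rule wdual_eqI, simp add: one_wdual_def times_wdual_def conv_eps_left conv_eps_right)+
  show "(a + b) * c = a * c + b * c" "a * (b + c) = a * b + a * c"
    by (rule wdual_eqI, simp add: plus_wdual_def times_wdual_def conv_add_left conv_add_right)+
  show "(0::'a wdual) \<noteq> 1"
    by (auto simp: zero_wdual_def one_wdual_def fun_eq_iff intro!: exI[of _ "[]"])
qed (rule wdual_eqI, simp add: zero_wdual_def plus_wdual_def uminus_wdual_def minus_wdual_def add_ac)+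

end

lemma ev_simps [simp]: "ev 0 w = 0" "ev (X + Y) w = ev X w + ev Y w" "ev (X - Y) w = ev X w - ev Y w"
  "ev (- X) w = - ev X w" "ev 1 w = weps w"
  by (simp_all add: zero_wdual_def plus_wdual_def minus_wdual_def uminus_wdual_def one_wdual_def)

lemma ev_mult: "ev (X * Y) = conv (ev X) (ev Y)"
  by (simp add: times_wdual_def)

lemma ev_mult_Nil [simp]: "ev (X * Y) [] = ev X [] * ev Y []"
  by (simp add: ev_mult)

lemma ev_sum: "ev (sum f A) w = (\<Sum>a\<in>A. ev (f a) w)"
  by (induction A rule: infinite_finite_induct) simp_all

definition sm :: "'r::ring_1 \<Rightarrow> 'r wdual \<Rightarrow> 'r wdual" where
  "sm c X = WD (\<lambda>w. c * ev X w)"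

text \<open>The right action of a letter on functionals: acting by \<open>l\<close> and then
  evaluating at \<open>w\<close> is evaluating at the product \<open>l w\<close>.\<close>

definition rt :: "letter \<Rightarrow> 'r wdual \<Rightarrow> 'r wdual" where
  "rt l X = WD (\<lambda>w. ev X (l # w))"

lemma ev_sm [simp]: "ev (sm c X) w = c * ev X w" and ev_rt: "ev (rt l X) w = ev X (l # w)"
  by (simp_all add: sm_def rt_def)

lemma conv_scale_left: "conv (\<lambda>v. c * f v) g w = c * conv f g w"
proof (induction w arbitrary: f g)
  case (Cons l w)
  then show ?case by (cases l) (simp_all add: distrib_left)
qed (simp add: mult.assoc)

lemma conv_scale_right: "conv f (\<lambda>v. (c::'k::field) * g v) w = c * conv f g w"
proof (induction w arbitrary: f g)
  case (Cons l w)
  then show ?case by (cases l) (simp_all add: distrib_left)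
qed simp

lemma sm_mult_left [simp]: "sm c X * Y = sm c (X * Y)"
  by (rule wdual_eqI) (simp add: ev_mult, simp add: sm_def conv_scale_left)

lemma sm_mult_right [simp]: "X * sm (c::'k::field) Y = sm c (X * Y)"
  by (rule wdual_eqI) (simp add: ev_mult, simp add: sm_def conv_scale_right)

lemma sm_simps [simp]: "sm c (sm d X) = sm (c * d) X" "sm 1 X = X" "sm 0 X = 0" "sm c 0 = 0"
  "sm c (- X) = - sm c X" "sm (- c) X = - sm c X"
  by (rule wdual_eqI, simp add: mult.assoc)+

lemma sm_distrib: "sm c (X + Y) = sm c X + sm c Y" "sm (c + d) X = sm c X + sm d X"
  "sm c (X - Y) = sm c X - sm c Y" "sm (c - d) X = sm c X - sm d X"
  by (rule wdual_eqI, simp add: algebra_simps)+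

lemma sm_cancel: "(c::'k::field) \<noteq> 0 \<Longrightarrow> sm c X = sm c Y \<longleftrightarrow> X = Y"
  by (metis sm_simps(1,2) left_inverse)

lemma sm_eq_0_iff: "sm (c::'k::field) X = 0 \<longleftrightarrow> c = 0 \<or> X = 0"
  using sm_cancel[of c X 0] by auto

lemma sm_sum: "sm c (sum f A) = (\<Sum>a\<in>A. sm c (f a))"
  by (induction A rule: infinite_finite_induct) (simp_all add: sm_distrib)

lemma sm_power: "sm (c::'k::field) X ^ n = sm (c ^ n) (X ^ n)"
  by (induction n) (simp_all add: mult.commute)

interpretation sm: scalar_emb "\<lambda>c :: 'k::field. sm c (1 :: 'k wdual)"
  by standard (simp_all add: sm_distrib mult.commute)

lemma rt_simps [simp]: "rt l 0 = 0" "rt l (X + Y) = rt l X + rt l Y" "rt l (X - Y) = rt l X - rt l Y"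
  "rt l (- X) = - rt l X" "rt l (sm c X) = sm c (rt l X)"
  by (rule wdual_eqI, simp add: ev_rt)+

lemma rt_sum: "rt l (sum f A) = (\<Sum>a\<in>A. rt l (f a))"
  by (induction A rule: infinite_finite_induct) simp_all

lemma rt_one [simp]: "rt LK 1 = 1" "rt LE 1 = 0" "rt LG 1 = 0"
  by (rule wdual_eqI, simp add: ev_rt)+

lemma rt_mult: "rt LK (X * Y) = rt LK X * rt LK Y"
  "rt LE (X * Y) = rt LE X * rt LK Y + X * rt LE Y"
  "rt LG (X * Y) = rt LG X * rt LK Y + X * rt LG Y"
  by (rule wdual_eqI, simp add: ev_rt ev_mult rt_def)+

lemma rt_K_power: "rt LK (X ^ n) = rt LK X ^ n"
  by (induction n) (simp_all add: rt_mult)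

text \<open>The coproduct dual to concatenation, in curried form: a functional on pairs of words is
  stored as a \<open>wdual\<close> with values in \<open>wdual\<close>, so the tensor square is
  again a ring type with a convolution product.\<close>

definition cur :: "'r wdual \<Rightarrow> 'r wdual wdual" where
  "cur X = WD (\<lambda>w. WD (\<lambda>w'. ev X (w @ w')))"

lemma ev_cur: "ev (ev (cur X) w) w' = ev X (w @ w')"
  by (simp add: cur_def)

lemma cur_add: "cur (X + Y) = cur X + cur Y"
  by (intro wdual_eqI) (simp add: ev_cur)

lemma cur_Cons: "(\<lambda>v. ev (cur X) (l # v)) = ev (cur (rt l X))"
  by (rule ext) (simp add: cur_def rt_def)

lemma cur_mult: "cur (X * Y) = cur X * cur Y"
proof (rule wdual_eqI, rule wdual_eqI)
  fix w w'
  show "ev (ev (cur (X * Y)) w) w' = ev (ev (cur X * cur Y) w) w'"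
  proof (induction w arbitrary: X Y)
    case Nil
    have "ev (cur X) [] = X" for X :: "'a wdual" by (rule wdual_eqI) (simp add: ev_cur)
    then show ?case by simp
  next
    case (Cons l w)
    have "ev (ev (cur (X * Y)) (l # w)) w' = ev (ev (cur (rt l (X * Y))) w) w'"
      by (simp add: ev_cur ev_rt)
    then show ?case
      using Cons[of "rt LK X" "rt LK Y"] Cons[of "rt l X" "rt LK Y"] Cons[of X "rt l Y"]
      by (cases l) (simp_all add: rt_mult cur_add ev_mult cur_Cons)
  qed
qed

text \<open>The words without \<open>LE\<close> span the Borel subalgebra generated by \<open>K\<close> and \<open>F\<close>.\<close>

definition res :: "'r::ring_1 wdual \<Rightarrow> 'r wdual" where
  "res X = WD (\<lambda>w. if LE \<in> set w then 0 else ev X w)"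

lemma ev_res: "ev (res X) w = (if LE \<in> set w then 0 else ev X w)"
  by (simp add: res_def)

lemma res_simps [simp]: "res 0 = 0" "res 1 = 1" "res (X + Y) = res X + res Y" "res (X - Y) = res X - res Y"
  "res (- X) = - res X" "res (sm c X) = sm c (res X)"
  by (rule wdual_eqI, simp add: ev_res weps_def; fail)+ (rule wdual_eqI, auto simp add: ev_res weps_def)+

lemma rt_res: "rt LE (res X) = 0" "rt LK (res X) = res (rt LK X)" "rt LG (res X) = res (rt LG X)"
  by (rule wdual_eqI, simp add: ev_res ev_rt)+

text \<open>The coproducts of \<open>LK\<close> and \<open>LG\<close> do not involve
  \<open>LE\<close>, so the words avoiding \<open>LE\<close> span a subcoalgebra. Extension by zero
  keeps the restriction in the same ring type.\<close>

lemma res_mult [simp]: "res (X * Y) = res X * res Y"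
proof (rule wdual_eqI)
  fix w
  show "ev (res (X * Y)) w = ev (res X * res Y) w"
  proof (induction w arbitrary: X Y)
    case (Cons l w)
    have "ev (res (X * Y)) (l # w) = ev (rt l (res (X * Y))) w"
      "ev (res X * res Y) (l # w) = ev (rt l (res X * res Y)) w"
      by (simp_all add: ev_rt)
    then show ?case
      using Cons[of "rt LK X" "rt LK Y"] Cons[of "rt l X" "rt LK Y"] Cons[of X "rt l Y"]
      by (cases l) (simp_all add: rt_mult rt_res)
  qed (simp add: ev_res)
qed

lemma res_power: "res (X ^ n) = res X ^ n"
  by (induction n) simp_all

lemma res_sum: "res (sum f A) = (\<Sum>a\<in>A. res (f a))"
  by (induction A rule: infinite_finite_induct) simp_all

section \<open>The binomial theorem at a root of unity\<close>

lemma q_num_Suc: "q_num t (Suc m) = 1 + t * q_num t m"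
  unfolding q_num_def by (simp add: sum.lessThan_Suc_shift sum_distrib_left del: sum.lessThan_Suc)

lemma q_num_0 [simp]: "q_num t 0 = 0"
  by (simp add: q_num_def)

lemma q_num_geometric: "(t - 1) * q_num t m = t ^ m - 1"
  by (induction m) (simp_all add: q_num_Suc algebra_simps)

lemma q_num_Suc_right: "q_num t (Suc m) = q_num t m + t ^ m"
  by (simp add: q_num_def)

fun gauss_binom :: "'k::field \<Rightarrow> nat \<Rightarrow> nat \<Rightarrow> 'k" where
  "gauss_binom t n 0 = 1"
| "gauss_binom t 0 (Suc k) = 0"
| "gauss_binom t (Suc n) (Suc k) = gauss_binom t n k + t ^ Suc k * gauss_binom t n (Suc k)"

text \<open>A quotient of factorials would divide by zero at a root of unity; this absorption
  identity is free of division.\<close>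

lemma gauss_binom_absorb: "q_num t (Suc k) * gauss_binom t (Suc n) (Suc k) = q_num t (Suc n) * gauss_binom t n k"
proof (induction n arbitrary: k)
  case 0
  then show ?case by (cases k) (simp_all add: q_num_Suc)
next
  case (Suc n)
  show ?case
  proof (cases k)
    case 0
    then show ?thesis using Suc[of 0] by (simp add: q_num_Suc)
  next
    case (Suc j)
    let ?g = "gauss_binom t (Suc n) (Suc j)"
    note IH = Suc.IH[of j] Suc.IH[of "Suc j"]
    have "q_num t (Suc (Suc j)) * gauss_binom t (Suc (Suc n)) (Suc (Suc j))
      = q_num t (Suc (Suc j)) * ?g + t ^ Suc (Suc j) * (q_num t (Suc (Suc j)) * gauss_binom t (Suc n) (Suc (Suc j)))"
      by (simp del: gauss_binom.simps add: gauss_binom.simps(3)[of t "Suc n"] algebra_simps)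
    also have "\<dots> = ?g + t * (q_num t (Suc j) * ?g)
        + t ^ Suc (Suc j) * (q_num t (Suc n) * gauss_binom t n (Suc j))"
      unfolding IH(2) by (simp add: q_num_Suc[of t "Suc j"] algebra_simps)
    also have "\<dots> = ?g + t * q_num t (Suc n) * (gauss_binom t n j + t ^ Suc j * gauss_binom t n (Suc j))"
      unfolding IH(1) by (simp add: algebra_simps)
    also have "\<dots> = q_num t (Suc (Suc n)) * ?g"
      by (simp add: q_num_Suc[of t "Suc n"] algebra_simps)
    finally show ?thesis using Suc by simp
  qed
qed

lemma gauss_binom_eq_0: "n < k \<Longrightarrow> gauss_binom t n k = 0"
  by (induction t n k rule: gauss_binom.induct) simp_all

lemma gauss_binom_self: "gauss_binom t n n = 1"
  by (induction n) (simp_all add: gauss_binom_eq_0)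

lemma gauss_binom_root:
  assumes "t ^ N = 1" "\<And>m. 0 < m \<Longrightarrow> m < N \<Longrightarrow> t ^ m \<noteq> 1" "0 < k" "k < N"
  shows "gauss_binom t N k = 0"
proof -
  obtain n j where nj: "N = Suc n" "k = Suc j"
    using assms(3,4) by (metis Suc_pred less_trans)
  have "t \<noteq> 1" using assms(2)[of 1] assms(3,4) by auto
  moreover have "t ^ k \<noteq> 1" using assms by simp
  ultimately have "q_num t N = 0" "q_num t k \<noteq> 0"
    using q_num_geometric[of t N] q_num_geometric[of t k] assms(1) by auto
  then show ?thesis using gauss_binom_absorb[of t j n] by (simp add: nj)
qed

section \<open>Elements that commute up to a scalar modulo an ideal\<close>

lemma cls_mult_cong: "cls R p = cls R p' \<Longrightarrow> cls R r = cls R r' \<Longrightarrow> cls R (p * r) = cls R (p' * r')"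
  by (metis pres_alg_mult)

lemma cls_add_cong: "cls R p = cls R p' \<Longrightarrow> cls R r = cls R r' \<Longrightarrow> cls R (p + r) = cls R (p' + r')"
  by (metis pres_alg_add)

lemma cls_sum_cong: "(\<And>i. i \<in> A \<Longrightarrow> cls R (f i) = cls R (g i)) \<Longrightarrow> cls R (sum f A) = cls R (sum g A)"
proof (induction A rule: infinite_finite_induct)
  case (insert x F)
  then show ?case by (simp only: sum.insert[OF insert(1,2)]) (intro cls_add_cong, auto)
qed simp_all

lemma q_commute_power:
  assumes "cls R (Y * X) = cls R (scal t * (X * Y))"
  shows "cls R (Y * X ^ n) = cls R (scal (t ^ n) * (X ^ n * Y))"
proof (induction n)
  case (Suc n)
  have "cls R (Y * X ^ Suc n) = cls R (Y * X ^ n * X)"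
    by (simp add: power_commutes mult.assoc)
  also have "\<dots> = cls R (scal (t ^ n) * (X ^ n * Y) * X)"
    by (rule cls_mult_cong[OF Suc refl])
  also have "\<dots> = cls R (scal (t ^ n) * X ^ n * (Y * X))"
    by (simp add: mult.assoc)
  also have "\<dots> = cls R (scal (t ^ n) * X ^ n * (scal t * (X * Y)))"
    by (rule cls_mult_cong[OF refl assms])
  also have "scal (t ^ n) * X ^ n * (scal t * (X * Y)) = scal (t ^ Suc n) * (X ^ Suc n * Y)"
    by (simp only: mult.assoc scal_central_left[of "X ^ n" t] power_Suc2 scal_mult)
  finally show ?case .
qed simp

lemma q_commute_power_left:
  assumes "cls R (Y * X) = cls R (scal t * (X * Y))"
  shows "cls R (Y ^ n * X) = cls R (scal (t ^ n) * (X * Y ^ n))"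
proof (induction n)
  case (Suc n)
  have "cls R (Y ^ Suc n * X) = cls R (Y * (Y ^ n * X))"
    by (simp add: mult.assoc)
  also have "\<dots> = cls R (Y * (scal (t ^ n) * (X * Y ^ n)))"
    by (rule cls_mult_cong[OF refl Suc])
  also have "Y * (scal (t ^ n) * (X * Y ^ n)) = scal (t ^ n) * (Y * X * Y ^ n)"
    by (simp only: mult.assoc scal_central_left[of Y "t ^ n"])
  also have "cls R \<dots> = cls R (scal (t ^ n) * (scal t * (X * Y) * Y ^ n))"
    by (intro cls_mult_cong assms refl)
  also have "scal (t ^ n) * (scal t * (X * Y) * Y ^ n) = scal (t ^ Suc n) * (X * Y ^ Suc n)"
    by (simp only: mult.assoc power_Suc2[of t] power_Suc[of Y] scal_mult)
  finally show ?case .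
qed simp

lemma q_binomial:
  assumes "cls R (Y * X) = cls R (scal t * (X * Y))"
  shows "cls R ((X + Y) ^ n) = cls R (\<Sum>i\<le>n. scal (gauss_binom t n i) * (X ^ i * Y ^ (n - i)))"
proof (induction n)
  case (Suc n)
  let ?g = "gauss_binom t n"
  let ?h = "\<lambda>i. scal (t ^ i * ?g i) * (X ^ i * Y ^ (Suc n - i))"
  have "cls R ((X + Y) ^ Suc n) = cls R ((X + Y) * (\<Sum>i\<le>n. scal (?g i) * (X ^ i * Y ^ (n - i))))"
    unfolding power_Suc by (rule cls_mult_cong[OF refl Suc])
  also have "(X + Y) * (\<Sum>i\<le>n. scal (?g i) * (X ^ i * Y ^ (n - i)))
    = (\<Sum>i\<le>n. scal (?g i) * (X ^ Suc i * Y ^ (n - i)) + scal (?g i) * ((Y * X ^ i) * Y ^ (n - i)))"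
    by (simp add: sum_distrib_left distrib_right sum.distrib mult.assoc scal_central_left distrib_left)
  also have "cls R \<dots> = cls R (\<Sum>i\<le>n. scal (?g i) * (X ^ Suc i * Y ^ (n - i))
      + scal (?g i) * ((scal (t ^ i) * (X ^ i * Y)) * Y ^ (n - i)))"
    by (intro cls_sum_cong cls_add_cong cls_mult_cong refl q_commute_power assms)
  also have "(\<Sum>i\<le>n. scal (?g i) * (X ^ Suc i * Y ^ (n - i))
      + scal (?g i) * ((scal (t ^ i) * (X ^ i * Y)) * Y ^ (n - i)))
    = (\<Sum>i\<le>n. scal (?g i) * (X ^ Suc i * Y ^ (n - i)) + ?h i)"
  proof (rule sum.cong[OF refl])
    fix i assume "i \<in> {..n}"
    then have "Y * Y ^ (n - i) = Y ^ (Suc n - i)" by (simp add: Suc_diff_le)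
    then show "scal (?g i) * (X ^ Suc i * Y ^ (n - i)) + scal (?g i) * ((scal (t ^ i) * (X ^ i * Y)) * Y ^ (n - i))
      = scal (?g i) * (X ^ Suc i * Y ^ (n - i)) + ?h i"
      by (simp add: scal_mult mult.assoc scal_central_left[of "scal (?g i)" "t ^ i"])
  qed
  also have "\<dots> = (\<Sum>i\<le>n. scal (?g i) * (X ^ Suc i * Y ^ (n - i))) + (\<Sum>i\<le>Suc n. ?h i)"
    by (simp add: sum.distrib gauss_binom_eq_0)
  also have "\<dots> = (\<Sum>i\<le>Suc n. scal (gauss_binom t (Suc n) i) * (X ^ i * Y ^ (Suc n - i)))"
    unfolding sum.atMost_Suc_shift[of _ n]
    by (simp add: sum.distrib[symmetric] scal_add distrib_right add.assoc add.left_commute del: sum.atMost_Suc)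
  finally show ?case .
qed simp

text \<open>All inner Gaussian coefficients vanish at a primitive \<open>N\<close>-th root of unity.
  This is what makes \<open>E^N = 0\<close> and \<open>F^N = 0\<close> compatible with the
  coproduct.\<close>

lemma q_binomial_root:
  assumes "cls R (Y * X) = cls R (scal t * (X * Y))"
    and "t ^ N = 1" "\<And>m. 0 < m \<Longrightarrow> m < N \<Longrightarrow> t ^ m \<noteq> 1" "0 < N"
  shows "cls R ((X + Y) ^ N) = cls R (X ^ N + Y ^ N)"
proof -
  have "(\<Sum>i\<le>N. scal (gauss_binom t N i) * (X ^ i * Y ^ (N - i)))
    = (\<Sum>i\<in>{0, N}. scal (gauss_binom t N i) * (X ^ i * Y ^ (N - i)))"
    using gauss_binom_root[OF assms(2,3)]
    by (intro sum.mono_neutral_right) (auto simp: neq0_conv)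
  also have "\<dots> = X ^ N + Y ^ N"
    using assms(4) by (simp add: gauss_binom_self add.commute)
  finally show ?thesis using q_binomial[OF assms(1), of N] by simp
qed

section \<open>The bialgebra structure of the small quantum group\<close>

locale root_of_unity =
  fixes N :: nat and q :: "'k :: field_char_0"
  assumes N_gt_1: "N > 1" and odd_N: "odd N" and q_N: "q ^ N = 1"
    and q_prim: "\<And>m. 0 < m \<Longrightarrow> m < N \<Longrightarrow> q ^ m \<noteq> 1"
begin

lemma q_nz [simp]: "q \<noteq> 0"
  using q_N N_gt_1 by (metis not_one_less_zero power_0_left zero_neq_one bot_nat_0.not_eq_extremum)

lemma q2_N: "(q\<^sup>2) ^ N = 1"
  by (metis q_N power_mult power_one mult.commute)

text \<open>Oddness of \<open>N\<close> rules out \<open>2 m = N\<close>, and if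
  \<open>2 m > N\<close> then the exponent \<open>2 m - N\<close>, which is less than
  \<open>N\<close>, contradicts primitivity of \<open>q\<close>.\<close>

lemma q2_prim: "0 < m \<Longrightarrow> m < N \<Longrightarrow> (q\<^sup>2) ^ m \<noteq> 1"
proof
  assume m: "0 < m" "m < N" and 1: "(q\<^sup>2) ^ m = 1"
  then have q2m: "q ^ (2 * m) = 1" by (simp add: power_mult)
  show False
  proof (cases "2 * m < N")
    case True
    then show False using q_prim[of "2 * m"] q2m m by simp
  next
    case False
    then have "2 * m \<noteq> N" "N \<le> 2 * m" using odd_N by auto
    moreover have "q ^ (2 * m - N) = 1"
      using q2m q_N \<open>N \<le> 2 * m\<close> by (metis le_add_diff_inverse mult_1 power_add)
    ultimately show False using q_prim[of "2 * m - N"] m by simp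
  qed
qed

lemma q_square_neq_1: "q\<^sup>2 \<noteq> 1"
  using q2_prim[of 1] N_gt_1 by simp

lemma q_minus_inverse: "q - inverse q \<noteq> 0"
  using q_square_neq_1 by (simp add: field_simps power2_eq_square)

lemma q_power_N1: "q ^ (N - 1) = inverse q"
proof -
  have "q ^ (N - 1) * q = 1" using q_N N_gt_1 by (metis power_minus_mult less_trans zero_less_one)
  then show ?thesis by (metis inverse_unique mult.commute)
qed

lemma q2_power_N1: "(q\<^sup>2) ^ (N - 1) = inverse (q\<^sup>2)"
  by (metis power_commutes power_inverse power_mult mult.commute q_power_N1)

abbreviation "RU \<equiv> U_rels N q"
abbreviation "RO \<equiv> O_rels N q"

lemma U_cls_rels:
  "gen UK ^ N - 1 \<in> rel_ideal RU" "gen UK * gen UE - scal (q\<^sup>2) * (gen UE * gen UK) \<in> rel_ideal RU"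
  "gen UK * gen UF - scal (inverse (q\<^sup>2)) * (gen UF * gen UK) \<in> rel_ideal RU"
  "gen UE ^ N \<in> rel_ideal RU" "gen UF ^ N \<in> rel_ideal RU"
  "gen UE * gen UF - gen UF * gen UE - scal (inverse (q - inverse q)) * (gen UK - gen UK ^ (N - 1)) \<in> rel_ideal RU"
  by (rule rel_ideal_self, simp add: U_rels_def Let_def mult.assoc)+

text \<open>\<open>K^(N-1)\<close> plays the role of the inverse of \<open>K\<close>; its
  commutation with \<open>E\<close> is needed for a mixed term in the coproduct of
  \<open>E F - F E\<close>.\<close>

lemma U_K_inv_E: "scal (inverse (q\<^sup>2)) * (gen UE * gen UK ^ (N - 1)) - gen UK ^ (N - 1) * gen UE \<in> rel_ideal RU"
  using q_commute_power_left[of RU "gen UK" "gen UE" "q\<^sup>2" "N - 1"] U_cls_rels(2)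
  unfolding q2_power_N1 cls_eq_iff by (metis rel_ideal_closed(5) minus_diff_eq)

lemma U_K_inv_F: "gen UK ^ (N - 1) * gen UF - scal (q\<^sup>2) * (gen UF * gen UK ^ (N - 1)) \<in> rel_ideal RU"
proof -
  have "inverse (q\<^sup>2) ^ (N - 1) = q\<^sup>2" by (metis power_inverse q2_power_N1 inverse_inverse_eq)
  then show ?thesis
    using q_commute_power_left[of RU "gen UK" "gen UF" "inverse (q\<^sup>2)" "N - 1"] U_cls_rels(3)
    unfolding cls_eq_iff by metis
qed

lemma U_delta_rels:
  assumes "r \<in> RU"
  shows "free_hom scal (U_delta N) r \<in> rel_ideal (tensor_rels RU RU)"
proof -
  let ?J = "rel_ideal (tensor_rels RU RU)"
  let ?K = "gen UK :: ugen list \<Rightarrow>\<^sub>0 'k" let ?E = "gen UE :: ugen list \<Rightarrow>\<^sub>0 'k"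
  let ?F = "gen UF :: ugen list \<Rightarrow>\<^sub>0 'k" let ?L = "?K ^ (N - 1)" let ?D = "free_hom scal (U_delta N)"
  let ?c = "inverse (q - inverse q)"
  note D = scal.free_hom_simps ptensor_mult ptensor_power
  note ex = distrib_left distrib_right right_diff_distrib left_diff_distrib ptensor_mult
    ptensor_add_left ptensor_add_right ptensor_diff ptensor_scal ptensor_minus mult.assoc
  note J = ptensor_rel_left[of _ RU _ RU] ptensor_rel_right[of _ RU _ RU]
  have 1: "?D (?K ^ N - 1) \<in> ?J"
  proof -
    have "?D (?K ^ N - 1) = ptensor (?K ^ N - 1) (?K ^ N) + ptensor 1 (?K ^ N - 1)"
      by (simp add: D ex ptensor_1_1)
    then show ?thesis using J U_cls_rels(1) by (simp add: rel_ideal_closed)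
  qed
  have 2: "?D (?K * ?E - scal (q\<^sup>2) * ?E * ?K) \<in> ?J"
  proof -
    have "?D (?K * ?E - scal (q\<^sup>2) * ?E * ?K)
      = ptensor (?K * ?E - scal (q\<^sup>2) * (?E * ?K)) (?K * ?K) + ptensor ?K (?K * ?E - scal (q\<^sup>2) * (?E * ?K))"
      by (simp add: D ex)
    then show ?thesis using J U_cls_rels(2) by (simp add: rel_ideal_closed)
  qed
  have 3: "?D (?K * ?F - scal (inverse (q\<^sup>2)) * ?F * ?K) \<in> ?J"
  proof -
    have "?D (?K * ?F - scal (inverse (q\<^sup>2)) * ?F * ?K)
      = ptensor (?K * ?F - scal (inverse (q\<^sup>2)) * (?F * ?K)) ?K
        + ptensor (?K * ?L) (?K * ?F - scal (inverse (q\<^sup>2)) * (?F * ?K))"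
      by (simp add: D ex power_commutes)
    then show ?thesis using J U_cls_rels(3) by (simp add: rel_ideal_closed)
  qed
  have 4: "?D (?E ^ N) \<in> ?J"
  proof -
    have "cls (tensor_rels RU RU) ((ptensor 1 ?E + ptensor ?E ?K) ^ N)
      = cls (tensor_rels RU RU) (ptensor 1 ?E ^ N + ptensor ?E ?K ^ N)"
    proof (rule q_binomial_root[OF _ q2_N q2_prim])
      have "ptensor ?E ?K * ptensor 1 ?E - scal (q\<^sup>2) * (ptensor 1 ?E * ptensor ?E ?K)
        = ptensor ?E (?K * ?E - scal (q\<^sup>2) * (?E * ?K))"
        by (simp add: ex)
      then show "cls (tensor_rels RU RU) (ptensor ?E ?K * ptensor 1 ?E)
        = cls (tensor_rels RU RU) (scal (q\<^sup>2) * (ptensor 1 ?E * ptensor ?E ?K))"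
        unfolding cls_eq_iff using J U_cls_rels(2) by simp
    qed (use N_gt_1 in auto)
    moreover have "ptensor 1 ?E ^ N + ptensor ?E ?K ^ N \<in> ?J"
      using J U_cls_rels(4) by (simp add: ptensor_power rel_ideal_closed)
    moreover have "?D (?E ^ N) = (ptensor 1 ?E + ptensor ?E ?K) ^ N"
      by (simp add: scal.free_hom_power scal.free_hom_gen add.commute)
    ultimately show ?thesis by (simp only: flip: cls_eq_0_iff)
  qed
  have 5: "?D (?F ^ N) \<in> ?J"
  proof -
    have "cls (tensor_rels RU RU) ((ptensor ?F 1 + ptensor ?L ?F) ^ N)
      = cls (tensor_rels RU RU) (ptensor ?F 1 ^ N + ptensor ?L ?F ^ N)"
    proof (rule q_binomial_root[OF _ q2_N q2_prim])
      have "ptensor ?L ?F * ptensor ?F 1 - scal (q\<^sup>2) * (ptensor ?F 1 * ptensor ?L ?F)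
        = ptensor (?L * ?F - scal (q\<^sup>2) * (?F * ?L)) ?F"
        by (simp add: ex)
      then show "cls (tensor_rels RU RU) (ptensor ?L ?F * ptensor ?F 1)
        = cls (tensor_rels RU RU) (scal (q\<^sup>2) * (ptensor ?F 1 * ptensor ?L ?F))"
        unfolding cls_eq_iff using J U_K_inv_F by simp
    qed (use N_gt_1 in auto)
    moreover have "ptensor ?F 1 ^ N + ptensor ?L ?F ^ N \<in> ?J"
      using J U_cls_rels(5) by (simp add: ptensor_power rel_ideal_closed)
    moreover have "?D (?F ^ N) = (ptensor ?F 1 + ptensor ?L ?F) ^ N"
      by (simp add: scal.free_hom_power scal.free_hom_gen)
    ultimately show ?thesis by (simp only: flip: cls_eq_0_iff)
  qed
  have 6: "?D (?E * ?F - ?F * ?E - scal ?c * (?K - ?L)) \<in> ?J"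
  proof -
    let ?r = "?E * ?F - ?F * ?E - scal ?c * (?K - ?L)"
    \<comment> \<open>With \<open>L = K^(N-1)\<close>, the mixed terms of the coproduct are
      \<open>E L \<otimes> K F - L E \<otimes> F K\<close>; inserting
      \<open>q^-2 E L \<otimes> F K\<close> with both signs turns them into two commutation
      relators.\<close>
    have "?D ?r = ptensor ?r ?K + ptensor ?L ?r
      + ptensor (?E * ?L) (?K * ?F - scal (inverse (q\<^sup>2)) * (?F * ?K))
      + ptensor (scal (inverse (q\<^sup>2)) * (?E * ?L) - ?L * ?E) (?F * ?K)"
      by (simp add: D ex)
    then show ?thesis using J U_cls_rels(3,6) U_K_inv_E by (simp add: rel_ideal_closed)
  qed
  show ?thesis
    using assms 1 2 3 4 5 6 by (auto simp: U_rels_def Let_def)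
qed

lemma U_comult: "comult RU (U_delta N) (cls RU p) = cls (tensor_rels RU RU) (free_hom scal (U_delta N) p)"
  by (rule comult_cls) (rule U_delta_rels)

lemma U_counit: "counit U_eps (cls RU p) = free_hom (\<lambda>c. c) U_eps p"
  by (rule counit_cls) (use N_gt_1 in \<open>auto simp: U_rels_def Let_def scal_id.free_hom_simps zero_power\<close>)

subsection \<open>The two-dimensional representation\<close>

definition rho_word :: "ugen list \<Rightarrow> 'k^2^2" where
  "rho_word w = foldr (\<lambda>g M. rho_gen q g ** M) w (mat 1)"

definition rho_rep :: "(ugen list \<Rightarrow>\<^sub>0 'k) \<Rightarrow> 'k^2^2" where
  "rho_rep p = (\<chi> i j. psum (\<lambda>c w. c * rho_word w $ i $ j) p)"

lemma rho_word_append: "rho_word (v @ w) = rho_word v ** rho_word w"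
  by (induction v) (simp_all add: rho_word_def matrix_mul_assoc)

lemma rho_rep_add: "rho_rep (p + r) = rho_rep p + rho_rep r"
  unfolding rho_rep_def vec_eq_iff
  by (simp add: additive.add[OF additive_psum] distrib_right)

lemma rho_rep_single: "rho_rep (Poly_Mapping.single w c) $ i $ j = c * rho_word w $ i $ j"
  by (simp add: rho_rep_def psum_single)

lemma rho_rep_mult: "rho_rep (p * r) = rho_rep p ** rho_rep r"
proof (induction p rule: pm_induct)
  case (single w c)
  show ?case
  proof (induction r rule: pm_induct)
    case (single v d)
    show ?case
      by (simp add: vec_eq_iff mult_single plus_list_def rho_rep_single rho_word_append
          matrix_matrix_mult_def sum_2 algebra_simps)
  qed (simp add: distrib_left rho_rep_add matrix_add_ldistrib)
qed (simp add: distrib_right rho_rep_add vec_eq_iff matrix_matrix_mult_def sum_2 algebra_simps)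

lemma rho_rep_gen: "rho_rep (gen g) = rho_gen q g"
  by (simp add: vec_eq_iff gen_def rho_rep_single rho_word_def)

lemma rho_rep_scal: "rho_rep (scal c * p) $ i $ j = c * rho_rep p $ i $ j"
proof -
  have "rho_rep (scal c) = mat c"
    by (simp add: vec_eq_iff scal_def rho_rep_single rho_word_def zero_list_def mat_def)
  then show ?thesis
    unfolding rho_rep_mult using exhaust_2[of i]
    by (auto simp: matrix_matrix_mult_def sum_2 mat_def)
qed

lemma rho_rep_one: "rho_rep 1 = mat 1"
proof -
  have "rho_word 0 = mat 1" by (simp add: rho_word_def zero_list_def)
  then show ?thesis using rho_rep_single[of 0 1] by (simp add: vec_eq_iff)
qed

lemma rho_rep_diff: "rho_rep (p - r) = rho_rep p - rho_rep r"
  using rho_rep_add[of "p - r" r] by simp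

lemma rho_rep_power_K: "rho_rep (gen UK ^ n) = vector [vector [q ^ n, 0], vector [0, inverse q ^ n]]"
  by (induction n)
    (simp_all add: rho_rep_one rho_rep_mult rho_rep_gen vec_eq_iff forall_2 matrix_matrix_mult_def sum_2 mat_def)

lemma rho_rep_square: "rho_rep (gen UE ^ Suc (Suc n)) = 0" "rho_rep (gen UF ^ Suc (Suc n)) = 0"
proof -
  have "rho_rep (gen UE * gen UE) = 0" "rho_rep (gen UF * gen UF) = 0"
    by (simp_all add: rho_rep_mult rho_rep_gen vec_eq_iff forall_2 matrix_matrix_mult_def sum_2)
  then show "rho_rep (gen UE ^ Suc (Suc n)) = 0" "rho_rep (gen UF ^ Suc (Suc n)) = 0"
    by (simp_all add: rho_rep_mult matrix_mul_assoc vec_eq_iff matrix_matrix_mult_def flip: mult.assoc)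
qed

lemma rho_rep_rels:
  assumes "p \<in> rel_ideal RU"
  shows "rho_rep p = 0"
proof -
  have "rho_rep 0 = 0" using rho_rep_diff[of 0 0] by simp
  moreover have "M ** (0 :: 'k^2^2) = 0" "(0 :: 'k^2^2) ** M = 0" for M :: "'k^2^2"
    by (simp_all add: vec_eq_iff matrix_matrix_mult_def)
  ultimately have "two_sided {p. rho_rep p = 0}"
    by (auto simp: two_sided_def rho_rep_add rho_rep_mult)
  moreover have "RU \<subseteq> {p. rho_rep p = 0}"
  proof -
    \<comment> \<open>The matrices of \<open>E\<close> and \<open>F\<close> already have square
      zero, so \<open>N \<ge> 2\<close> suffices for the nilpotency relators.\<close>
    obtain n where n: "N = Suc (Suc n)" using N_gt_1 by (intro that[of "N - 2"]) simp
    have e: "rho_rep (gen UE ^ N) = 0" "rho_rep (gen UF ^ N) = 0"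
      unfolding n by (rule rho_rep_square)+
    have i: "inverse q ^ N = 1" "inverse q ^ (N - 1) = q"
      using q_N q_power_N1 by (simp_all add: power_inverse)
    have c: "inverse (q - inverse q) * (q - inverse q) = 1" "inverse (q - inverse q) * (inverse q - q) = - 1"
      using q_minus_inverse by (simp_all add: field_simps)
    show ?thesis
      using c
      by (auto simp: U_rels_def Let_def rho_rep_diff rho_rep_scal e mult.assoc rho_rep_power_K rho_rep_one
          q_N i vec_eq_iff forall_2 mat_def)
        (auto simp: rho_rep_mult rho_rep_gen matrix_matrix_mult_def sum_2 power2_eq_square rho_rep_power_K
          q_power_N1[unfolded One_nat_def] i[unfolded One_nat_def])
  qed
  ultimately show ?thesis using rel_ideal_minimal assms by blast
qed

lemma rho_cls: "rho q (cls RU p) = rho_rep p"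
proof -
  have "rho q X = the_elem (rho_rep ` X)" for X
    by (simp add: rho_def rho_rep_def psum_def rho_word_def)
  then show ?thesis
    using the_elem_cls_additive[of rho_rep RU p] rho_rep_rels by (simp add: additive.intro rho_rep_add)
qed

end

section \<open>The coordinate algebra as functionals on words\<close>

text \<open>The pure tensor of \<open>X\<close> and \<open>Y\<close> in the curried encoding of
  \<open>cur\<close>.\<close>

definition box :: "'k::field wdual \<Rightarrow> 'k wdual \<Rightarrow> 'k wdual wdual" where
  "box X Y = WD (\<lambda>w. sm (ev X w) Y)"

lemma ev_box [simp]: "ev (box X Y) w = sm (ev X w) Y"
  by (simp add: box_def)

lemma conv_sm: "conv (\<lambda>v. sm (f v) X) (\<lambda>v. sm (g v) Y) w = sm (conv f g w) (X * Y :: 'k::field wdual)"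
proof (induction w arbitrary: f g)
  case (Cons l w)
  then show ?case by (cases l) (simp_all add: sm_distrib)
qed (simp add: mult.commute)

lemma box_mult: "box X Y * box X' Y' = box (X * X') (Y * Y')"
  by (rule wdual_eqI) (simp add: ev_mult box_def conv_sm)

lemma box_simps: "box (X + X') Y = box X Y + box X' Y" "box X (Y + Y') = box X Y + box X Y'"
  "box (X - X') Y = box X Y - box X' Y" "box (sm c X) Y = box X (sm c Y)" "box 0 Y = 0" "box X 0 = 0"
  by (rule wdual_eqI, simp add: sm_distrib mult.commute)+

fun emb :: "letter \<Rightarrow> ugen list" where
  "emb LK = [UK]"
| "emb LE = [UE]"
| "emb LG = [UK, UF]"

abbreviation embw :: "letter list \<Rightarrow> ugen list" where
  "embw w \<equiv> concat (map emb w)"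

locale coordinate_pairing = root_of_unity N q
  for N :: nat and q :: "'k :: field_char_0" +
  fixes \<phi> :: "(ogen list \<Rightarrow>\<^sub>0 'k) set \<Rightarrow> (ugen list \<Rightarrow>\<^sub>0 'k) set \<Rightarrow> 'k"
  assumes phi: "is_phi N q \<phi>"
begin

abbreviation wrep :: "letter list \<Rightarrow> ugen list \<Rightarrow>\<^sub>0 'k" where
  "wrep w \<equiv> Poly_Mapping.single (embw w) 1"

abbreviation wcls :: "letter list \<Rightarrow> (ugen list \<Rightarrow>\<^sub>0 'k) set" where
  "wcls w \<equiv> cls RU (wrep w)"

lemma single_Nil: "Poly_Mapping.single [] 1 = (1 :: 'g list \<Rightarrow>\<^sub>0 'k)"
  by (metis single_one zero_list_def)

lemma wrep_Nil: "wrep [] = 1"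
  by (simp add: single_Nil)

lemma wrep_Cons: "wrep (l # w) = Poly_Mapping.single (emb l) 1 * wrep w"
  by (simp add: mult_single plus_list_def)

lemma single_emb: "Poly_Mapping.single (emb LK) 1 = gen UK" "Poly_Mapping.single (emb LE) 1 = gen UE"
  "Poly_Mapping.single (emb LG) 1 = gen UK * gen UF"
  by (simp_all add: gen_def mult_single plus_list_def)

text \<open>\<open>F = K^(N-1) (K F)\<close> because \<open>K^N = 1\<close>, so the three letters
  reach all words although \<open>F\<close> itself is not a letter.\<close>

lemma wcls_span: "\<exists>w. cls RU (Poly_Mapping.single v 1) = wcls w"
proof (induction v)
  case Nil
  show ?case by (rule exI[of _ "[]"]) simp
next
  case (Cons g v)
  then obtain w where w: "cls RU (Poly_Mapping.single v 1) = wcls w" by blast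
  have "Poly_Mapping.single (g # v) 1 = gen g * (Poly_Mapping.single v 1 :: ugen list \<Rightarrow>\<^sub>0 'k)"
    by (simp add: gen_def mult_single plus_list_def)
  then have g: "cls RU (Poly_Mapping.single (g # v) 1) = cls RU (gen g * wrep w)"
    using cls_mult_cong[OF refl w] by metis
  show ?case
  proof (cases g)
    case UF
    have "wrep (replicate n LK @ LG # w) = gen UK ^ n * (gen UK * gen UF * wrep w)" for n
      by (induction n) (simp_all only: replicate_0 replicate_Suc append_Nil append_Cons wrep_Cons single_emb
          power_0 power_Suc mult_1_left mult.assoc)
    from this[of "N - 1"] have "wrep (replicate (N - 1) LK @ LG # w) = gen UK ^ N * (gen UF * wrep w)"
      using power_minus_mult[of N "gen UK :: ugen list \<Rightarrow>\<^sub>0 'k"] N_gt_1 by (simp add: mult.assoc[symmetric])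
    moreover have "cls RU (gen UK ^ N * (gen UF * wrep w)) = cls RU (1 * (gen UF * wrep w))"
      by (rule cls_mult_cong) (simp_all add: cls_eq_iff U_cls_rels)
    ultimately have "wcls (replicate (N - 1) LK @ LG # w) = cls RU (gen UF * wrep w)"
      by (simp only: mult_1_left)
    then show ?thesis using g UF by (intro exI[of _ "replicate (N - 1) LK @ LG # w"]) (simp only:)
  next
    case UK
    then show ?thesis using g by (intro exI[of _ "LK # w"]) (simp only: wrep_Cons single_emb)
  next
    case UE
    then show ?thesis using g by (intro exI[of _ "LE # w"]) (simp only: wrep_Cons single_emb)
  qed
qed

lemma lin_fun_eq:
  assumes "lin_fun RU F" "lin_fun RU G" "\<And>w. F (wcls w) = G (wcls w)"
  shows "F (cls RU p) = G (cls RU p)"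
proof (induction p rule: pm_induct)
  case (single v c)
  obtain w where "cls RU (Poly_Mapping.single v 1) = wcls w" using wcls_span by blast
  then show ?case
    using assms(3)[of w] lin_funD(4)[OF assms(1), of v c] lin_funD(4)[OF assms(2), of v c] by simp
qed (simp add: lin_funD(1)[OF assms(1)] lin_funD(1)[OF assms(2)])

lemma phi_iso: "\<phi> \<in> alg_iso (Oq N q) (dual_alg RU (U_delta N) U_eps)"
  using phi by (simp add: is_phi_def hopf_iso_dual_def)

lemma phi_props:
  assumes X: "X \<in> carrier (Oq N q)" and Y: "Y \<in> carrier (Oq N q)" and h: "h \<in> carrier (Uq N q)"
  shows "lin_fun RU (\<phi> X)" "\<phi> X \<in> extensional (carrier (Uq N q))"
    "\<phi> (X \<otimes>\<^bsub>Oq N q\<^esub> Y) h = tensor_fun RU RU (\<phi> X) (\<phi> Y) (comult RU (U_delta N) h)"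
    "\<phi> (X \<oplus>\<^bsub>Oq N q\<^esub> Y) h = \<phi> X h + \<phi> Y h"
    "\<phi> (c \<odot>\<^bsub>Oq N q\<^esub> X) h = c * \<phi> X h"
    "\<phi> (\<one>\<^bsub>Oq N q\<^esub>) h = counit U_eps h"
proof -
  let ?D = "dual_alg RU (U_delta N) U_eps"
  have hom: "\<phi> \<in> ring_hom (Oq N q) ?D" and sm: "\<And>c. \<phi> (c \<odot>\<^bsub>Oq N q\<^esub> X) = c \<odot>\<^bsub>?D\<^esub> \<phi> X"
    using phi_iso X by (auto simp: alg_iso_def ring_iso_def)
  have c: "\<phi> X \<in> carrier ?D" using hom X by (auto simp: ring_hom_def)
  then show "\<phi> X \<in> extensional (carrier (Uq N q))" by (simp add: dual_alg_def)
  from c show "lin_fun RU (\<phi> X)"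
    unfolding lin_fun_def dual_alg_def
    by (simp del: pres_alg_add pres_alg_smult add: pres_alg_add[symmetric] pres_alg_smult[symmetric])
  show "\<phi> (X \<otimes>\<^bsub>Oq N q\<^esub> Y) h = tensor_fun RU RU (\<phi> X) (\<phi> Y) (comult RU (U_delta N) h)"
    "\<phi> (X \<oplus>\<^bsub>Oq N q\<^esub> Y) h = \<phi> X h + \<phi> Y h" "\<phi> (\<one>\<^bsub>Oq N q\<^esub>) h = counit U_eps h"
    using hom X Y h unfolding ring_hom_def by (simp_all add: dual_alg_def del: pres_alg_one)
  show "\<phi> (c \<odot>\<^bsub>Oq N q\<^esub> X) h = c * \<phi> X h"
    unfolding sm using h by (simp add: dual_alg_def)
qed

lemma phi_lin: "lin_fun RU (\<phi> (cls RO f))"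
  using phi_props(1)[of "cls RO f" "cls RO f" "cls RU 0"] by simp

lemma phi_lin_left: "lin_fun RO (\<lambda>X. \<phi> X (cls RU p))"
  unfolding lin_fun_def
  using phi_props(4)[of "cls RO _" "cls RO _" "cls RU p"] phi_props(5)[of "cls RO _" "cls RO _" "cls RU p"]
  by simp

lemma phi_inj:
  assumes "X \<in> carrier (Oq N q)" "Y \<in> carrier (Oq N q)" "\<And>w. \<phi> X (wcls w) = \<phi> Y (wcls w)"
  shows "X = Y"
proof -
  have lin: "lin_fun RU (\<phi> X)" "lin_fun RU (\<phi> Y)"
    using assms(1,2) phi_lin by (auto simp: carrier_pres_alg)
  have "\<phi> X = \<phi> Y"
  proof (rule extensionalityI[of _ "carrier (Uq N q)"])
    show "\<phi> X \<in> extensional (carrier (Uq N q))" "\<phi> Y \<in> extensional (carrier (Uq N q))"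
      by (rule phi_props(2)[OF _ _ cls_carrier], rule assms(1,2), rule assms(1,2))+
    fix h assume "h \<in> carrier (Uq N q)"
    then obtain p where "h = cls RU p" by (auto simp: carrier_pres_alg)
    then show "\<phi> X h = \<phi> Y h" using lin_fun_eq[OF lin assms(3)] by simp
  qed
  moreover have "inj_on \<phi> (carrier (Oq N q))"
    using phi_iso by (auto simp: alg_iso_def ring_iso_def bij_betw_def)
  ultimately show ?thesis using assms(1,2) by (simp add: inj_on_eq_iff)
qed

definition psi :: "(ogen list \<Rightarrow>\<^sub>0 'k) set \<Rightarrow> 'k wdual" where
  "psi X = WD (\<lambda>w. \<phi> X (wcls w))"

abbreviation Phi :: "(ogen list \<Rightarrow>\<^sub>0 'k) \<Rightarrow> 'k wdual" where
  "Phi f \<equiv> psi (cls RO f)"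

lemma psi_inj: "X \<in> carrier (Oq N q) \<Longrightarrow> Y \<in> carrier (Oq N q) \<Longrightarrow> psi X = psi Y \<Longrightarrow> X = Y"
  by (rule phi_inj) (auto simp: psi_def fun_eq_iff)

text \<open>Injectivity of \<open>\<phi>\<close> identifies the coordinate algebra with a subring of
  \<open>wdual\<close>, so equations in the quotient become equations of functions on words.\<close>

lemma Phi_eq_0_iff: "Phi f = 0 \<longleftrightarrow> f \<in> rel_ideal RO"
proof -
  have "Phi 0 = 0"
    using lin_funD(3)[OF phi_lin_left] by (intro wdual_eqI) (simp add: psi_def)
  then have "Phi f = 0 \<longleftrightarrow> cls RO f = cls RO 0"
    using psi_inj[of "cls RO f" "cls RO 0"] by auto
  then show ?thesis by (simp add: cls_eq_0_iff)
qed

lemma Phi_add: "Phi (f + g) = Phi f + Phi g" and Phi_scal: "Phi (scal c * f) = sm c (Phi f)"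
  using lin_funD(1,2)[OF phi_lin_left] by (auto intro!: wdual_eqI simp: psi_def)

lemma Phi_diff: "Phi (f - g) = Phi f - Phi g"
  using Phi_add[of "f - g" g] by simp

lemma tfun_mult:
  assumes "lin_fun RU F" "lin_fun RU G" "lin_fun RU F'" "lin_fun RU G'"
    and "\<And>p. F (cls RU (x * p)) = F' (cls RU p)" "\<And>p. G (cls RU (y * p)) = G' (cls RU p)"
  shows "tfun RU RU F G (ptensor x y * t) = tfun RU RU F' G' t"
proof (induction t rule: pm_induct)
  case (single m c)
  have "Poly_Mapping.single m c = ptensor (Poly_Mapping.single (fst m) c) (Poly_Mapping.single (snd m) 1)"
    by (simp add: ptensor_single)
  then show ?case by (simp add: ptensor_mult tfun_ptensor assms)
qed (simp add: distrib_left additive.add[OF additive_tfun])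

text \<open>The coproduct of \<open>F\<close> has \<open>K^-1\<close> on its left, but that of
  \<open>K F\<close> is \<open>K F \<otimes> K + K^N \<otimes> K F\<close>, of the same shape as
  that of \<open>E\<close>. This is why the third letter stands for \<open>K F\<close>.\<close>

lemma tfun_delta_wrep:
  assumes "lin_fun RU F" "lin_fun RU G"
  shows "tfun RU RU F G (free_hom scal (U_delta N) (wrep w)) = conv (\<lambda>v. F (wcls v)) (\<lambda>v. G (wcls v)) w"
  using assms
proof (induction w arbitrary: F G)
  case Nil
  then show ?case
    unfolding wrep_Nil by (simp add: scal.free_hom_one tfun_ptensor single_Nil flip: ptensor_1_1)
next
  case (Cons l w)
  let ?D = "free_hom scal (U_delta N)"
  let ?L = "\<lambda>l F X. F (cls RU (Poly_Mapping.single (emb l) 1) \<otimes>\<^bsub>Uq N q\<^esub> X)"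
  have lin: "lin_fun RU (?L l F)" "lin_fun RU (?L l G)" for l
    by (rule lin_fun_mult_left, rule Cons.prems)+
  have L: "F (cls RU (wrep (l # v))) = ?L l F (wcls v)" for F :: "(ugen list \<Rightarrow>\<^sub>0 'k) set \<Rightarrow> 'k" and l v
    unfolding wrep_Cons by simp
  note IH = Cons.IH[OF lin(1) lin(2)] Cons.IH[OF Cons.prems(1) lin(2)] and tm = tfun_mult[OF Cons.prems]
  have pm: "ptensor x y * (ptensor x' y' * t) = ptensor (x * x') (y * y') * t"
    for x y x' y' :: "ugen list \<Rightarrow>\<^sub>0 'k" and t
    by (simp add: ptensor_mult mult.assoc[symmetric])
  have K: "?D (wrep (LK # w)) = ptensor (gen UK) (gen UK) * ?D (wrep w)"
    and E: "?D (wrep (LE # w)) = ptensor (gen UE) (gen UK) * ?D (wrep w) + ptensor 1 (gen UE) * ?D (wrep w)"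
    and G: "?D (wrep (LG # w)) = ptensor (gen UK * gen UF) (gen UK) * ?D (wrep w)
      + ptensor (gen UK ^ N) (gen UK * gen UF) * ?D (wrep w)"
    using N_gt_1 unfolding wrep_Cons single_emb
    by (simp_all add: scal.free_hom_simps distrib_right distrib_left pm mult.assoc power_eq_if[of _ N])
  have N: "F (cls RU (gen UK ^ N * p)) = F (cls RU p)" for p
  proof -
    have "cls RU (gen UK ^ N * p) = cls RU (1 * p)"
      by (rule cls_mult_cong) (simp_all add: cls_eq_iff U_cls_rels)
    then show ?thesis by simp
  qed
  show ?case
  proof (cases l)
    case LK
    have "tfun RU RU F G (?D (wrep (LK # w))) = tfun RU RU (?L LK F) (?L LK G) (?D (wrep w))"
      unfolding K by (intro tm lin) (simp_all add: gen_def mult_single plus_list_def)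
    then show ?thesis unfolding LK conv.simps L IH by simp
  next
    case LE
    have "tfun RU RU F G (?D (wrep (LE # w))) = tfun RU RU (?L LE F) (?L LK G) (?D (wrep w))
      + tfun RU RU F (?L LE G) (?D (wrep w))"
      unfolding E additive.add[OF additive_tfun]
      by (intro arg_cong2[where f = "(+)"] tm lin Cons.prems) (simp_all add: gen_def mult_single plus_list_def)
    then show ?thesis unfolding LE conv.simps L IH by simp
  next
    case LG
    have "tfun RU RU F G (?D (wrep (LG # w))) = tfun RU RU (?L LG F) (?L LK G) (?D (wrep w))
      + tfun RU RU F (?L LG G) (?D (wrep w))"
      unfolding G additive.add[OF additive_tfun]
      by (intro arg_cong2[where f = "(+)"] tm lin Cons.prems N) (simp_all add: gen_def mult_single plus_list_def)
    then show ?thesis unfolding LG conv.simps L IH by simp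
  qed
qed

lemma Phi_mult: "Phi (f * g) = Phi f * Phi g"
proof (rule wdual_eqI)
  fix w
  have "ev (Phi (f * g)) w = \<phi> (cls RO f \<otimes>\<^bsub>Oq N q\<^esub> cls RO g) (wcls w)"
    by (simp add: psi_def)
  also have "\<dots> = tfun RU RU (\<phi> (cls RO f)) (\<phi> (cls RO g)) (free_hom scal (U_delta N) (wrep w))"
    by (subst phi_props(3)) (simp_all add: U_comult tensor_fun_cls phi_lin del: pres_alg_mult)
  also have "\<dots> = ev (Phi f * Phi g) w"
    by (simp add: tfun_delta_wrep phi_lin ev_mult psi_def)
  finally show "ev (Phi (f * g)) w = ev (Phi f * Phi g) w" .
qed

lemma Phi_one: "Phi 1 = 1"
proof (rule wdual_eqI)
  fix w
  have "ev (Phi 1) w = counit U_eps (wcls w)"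
    using phi_props(6)[of "cls RO 1" "cls RO 1" "wcls w"] by (simp add: psi_def)
  also have "\<dots> = prod_list (map U_eps (embw w))"
    by (simp add: U_counit scal_id.free_hom_single)
  also have "\<dots> = weps w"
  proof (induction w)
    case (Cons l w)
    then show ?case by (cases l) simp_all
  qed simp
  finally show "ev (Phi 1) w = ev 1 w" by simp
qed

lemma Phi_power: "Phi (f ^ n) = Phi f ^ n"
  by (induction n) (simp_all add: Phi_one Phi_mult)

lemma Phi_scal_one: "Phi (scal c) = sm c 1"
  using Phi_scal[of c 1] by (simp add: Phi_one)

lemmas Phi_simps = Phi_add Phi_diff Phi_mult Phi_scal_one Phi_one Phi_power

lemma phi_gen:
  "ev (Phi (gen Oa)) w = rho_word (embw w) $ 1 $ 1" "ev (Phi (gen Ob)) w = rho_word (embw w) $ 1 $ 2"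
  "ev (Phi (gen Oc)) w = rho_word (embw w) $ 2 $ 1" "ev (Phi (gen Od)) w = rho_word (embw w) $ 2 $ 2"
proof -
  have "vector [vector [\<phi> (cls RO (gen Oa)) (wcls w), \<phi> (cls RO (gen Ob)) (wcls w)],
      vector [\<phi> (cls RO (gen Oc)) (wcls w), \<phi> (cls RO (gen Od)) (wcls w)]] = rho_rep (wrep w)"
    using phi unfolding is_phi_def rho_cls[symmetric] by blast
  then show "ev (Phi (gen Oa)) w = rho_word (embw w) $ 1 $ 1" "ev (Phi (gen Ob)) w = rho_word (embw w) $ 1 $ 2"
    "ev (Phi (gen Oc)) w = rho_word (embw w) $ 2 $ 1" "ev (Phi (gen Od)) w = rho_word (embw w) $ 2 $ 2"
    unfolding vec_eq_iff by (simp_all add: forall_2 rho_rep_single psi_def)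
qed

definition "PA = Phi (gen Oa)"
definition "PB = Phi (gen Ob)"
definition "PC = Phi (gen Oc)"
definition "PD = Phi (gen Od)"

lemmas P_defs = PA_def PB_def PC_def PD_def

text \<open>Prepending a letter multiplies the matrix on the left, so letters act on rows:
  \<open>K\<close> scales them, \<open>E\<close> takes \<open>a, b\<close> to \<open>c, d\<close>
  and kills \<open>c, d\<close>, and \<open>K F\<close> takes \<open>c, d\<close> to
  \<open>q^-1 a, q^-1 b\<close> and kills \<open>a, b\<close>.\<close>

lemma rt_gens:
  "rt LK PA = sm q PA" "rt LK PB = sm q PB" "rt LK PC = sm (inverse q) PC" "rt LK PD = sm (inverse q) PD"
  "rt LE PA = PC" "rt LE PB = PD" "rt LE PC = 0" "rt LE PD = 0"
  "rt LG PA = 0" "rt LG PB = 0" "rt LG PC = sm (inverse q) PA" "rt LG PD = sm (inverse q) PB"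
  unfolding P_defs
  by (rule wdual_eqI, simp add: ev_rt phi_gen rho_word_def matrix_matrix_mult_def sum_2)+

subsection \<open>The coproduct of the coordinate algebra\<close>

text \<open>
  The coproduct is well defined because \<open>P\<close> below, the tensor square of the embedding
  \<open>Phi\<close>, has the ideal of \<open>tensor_rels\<close> as its kernel, and turns the coproduct of \<open>f\<close>
  into \<open>(w, w') \<mapsto> Phi f (w w')\<close>.
\<close>

definition P :: "((ogen list \<times> ogen list) \<Rightarrow>\<^sub>0 'k) \<Rightarrow> 'k wdual wdual" where
  "P = psum (\<lambda>c (v, w). box (sm c (Phi (Poly_Mapping.single v 1))) (Phi (Poly_Mapping.single w 1)))"

lemma additive_P: "Modules.additive P"
  unfolding P_def by (intro additive_psum) (auto simp: sm_distrib box_simps)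

lemma Phi_single: "Phi (Poly_Mapping.single v c) = sm c (Phi (Poly_Mapping.single v 1))"
  using Phi_scal[of c "Poly_Mapping.single v 1"] by (simp add: scal_mult_single)

lemma P_ptensor: "P (ptensor p r) = box (Phi p) (Phi r)"
proof -
  have 1: "P (ptensor p (Poly_Mapping.single w b)) = box (Phi p) (Phi (Poly_Mapping.single w b))" for p w b
  proof (induction p rule: pm_induct)
    case (single v a)
    show ?case
      by (subst Phi_single, subst Phi_single)
        (simp add: ptensor_single P_def psum_single box_simps mult.commute)
  qed (simp add: ptensor_add_left additive.add[OF additive_P] Phi_add box_simps)
  show ?thesis
    by (induction r rule: pm_induct)
      (simp_all add: 1 ptensor_add_right additive.add[OF additive_P] Phi_add box_simps)
qed

lemma P_mult: "P (s * t) = P s * P t"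
proof -
  have *: "Poly_Mapping.single m c = ptensor (Poly_Mapping.single (fst m) c) (Poly_Mapping.single (snd m) 1)"
    for m :: "ogen list \<times> ogen list" and c :: 'k
    by (simp add: ptensor_single)
  show ?thesis
  proof (induction s rule: pm_induct)
    case (single m c)
    show ?case
    proof (induction t rule: pm_induct)
      case (single n d)
      then show ?case
        unfolding *[of m] *[of n] by (simp only: ptensor_mult P_ptensor Phi_mult box_mult)
    qed (simp add: distrib_left additive.add[OF additive_P])
  qed (simp add: distrib_right additive.add[OF additive_P])
qed

text \<open>Both sides are multiplicative, and on generators the claim is
  \<open>rho_word_append\<close>, the coproduct of a matrix coefficient.\<close>

lemma P_delta: "P (free_hom scal O_delta f) = cur (Phi f)"
proof (rule pm_ext)
  show "Modules.additive (\<lambda>f. P (free_hom scal O_delta f))"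
    by (simp add: additive.intro scal.free_hom_add additive.add[OF additive_P])
  show "Modules.additive (\<lambda>f. cur (Phi f))"
    by (simp add: additive.intro Phi_add cur_add)
  fix w and c :: 'k
  show "P (free_hom scal O_delta (Poly_Mapping.single w c)) = cur (Phi (Poly_Mapping.single w c))"
  proof (induction w)
    case Nil
    have "P (free_hom scal O_delta (scal c)) = box (Phi (scal c * 1)) (Phi 1)"
      unfolding scal.free_hom_scal by (subst scal_ptensor(1)) (simp add: P_ptensor)
    also have "\<dots> = cur (Phi (scal c * 1))"
      unfolding Phi_simps by (intro wdual_eqI) (simp add: ev_cur weps_def)
    finally have "P (free_hom scal O_delta (scal c)) = cur (Phi (scal c))"
      by (simp only: mult_1_right)
    moreover have "scal c = (Poly_Mapping.single [] c :: ogen list \<Rightarrow>\<^sub>0 'k)"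
      by (simp add: scal_def zero_list_def)
    ultimately show ?case by (simp only:)
  next
    case (Cons g w)
    have "P (O_delta g) = cur (Phi (gen g))"
      by (intro wdual_eqI, cases g)
        (simp_all add: additive.add[OF additive_P] P_ptensor ev_cur phi_gen rho_word_append
          matrix_matrix_mult_def sum_2)
    moreover have "Poly_Mapping.single (g # w) c = gen g * Poly_Mapping.single w c"
      by (simp add: gen_def mult_single plus_list_def)
    ultimately show ?case
      using Cons by (simp add: scal.free_hom_mult scal.free_hom_gen P_mult Phi_mult cur_mult)
  qed
qed

text \<open>The tensor square of an injective linear map is injective. The proof eliminates one pure
  tensor at a time: multiples of \<open>p\<close> are subtracted from the other left factors until
  these vanish at a word \<open>w\<close> where \<open>Phi p\<close> does not.\<close>

lemma P_kernel_list:
  assumes "(\<Sum>(p, r)\<leftarrow>ps. box (Phi p) (Phi r)) = 0"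
  shows "(\<Sum>(p, r)\<leftarrow>ps. ptensor p r) \<in> rel_ideal (tensor_rels RO RO)"
  using assms
proof (induction "length ps" arbitrary: ps)
  case 0
  then show ?case by (simp add: rel_ideal_closed)
next
  case (Suc n)
  then obtain p r qs where ps: "ps = (p, r) # qs" and n: "n = length qs"
    by (cases ps) auto
  have sum0: "box (Phi p) (Phi r) + (\<Sum>(p, r)\<leftarrow>qs. box (Phi p) (Phi r)) = 0"
    using Suc.prems by (simp add: ps)
  show ?case
  proof (cases "Phi p = 0")
    case True
    then have "ptensor p r \<in> rel_ideal (tensor_rels RO RO)"
      by (simp add: Phi_eq_0_iff ptensor_rel_left)
    moreover have "(\<Sum>(p, r)\<leftarrow>qs. ptensor p r) \<in> rel_ideal (tensor_rels RO RO)"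
      using sum0 True by (intro Suc.hyps(1)[OF n]) (simp add: box_simps)
    ultimately show ?thesis by (simp add: ps rel_ideal_closed)
  next
    case False
    then obtain w where w: "ev (Phi p) w \<noteq> 0"
      by (metis ev_simps(1) wdual_eqI)
    define e where "e p' = ev (Phi p') w / ev (Phi p) w" for p'
    \<comment> \<open>The total right factor now paired with \<open>p\<close>; evaluating the
      relation at \<open>w\<close> isolates it and forces \<open>Phi r' = 0\<close>.\<close>
    define r' where "r' = r + (\<Sum>(p', r')\<leftarrow>qs. scal (e p') * r')"
    define qs' where "qs' = map (\<lambda>(p', r'). (p' - scal (e p') * p, r')) qs"
    have "Phi (\<Sum>(p', r')\<leftarrow>as. scal (e p') * r') = (\<Sum>(p', r')\<leftarrow>as. sm (e p') (Phi r'))" for as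
      by (induction as) (auto simp: Phi_simps Phi_eq_0_iff rel_ideal_closed)
    moreover have "ev (\<Sum>(p', r')\<leftarrow>as. box (Phi p') (Phi r')) w = sm (ev (Phi p) w) (\<Sum>(p', r')\<leftarrow>as. sm (e p') (Phi r'))" for as
      by (induction as) (use w in \<open>auto simp: sm_distrib e_def\<close>)
    moreover have "ev (box (Phi p) (Phi r) + (\<Sum>(p, r)\<leftarrow>qs. box (Phi p) (Phi r))) w = 0"
      unfolding sum0 by simp
    ultimately have "sm (ev (Phi p) w) (Phi r') = 0"
      by (simp add: r'_def Phi_add sm_distrib)
    then have r': "Phi r' = 0" using w by (simp add: sm_eq_0_iff)
    have 1: "(\<Sum>(p, r)\<leftarrow>ps. ptensor p r) = (\<Sum>(p, r)\<leftarrow>qs'. ptensor p r) + ptensor p r'"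
    proof -
      have "(\<Sum>(p, r)\<leftarrow>as. ptensor p r) = (\<Sum>(p, r)\<leftarrow>map (\<lambda>(p', r'). (p' - scal (e p') * p, r')) as. ptensor p r)
        + ptensor p (\<Sum>(p', r')\<leftarrow>as. scal (e p') * r')" for as
        by (induction as) (auto simp: ptensor_diff(1) ptensor_scal ptensor_add_right)
      from this[of qs] show ?thesis by (simp add: ps r'_def qs'_def ptensor_add_right)
    qed
    have 2: "(\<Sum>(p, r)\<leftarrow>ps. box (Phi p) (Phi r)) = (\<Sum>(p, r)\<leftarrow>qs'. box (Phi p) (Phi r)) + box (Phi p) (Phi r')"
    proof -
      have "(\<Sum>(p, r)\<leftarrow>as. box (Phi p) (Phi r))
        = (\<Sum>(p, r)\<leftarrow>map (\<lambda>(p', r'). (p' - scal (e p') * p, r')) as. box (Phi p) (Phi r))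
        + box (Phi p) (Phi (\<Sum>(p', r')\<leftarrow>as. scal (e p') * r'))" for as
        by (induction as) (auto simp: Phi_simps box_simps Phi_eq_0_iff[THEN iffD2] rel_ideal_closed)
      from this[of qs] show ?thesis by (simp add: ps r'_def qs'_def Phi_add box_simps)
    qed
    have "(\<Sum>(p, r)\<leftarrow>qs'. ptensor p r) \<in> rel_ideal (tensor_rels RO RO)"
      using Suc.prems 2 r' n by (intro Suc.hyps(1)) (simp_all add: qs'_def box_simps)
    moreover have "ptensor p r' \<in> rel_ideal (tensor_rels RO RO)"
      using r' by (simp add: Phi_eq_0_iff ptensor_rel_right)
    ultimately show ?thesis unfolding 1 by (rule rel_ideal_closed)
  qed
qed

lemma P_kernel:
  assumes "P t = 0"
  shows "t \<in> rel_ideal (tensor_rels RO RO)"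
proof -
  have "\<exists>ps. t = (\<Sum>(p, r)\<leftarrow>ps. ptensor p r)"
  proof (induction t rule: pm_induct)
    case (single m c)
    show ?case
      by (rule exI[of _ "[(Poly_Mapping.single (fst m) c, Poly_Mapping.single (snd m) 1)]"])
        (simp add: ptensor_single)
  next
    case (add s t)
    then obtain ps qs where "s = (\<Sum>(p, r)\<leftarrow>ps. ptensor p r)" "t = (\<Sum>(p, r)\<leftarrow>qs. ptensor p r)" by blast
    then show ?case by (intro exI[of _ "ps @ qs"]) simp
  qed
  then obtain ps where ps: "t = (\<Sum>(p, r)\<leftarrow>ps. ptensor p r)" by blast
  have "P (\<Sum>(p, r)\<leftarrow>ps. ptensor p r) = (\<Sum>(p, r)\<leftarrow>ps. box (Phi p) (Phi r))"
    by (induction ps) (auto simp: additive.add[OF additive_P] additive.zero[OF additive_P] P_ptensor)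
  then show ?thesis using assms P_kernel_list unfolding ps by simp
qed

lemma O_comult: "comult RO O_delta (cls RO f) = cls (tensor_rels RO RO) (free_hom scal O_delta f)"
proof (rule comult_cls)
  fix r assume "r \<in> RO"
  then have "Phi r = 0" by (simp add: Phi_eq_0_iff rel_ideal_self)
  then have "P (free_hom scal O_delta r) = 0"
    unfolding P_delta by (intro wdual_eqI) (simp add: ev_cur)
  then show "free_hom scal O_delta r \<in> rel_ideal (tensor_rels RO RO)" by (rule P_kernel)
qed

subsection \<open>The right action\<close>

lemma ract_cls:
  "ract N q \<phi> (cls RO f) (cls RU p) = cls RO (tleft RO (\<lambda>X. \<phi> X (cls RU p)) (free_hom scal O_delta f))"
  unfolding ract_def O_comult by (rule tensor_left_cls) (rule phi_lin_left)

lemma ract_carrier: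
  "X \<in> carrier (Oq N q) \<Longrightarrow> h \<in> carrier (Uq N q) \<Longrightarrow> ract N q \<phi> X h \<in> carrier (Oq N q)"
  by (auto simp: carrier_pres_alg ract_cls)

lemma phi_ract:
  assumes "X \<in> carrier (Oq N q)"
  shows "\<phi> (ract N q \<phi> X (cls RU p)) (cls RU r) = \<phi> X (cls RU (p * r))"
proof -
  obtain f where f: "X = cls RO f" using assms by (auto simp: carrier_pres_alg)
  let ?F = "\<lambda>X. \<phi> X (cls RU p)" and ?G = "\<lambda>X. \<phi> X (cls RU r)"
  have "\<phi> (cls RO (tleft RO ?F t)) (cls RU r) = tfun RO RO ?F ?G t" for t
  proof (rule pm_ext)
    show "Modules.additive (\<lambda>t. \<phi> (cls RO (tleft RO ?F t)) (cls RU r))"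
      by (simp add: additive.intro additive.add[OF additive_tleft] lin_funD(1)[OF phi_lin_left])
    show "Modules.additive (tfun RO RO ?F ?G)" by (rule additive_tfun)
    fix m :: "ogen list \<times> ogen list" and c :: 'k
    have "Poly_Mapping.single m c = ptensor (Poly_Mapping.single (fst m) c) (Poly_Mapping.single (snd m) 1)"
      by (simp add: ptensor_single)
    then show "\<phi> (cls RO (tleft RO ?F (Poly_Mapping.single m c))) (cls RU r) = tfun RO RO ?F ?G (Poly_Mapping.single m c)"
      by (simp only: tleft_ptensor[OF phi_lin_left] tfun_ptensor[OF phi_lin_left phi_lin_left]
          lin_funD(2)[OF phi_lin_left])
  qed
  moreover have "tensor_fun RO RO ?F ?G (comult RO O_delta X) = \<phi> X (cls RU p \<otimes>\<^bsub>Uq N q\<^esub> cls RU r)"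
    using phi assms unfolding is_phi_def hopf_iso_dual_def by (metis cls_carrier)
  ultimately show ?thesis
    by (simp add: f ract_cls O_comult tensor_fun_cls phi_lin_left)
qed

lemma ev_psi_ract: "X \<in> carrier (Oq N q) \<Longrightarrow> ev (psi (ract N q \<phi> X (cls RU p))) w = \<phi> X (cls RU (p * wrep w))"
  by (simp add: psi_def phi_ract)

lemma ract_lin:
  assumes "X \<in> carrier (Oq N q)"
  shows "psi (ract N q \<phi> X (cls RU (p + r))) = psi (ract N q \<phi> X (cls RU p)) + psi (ract N q \<phi> X (cls RU r))"
    "psi (ract N q \<phi> X (cls RU (scal c * p))) = sm c (psi (ract N q \<phi> X (cls RU p)))"
    "psi (ract N q \<phi> X (cls RU 1)) = psi X"
    "psi (ract N q \<phi> X (cls RU (p * r))) = psi (ract N q \<phi> (ract N q \<phi> X (cls RU p)) (cls RU r))"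
  using phi_props(1)[OF assms assms, of "cls RU 0"] assms
  by (auto intro!: wdual_eqI simp: ev_psi_ract ract_carrier distrib_right mult.assoc lin_funD(1,2) phi_ract)
    (simp add: psi_def)

lemma ract_gens:
  assumes X: "X \<in> carrier (Oq N q)"
  shows "psi (ract N q \<phi> X (cls RU (gen UK))) = rt LK (psi X)"
    "psi (ract N q \<phi> X (cls RU (gen UE))) = rt LE (psi X)"
    "psi (ract N q \<phi> X (cls RU (gen UK * gen UF))) = rt LG (psi X)"
proof -
  have "psi (ract N q \<phi> X (cls RU (Poly_Mapping.single (emb l) 1))) = rt l (psi X)" for l
    by (rule wdual_eqI, simp only: ev_psi_ract[OF X] ev_rt, simp only: psi_def wdual.sel wrep_Cons)
  from this[of LK] this[of LE] this[of LG]
  show "psi (ract N q \<phi> X (cls RU (gen UK))) = rt LK (psi X)"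
    "psi (ract N q \<phi> X (cls RU (gen UE))) = rt LE (psi X)"
    "psi (ract N q \<phi> X (cls RU (gen UK * gen UF))) = rt LG (psi X)"
    unfolding single_emb .
qed

end

section \<open>The action of \<open>u\<close> and its eigenvalues\<close>

context coordinate_pairing
begin

lemma P_rels:
  "PB * PA = sm q (PA * PB)" "PC * PA = sm q (PA * PC)" "PC * PB = PB * PC" "PD * PB = sm q (PB * PD)"
  "PD * PC = sm q (PC * PD)" "PA * PD = 1 + sm (inverse q) (PB * PC)" "PD * PA = 1 + sm q (PB * PC)"
  "PA ^ N = 1" "PD ^ N = 1" "PB ^ N = 0" "PC ^ N = 0"
proof -
  have z: "Phi r = 0" if "r \<in> RO" for r
    using that by (simp add: Phi_eq_0_iff rel_ideal_self)
  have "Phi (gen Ob * gen Oa - scal q * gen Oa * gen Ob) = 0" "Phi (gen Oc * gen Oa - scal q * gen Oa * gen Oc) = 0"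
    "Phi (gen Ob * gen Oc - gen Oc * gen Ob) = 0" "Phi (gen Od * gen Ob - scal q * gen Ob * gen Od) = 0"
    "Phi (gen Od * gen Oc - scal q * gen Oc * gen Od) = 0"
    "Phi (gen Oa * gen Od - scal (inverse q) * gen Ob * gen Oc - 1) = 0"
    "Phi (gen Od * gen Oa - scal q * gen Ob * gen Oc - 1) = 0"
    "Phi (gen Oa ^ N - 1) = 0" "Phi (gen Od ^ N - 1) = 0" "Phi (gen Ob ^ N) = 0" "Phi (gen Oc ^ N) = 0"
    by (rule z, simp add: O_rels_def Let_def)+
  then show "PB * PA = sm q (PA * PB)" "PC * PA = sm q (PA * PC)" "PC * PB = PB * PC" "PD * PB = sm q (PB * PD)"
    "PD * PC = sm q (PC * PD)" "PA * PD = 1 + sm (inverse q) (PB * PC)" "PD * PA = 1 + sm q (PB * PC)"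
    "PA ^ N = 1" "PD ^ N = 1" "PB ^ N = 0" "PC ^ N = 0"
    unfolding Phi_simps P_defs[symmetric] by (simp_all add: mult.assoc algebra_simps)
qed

lemma PD_power_PB: "PD ^ k * PB = sm (q ^ k) (PB * PD ^ k)"
proof (induction k)
  case (Suc k)
  have "PD ^ Suc k * PB = PD * (PD ^ k * PB)" by (simp add: mult.assoc)
  then show ?case
    unfolding Suc by (simp add: mult.assoc[symmetric] P_rels) (simp add: mult.assoc mult.commute)
qed simp

lemma PD_power_PB_power: "PD ^ k * PB ^ m = sm (q ^ (k * m)) (PB ^ m * PD ^ k)"
proof (induction m)
  case (Suc m)
  have "PD ^ k * PB ^ Suc m = PD ^ k * PB ^ m * PB" by (simp add: mult.assoc power_commutes)
  also have "\<dots> = sm (q ^ (k * m)) (PB ^ m * (PD ^ k * PB))" unfolding Suc by (simp add: mult.assoc)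
  also have "\<dots> = sm (q ^ (k * Suc m)) (PB ^ Suc m * PD ^ k)"
    unfolding PD_power_PB power_Suc2[of PB] by (simp add: mult.assoc power_add mult.commute)
  finally show ?case .
qed simp

lemma PB_power_PD: "PB ^ m * PD = sm (inverse q ^ m) (PD * PB ^ m)"
  using PD_power_PB_power[of 1 m] by (simp flip: power_mult_distrib)

lemma PD_mod: "PD ^ (N * k + r) = PD ^ r"
  by (simp add: power_add power_mult P_rels)

end

text \<open>The roots of the minimal polynomial of \<open>u\<close> are \<open>s q\<^sup>2\<^sup>k + t q\<^sup>-\<^sup>2\<^sup>k\<close>.\<close>

locale coideal_pairing = coordinate_pairing N q \<phi>
  for N :: nat and q :: "'k :: field_char_0" and \<phi> +
  fixes \<alpha> \<beta> s t :: 'k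
  assumes s_plus_t: "s + t = \<beta>" and s_times_t: "s * t = \<alpha> / (1 - q\<^sup>2)"
begin

lemma alpha_eq: "\<alpha> = s * t * (1 - q\<^sup>2)"
  unfolding s_times_t using q_square_neq_1 by simp

text \<open>
  The action of \<open>E + \<alpha> (q - q\<^sup>-\<^sup>1) K F + l K\<close>. The parameter \<open>l\<close> varies since multiplication by an
  eigenvector on the left replaces \<open>\<beta>\<close> by the eigenvalue.
\<close>

definition rU :: "'k \<Rightarrow> 'k wdual \<Rightarrow> 'k wdual" where
  "rU l Y = rt LE Y + sm (\<alpha> * (q - inverse q)) (rt LG Y) + sm l (rt LK Y)"

abbreviation "U \<equiv> rU \<beta>"

lemma rU_simps [simp]: "rU l 0 = 0" "rU l (X + Y) = rU l X + rU l Y" "rU l (X - Y) = rU l X - rU l Y"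
  "rU l (sm c X) = sm c (rU l X)"
  by (simp_all add: rU_def sm_distrib algebra_simps)

lemma rU_sum: "rU l (sum f A) = (\<Sum>a\<in>A. rU l (f a))"
  by (induction A rule: infinite_finite_induct) simp_all

lemma rU_eigen_mult:
  assumes "rU l f = sm m f"
  shows "rU l (f * g) = f * rU m g"
proof -
  have "rU l (f * g) = rU l f * rt LK g + f * (rt LE g + sm (\<alpha> * (q - inverse q)) (rt LG g))"
    by (simp add: rU_def rt_mult algebra_simps sm_distrib)
  then show ?thesis unfolding assms by (simp add: rU_def algebra_simps)
qed

lemma rU_one: "rU l 1 = sm l 1"
  by (simp add: rU_def)

text \<open>On the spans of \<open>b, d\<close> and of \<open>a, c\<close> the operator is a two by
  two matrix, and \<open>S T = s t\<close> is exactly the condition under which these vectors are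
  eigenvectors. The eigenvalue is the sum of the pair \<open>(S q, T q^-1)\<close>, which satisfies
  the same condition.\<close>

lemma eigen_v:
  assumes "S * T = s * t"
  shows "rU (S + T) (PD + sm (S * (q - inverse q)) PB) = sm (S * q + T * inverse q) (PD + sm (S * (q - inverse q)) PB)"
    "rU (S + T) (PC + sm (S * (q - inverse q)) PA) = sm (S * q + T * inverse q) (PC + sm (S * (q - inverse q)) PA)"
proof -
  have 1: "(S + T) * inverse q + S * (q - inverse q) = S * q + T * inverse q"
    by (simp add: algebra_simps)
  have 2: "\<alpha> * (q - inverse q) * inverse q + S * (q - inverse q) * ((S + T) * q)
    = (S * q + T * inverse q) * (S * (q - inverse q))"
    unfolding alpha_eq assms[symmetric] by (simp add: field_simps power2_eq_square)
  have "rU (S + T) (PD + sm (S * (q - inverse q)) PB)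
    = sm ((S + T) * inverse q + S * (q - inverse q)) PD
      + sm (\<alpha> * (q - inverse q) * inverse q + S * (q - inverse q) * ((S + T) * q)) PB"
    "rU (S + T) (PC + sm (S * (q - inverse q)) PA)
    = sm ((S + T) * inverse q + S * (q - inverse q)) PC
      + sm (\<alpha> * (q - inverse q) * inverse q + S * (q - inverse q) * ((S + T) * q)) PA"
    by (simp_all add: rU_def rt_gens sm_distrib algebra_simps)
  then show "rU (S + T) (PD + sm (S * (q - inverse q)) PB) = sm (S * q + T * inverse q) (PD + sm (S * (q - inverse q)) PB)"
    "rU (S + T) (PC + sm (S * (q - inverse q)) PA) = sm (S * q + T * inverse q) (PC + sm (S * (q - inverse q)) PA)"
    unfolding 1 2 by (simp_all add: sm_distrib)
qed

section \<open>Polynomials in \<open>u\<close> acting on functionals\<close>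

definition pact :: "'k poly \<Rightarrow> 'k wdual \<Rightarrow> 'k wdual" where
  "pact p Y = (\<Sum>i\<le>degree p. sm (poly.coeff p i) ((U ^^ i) Y))"

lemma U_pow_simps: "(U ^^ i) (X + Y) = (U ^^ i) X + (U ^^ i) Y" "(U ^^ i) (sm c X) = sm c ((U ^^ i) X)"
  by (induction i) simp_all

lemma pact_bound: "degree p \<le> n \<Longrightarrow> pact p Y = (\<Sum>i\<le>n. sm (poly.coeff p i) ((U ^^ i) Y))"
  unfolding pact_def by (intro sum.mono_neutral_left) (auto simp: coeff_eq_0)

lemma pact_lin: "pact p (X + Y) = pact p X + pact p Y" "pact p (sm c X) = sm c (pact p X)"
  by (simp_all add: pact_def U_pow_simps sm_distrib sum.distrib sm_sum mult.commute)

lemma pact_add: "pact (p + r) Y = pact p Y + pact r Y"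
proof -
  let ?n = "max (degree p) (degree r)"
  have "degree (p + r) \<le> ?n" by (rule degree_add_le_max)
  then show ?thesis
    using pact_bound[of p ?n Y] pact_bound[of r ?n Y] pact_bound[of "p + r" ?n Y]
    by (simp add: sm_distrib sum.distrib)
qed

lemma pact_smult: "pact (Polynomial.smult c p) Y = sm c (pact p Y)"
  using pact_bound[of "Polynomial.smult c p" "degree p" Y] by (simp add: pact_def sm_sum degree_smult_le)

lemma pact_pCons: "pact (pCons c p) Y = sm c Y + U (pact p Y)"
proof -
  have "pact (pCons c p) Y = (\<Sum>i\<le>Suc (degree p). sm (poly.coeff (pCons c p) i) ((U ^^ i) Y))"
    by (rule pact_bound) (rule degree_pCons_le)
  then show ?thesis
    unfolding sum.atMost_Suc_shift by (simp add: pact_def rU_sum)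
qed

lemma pact_0 [simp]: "pact 0 Y = 0"
  by (simp add: pact_def)

lemma pact_mult: "pact (p * r) Y = pact p (pact r Y)"
  by (induction p) (simp_all add: pact_add pact_smult pact_pCons)

lemma pact_linear_factor: "pact [:- c, 1:] Y = U Y - sm c Y"
  by (simp add: pact_pCons)

text \<open>\<open>E\<close> sends \<open>b^n\<close> to \<open>[n] d b^(n-1)\<close> with the
  symmetric quantum integer \<open>[n] = (q^n - q^-n) / (q - q^-1)\<close>, here with the
  denominator cleared.\<close>

lemma rt_E_PB_power: "sm (q - inverse q) (rt LE (PB ^ Suc m)) = sm (q ^ Suc m - inverse q ^ Suc m) (PD * PB ^ m)"
proof (induction m)
  case (Suc m)
  have "rt LE (PB ^ Suc (Suc m)) = PD * rt LK (PB ^ Suc m) + PB * rt LE (PB ^ Suc m)"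
    by (simp add: rt_mult rt_gens)
  also have "PD * rt LK (PB ^ Suc m) = sm (q ^ Suc m) (PD * PB ^ Suc m)"
    by (simp only: rt_K_power rt_gens sm_power sm_mult_right)
  finally have "sm (q - inverse q) (rt LE (PB ^ Suc (Suc m)))
    = sm ((q - inverse q) * q ^ Suc m) (PD * PB ^ Suc m) + PB * sm (q - inverse q) (rt LE (PB ^ Suc m))"
    by (simp only: sm_distrib(1) sm_simps sm_mult_right)
  also have "PB * sm (q - inverse q) (rt LE (PB ^ Suc m)) = sm (q ^ Suc m - inverse q ^ Suc m) (PB * PD * PB ^ m)"
    unfolding Suc by (simp add: mult.assoc)
  also have "PB * PD = sm (inverse q) (PD * PB)" by (simp add: P_rels)
  also have "sm (q ^ Suc m - inverse q ^ Suc m) (sm (inverse q) (PD * PB) * PB ^ m)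
    = sm ((q ^ Suc m - inverse q ^ Suc m) * inverse q) (PD * PB ^ Suc m)"
    by (simp add: mult.assoc)
  also have "sm ((q - inverse q) * q ^ Suc m) (PD * PB ^ Suc m) + sm ((q ^ Suc m - inverse q ^ Suc m) * inverse q) (PD * PB ^ Suc m)
    = sm ((q - inverse q) * q ^ Suc m + (q ^ Suc m - inverse q ^ Suc m) * inverse q) (PD * PB ^ Suc m)"
    by (simp only: sm_distrib)
  also have "(q - inverse q) * q ^ Suc m + (q ^ Suc m - inverse q ^ Suc m) * inverse q
    = q ^ Suc (Suc m) - inverse q ^ Suc (Suc m)"
    by (simp add: algebra_simps)
  finally show ?case .
qed (simp add: rt_gens)

text \<open>
  An eigenvector \<open>f\<close> of \<open>u\<close> gives the eigenvector \<open>f v\<close> for the eigenvector \<open>v\<close> of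
  \<open>eigen_v\<close>, and on the flag spanned by \<open>f b\<^sup>m, f v b\<^sup>m\<^sup>-\<^sup>1, \<dots>\<close> the element \<open>u\<close> is triangular.
\<close>

lemma eigen_chain:
  assumes "S * T = s * t" "U f = sm (S * q ^ m + T * inverse q ^ m) f"
  shows "pact (\<Prod>i\<le>m. [:- (S * q ^ (2 * i) + T * inverse q ^ (2 * i)), 1:]) (f * PB ^ m) = 0"
  using assms
proof (induction m arbitrary: S T f)
  case 0
  have "pact [:- (S + T), 1:] f = 0" unfolding pact_linear_factor using 0 by simp
  then show ?case by simp
next
  case (Suc m)
  let ?l = "S * q ^ Suc m + T * inverse q ^ Suc m" and ?c = "S * q ^ Suc m * (q - inverse q)"
  let ?v = "PD + sm ?c PB" and ?e = "(q ^ Suc m - inverse q ^ Suc m) / (q - inverse q)"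
  have pq: "inverse q ^ k * q ^ k = 1" for k by (simp flip: power_mult_distrib)
  have st: "S * q ^ Suc m * (T * inverse q ^ Suc m) = s * t"
    using Suc.prems(1) pq[of "Suc m"] by (simp add: mult_ac)
  have "rt LE (PB ^ Suc m) = sm ?e (PD * PB ^ m)"
    using arg_cong[OF rt_E_PB_power[of m], of "sm (inverse (q - inverse q))"] q_minus_inverse
    by (simp add: divide_inverse mult.commute)
  moreover have "rt LG (PB ^ Suc m) = 0"
    by (induction m) (simp_all add: rt_mult rt_gens)
  ultimately have "rU ?l (PB ^ Suc m) = sm ?e (PD * PB ^ m) + sm (?l * q ^ Suc m) (PB ^ Suc m)"
    by (simp only: rU_def rt_K_power rt_gens sm_power sm_simps add_0_right)
  \<comment> \<open>Trading \<open>d\<close> for the eigenvector \<open>v = d + c b\<close> changes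
    the diagonal coefficient by \<open>- e c\<close>, and the value of \<open>c\<close> brings it to
    \<open>S + T\<close>, the root split off at this step.\<close>
  also have "\<dots> = sm ?e (?v * PB ^ m) + sm (?l * q ^ Suc m - ?e * ?c) (PB ^ Suc m)"
  proof -
    have "sm e (PD * PB ^ m) + sm b (PB ^ Suc m) = sm e ((PD + sm c PB) * PB ^ m) + sm (b - e * c) (PB ^ Suc m)" for e b c
      by (simp add: distrib_right sm_distrib mult.assoc)
    then show ?thesis .
  qed
  also have "?l * q ^ Suc m - ?e * ?c = S + T"
  proof -
    have "?e * ?c = S * q ^ Suc m * (q ^ Suc m - inverse q ^ Suc m)"
      using q_minus_inverse by (simp add: mult_ac)
    then show ?thesis using pq[of "Suc m"] by (simp add: algebra_simps del: power_Suc)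
  qed
  finally have e: "rU ?l (PB ^ Suc m) = sm ?e (?v * PB ^ m) + sm (S + T) (PB ^ Suc m)" .
  have 1: "U (f * PB ^ Suc m) - sm (S + T) (f * PB ^ Suc m) = sm ?e (f * ?v * PB ^ m)"
    unfolding rU_eigen_mult[OF Suc.prems(2)] e
    by (simp only: distrib_left[of f "sm _ _"] sm_mult_right mult.assoc add_diff_cancel_right')
  have "U (f * ?v) = f * rU ?l ?v" by (rule rU_eigen_mult[OF Suc.prems(2)])
  also have "\<dots> = sm (S * q ^ Suc m * q + T * inverse q ^ Suc m * inverse q) (f * ?v)"
    unfolding eigen_v(1)[OF st] by simp
  also have "S * q ^ Suc m * q + T * inverse q ^ Suc m * inverse q
    = (S * q\<^sup>2) * q ^ m + (T * inverse q ^ 2) * inverse q ^ m"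
    by (simp add: power2_eq_square mult_ac)
  finally have 2: "U (f * ?v) = sm ((S * q\<^sup>2) * q ^ m + (T * inverse q ^ 2) * inverse q ^ m) (f * ?v)" .
  \<comment> \<open>\<open>f v\<close> has the eigenvalue required for length \<open>m\<close> with
    the parameters \<open>(S q^2, T q^-2)\<close>; the roots of the shorter chain are therefore
    those with index raised by one.\<close>
  have "(S * q\<^sup>2) * (T * inverse q ^ 2) = s * t"
    using Suc.prems(1) pq[of 2] by (simp add: mult_ac)
  from Suc.IH[OF this 2]
  have 3: "pact (\<Prod>i\<le>m. [:- (S * q ^ (2 * Suc i) + T * inverse q ^ (2 * Suc i)), 1:]) (f * ?v * PB ^ m) = 0"
    by (simp add: power_add[symmetric] mult.assoc power2_eq_square)
  let ?Q = "\<Prod>i\<le>m. [:- (S * q ^ (2 * Suc i) + T * inverse q ^ (2 * Suc i)), 1:]"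
  have "pact (?Q * [:- (S + T), 1:]) (f * PB ^ Suc m) = pact ?Q (sm ?e (f * ?v * PB ^ m))"
    by (simp only: pact_mult pact_linear_factor 1)
  also have "\<dots> = 0" by (simp only: pact_lin 3 sm_simps)
  finally show ?case
    unfolding prod.atMost_Suc_shift by (subst mult.commute) (simp only: mult_0_right power_0 mult_1_right)
qed

section \<open>The polynomial annihilating the flags, and its factor \<open>psi_poly\<close>\<close>

definition charpoly :: "'k poly" where
  "charpoly = (\<Prod>i<N. [:- (s * q ^ (2 * i) + t * inverse q ^ (2 * i)), 1:])"

lemma prod_shift_periodic:
  assumes "\<And>i. F (i + N) = (F i :: 'b::comm_monoid_mult)"
  shows "(\<Prod>i<N. F (i + j)) = (\<Prod>i<N. F i)"
proof (induction j)
  case (Suc j)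
  obtain n where n: "N = Suc n" using N_gt_1 by (cases N) auto
  have "(\<Prod>i<N. F (i + Suc j)) = (\<Prod>i<n. F (Suc i + j)) * F (N + j)"
    unfolding n by simp
  also have "F (N + j) = F (0 + j)" using assms[of j] by (simp add: add.commute)
  also have "(\<Prod>i<n. F (Suc i + j)) * F (0 + j) = (\<Prod>i<N. F (i + j))"
    unfolding n prod.lessThan_Suc_shift[of _ n] by (simp add: mult.commute)
  finally show ?case using Suc by simp
qed simp

lemma inverse_q_N: "inverse q ^ N = 1"
  using q_N by (simp add: power_inverse)

lemma charpoly_shift: "charpoly = (\<Prod>i<N. [:- (s * q ^ (2 * (i + j)) + t * inverse q ^ (2 * (i + j))), 1:])"
proof -
  have "q ^ (2 * (i + N)) = q ^ (2 * i)" "inverse q ^ (2 * (i + N)) = inverse q ^ (2 * i)" for i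
    using q_N inverse_q_N by (simp_all add: distrib_left power_add power_mult mult.commute[of 2 N])
  then show ?thesis
    unfolding charpoly_def by (subst prod_shift_periodic) simp_all
qed

text \<open>Index 0 gives the root \<open>s + t = \<beta>\<close>. Passing from \<open>k\<close> to
  \<open>N - k\<close> exchanges \<open>x = q^(2k)\<close> and \<open>y = q^(-2k)\<close>; such a
  pair of roots has sum \<open>\<beta> (x + y)\<close> and product
  \<open>\<beta>^2 + (x - y)^2 s t\<close>, which are the coefficients of a factor of
  \<open>\<psi>\<close>.\<close>

lemma charpoly_eq: "charpoly = [:- \<beta>, 1:] * psi_poly N q \<alpha> \<beta>"
proof -
  define M where "M = (N - 1) div 2"
  have M: "N = Suc (2 * M)" using odd_N by (auto simp: M_def elim: oddE)
  let ?F = "\<lambda>i. [:- (s * q ^ (2 * i) + t * inverse q ^ (2 * i)), 1:]"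
  have "charpoly = (\<Prod>i\<in>{0} \<union> {1..M} \<union> {Suc M..2 * M}. ?F i)"
    unfolding charpoly_def by (intro prod.cong) (auto simp: M)
  also have "\<dots> = ?F 0 * (\<Prod>i\<in>{1..M}. ?F i) * (\<Prod>i\<in>{Suc M..2 * M}. ?F i)"
    by (subst prod.union_disjoint) auto
  also have "(\<Prod>i\<in>{Suc M..2 * M}. ?F i) = (\<Prod>i\<in>{1..M}. ?F (N - i))"
    by (rule prod.reindex_bij_witness[of _ "\<lambda>i. N - i" "\<lambda>i. N - i"]) (auto simp: M)
  also have "?F 0 * (\<Prod>i\<in>{1..M}. ?F i) * (\<Prod>i\<in>{1..M}. ?F (N - i)) = ?F 0 * (\<Prod>i\<in>{1..M}. ?F i * ?F (N - i))"
    by (simp only: prod.distrib mult.assoc)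
  also have "(\<Prod>i\<in>{1..M}. ?F i * ?F (N - i)) = psi_poly N q \<alpha> \<beta>"
    unfolding psi_poly_def M_def[symmetric]
  proof (rule prod.cong[OF refl])
    fix k assume k: "k \<in> {1..M}"
    define x where "x = q ^ (2 * k)"
    define y where "y = inverse q ^ (2 * k)"
    have xy: "x * y = 1" by (simp add: x_def y_def flip: power_mult_distrib)
    have "2 * (N - k) + 2 * k = N * 2" using k by (auto simp: M)
    then have "q ^ (2 * (N - k)) * x = 1" "inverse q ^ (2 * (N - k)) * y = 1"
      using q_N inverse_q_N unfolding x_def y_def power_add[symmetric] by (simp_all only: power_mult power_one)
    then have N: "q ^ (2 * (N - k)) = y" "inverse q ^ (2 * (N - k)) = x"
      using xy by (metis mult.assoc mult.commute mult_1_left)+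
    have c: "(s * x + t * y) * (s * y + t * x) = \<beta>\<^sup>2 + (x - y)\<^sup>2 * (s * t)"
    proof -
      have "(s * x + t * y) * (s * y + t * x) = (s\<^sup>2 + t\<^sup>2) * (x * y) + s * t * (x\<^sup>2 + y\<^sup>2)"
        by (simp add: power2_eq_square algebra_simps)
      also have "\<dots> = (s\<^sup>2 + t\<^sup>2) * (x * y) + 2 * s * t * (x * y) + s * t * (x - y)\<^sup>2"
        by (simp add: power2_eq_square algebra_simps)
      finally show ?thesis unfolding xy s_plus_t[symmetric] by (simp add: power2_eq_square algebra_simps)
    qed
    have "?F k * ?F (N - k) = [: (s * x + t * y) * (s * y + t * x), - ((s + t) * (x + y)), 1:]"
      unfolding N x_def[symmetric] y_def[symmetric] by (simp add: algebra_simps)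
    also have "\<dots> = [: \<beta>\<^sup>2 + (x - y)\<^sup>2 / (1 - q\<^sup>2) * \<alpha>, - (\<beta> * (x + y)), 1:]"
      unfolding c s_plus_t s_times_t by simp
    finally show "?F k * ?F (N - k) = [: \<beta>\<^sup>2 + (q ^ (2 * k) - inverse q ^ (2 * k))\<^sup>2 / (1 - q\<^sup>2) * \<alpha>,
        - (\<beta> * (q ^ (2 * k) + inverse q ^ (2 * k))), 1:]"
      by (simp add: x_def y_def)
  qed
  finally show ?thesis by (simp add: s_plus_t)
qed

lemma PB_N1: "PB * PB ^ (N - 1) = 0"
  using P_rels(10) N_gt_1 by (metis power_minus_mult power_commutes less_trans zero_less_one)

section \<open>Eigenvectors multiplied by \<open>b^(N-1)\<close>\<close>

definition eigen :: "nat \<Rightarrow> 'k wdual \<Rightarrow> bool" where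
  "eigen n f \<longleftrightarrow> U f = sm (s * q ^ n + t * inverse q ^ n) f"

text \<open>Multiply by an eigenvector \<open>d + c b\<close>: its second term is killed by
  \<open>b^(N-1)\<close>.\<close>

lemma eigen_step:
  assumes "eigen n f"
  shows "\<exists>f'. eigen (Suc n) f' \<and> f' * PB ^ (N - 1) = f * PD * PB ^ (N - 1)"
proof -
  let ?c = "s * q ^ n * (q - inverse q)"
  have st: "s * q ^ n * (t * inverse q ^ n) = s * t"
    by (simp add: mult_ac flip: power_mult_distrib)
  have "eigen (Suc n) (f * (PD + sm ?c PB))"
    unfolding eigen_def rU_eigen_mult[OF assms[unfolded eigen_def]] eigen_v(1)[OF st] by (simp add: mult_ac)
  moreover have "f * (PD + sm ?c PB) * PB ^ (N - 1) = f * PD * PB ^ (N - 1)"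
    by (simp add: distrib_left distrib_right mult.assoc PB_N1 del: One_nat_def)
  ultimately show ?thesis by blast
qed

text \<open>\<open>eigen_chain\<close> for length \<open>N - 1\<close> with
  \<open>S = s q^(n+1)\<close>, so that \<open>S q^(N-1) = s q^n\<close>. For odd \<open>n\<close>
  the roots are those of \<open>charpoly\<close> with the index shifted by
  \<open>(n + 1) / 2\<close>.\<close>

lemma eigen_killed:
  assumes "eigen n f" "odd n"
  shows "pact charpoly (f * PB ^ (N - 1)) = 0"
proof -
  obtain j where j: "Suc n = 2 * j" using assms(2) by (metis even_Suc evenE)
  let ?S = "s * q ^ Suc n" and ?T = "t * inverse q ^ Suc n"
  have N: "Suc n + (N - 1) = n + N" using N_gt_1 by simp
  have "U f = sm (?S * q ^ (N - 1) + ?T * inverse q ^ (N - 1)) f"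
    using assms(1) q_N inverse_q_N unfolding eigen_def mult.assoc power_add[symmetric] N
    by (simp add: power_add)
  moreover have "?S * ?T = s * t"
    by (simp add: mult_ac) (simp add: field_simps flip: power_mult_distrib power_Suc)
  ultimately have "pact (\<Prod>i\<le>N - 1. [:- (?S * q ^ (2 * i) + ?T * inverse q ^ (2 * i)), 1:]) (f * PB ^ (N - 1)) = 0"
    by (intro eigen_chain)
  moreover have "{..N - 1} = {..<N}" using N_gt_1 by auto
  ultimately show ?thesis
    unfolding j charpoly_shift[of j] by (simp add: mult.assoc distrib_left add.commute flip: power_add)
qed

text \<open>Up to scalars, \<open>x^(N-1) z\<close> is \<open>d^3 b^(N-1)\<close> and
  \<open>x^(N-1) y\<close> is \<open>c d^2 b^(N-1)\<close>; both come from three eigenvector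
  factors, and 3 is odd.\<close>

lemma killed_D: "pact charpoly (PD ^ 3 * PB ^ (N - 1)) = 0" "pact charpoly (PD * PB ^ (N - 1)) = 0"
  and killed_C: "pact charpoly (PC * PD ^ 2 * PB ^ (N - 1)) = 0"
proof -
  let ?B = "PB ^ (N - 1)"
  \<comment> \<open>\<open>d\<close> commutes with \<open>b^(N-1)\<close> up to a scalar, so an
    identity valid against \<open>b^(N-1)\<close> survives the insertion of
    \<open>d\<close>.\<close>
  have *: "f' * PD * ?B = f * PD * PD * ?B" if "f' * ?B = f * PD * ?B" for f f'
  proof -
    have "PD * ?B = sm (q ^ (N - 1)) (?B * PD)" using PD_power_PB_power[of 1 "N - 1"] by simp
    then have key: "g * PD * ?B = sm (q ^ (N - 1)) (g * ?B * PD)" for g by (simp add: mult.assoc)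
    show ?thesis unfolding key[of f'] key[of "f * PD"] that ..
  qed
  have "eigen 0 1" by (simp add: eigen_def rU_one s_plus_t)
  then obtain f1 where f1: "eigen 1 f1" "f1 * ?B = 1 * PD * ?B" using eigen_step by force
  show D1: "pact charpoly (PD * ?B) = 0" using eigen_killed[OF f1(1)] f1(2) by simp
  obtain f2 where f2: "eigen 2 f2" "f2 * ?B = f1 * PD * ?B" using eigen_step[OF f1(1)] by (force simp: eval_nat_numeral)
  obtain f3 where f3: "eigen 3 f3" "f3 * ?B = f2 * PD * ?B" using eigen_step[OF f2(1)] by (force simp: eval_nat_numeral)
  have "f2 * ?B = PD * PD * ?B" using f2(2) *[OF f1(2)] by simp
  then have "f3 * ?B = PD * PD * PD * ?B" using f3(2) *[of f2 PD] by simp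
  then show "pact charpoly (PD ^ 3 * ?B) = 0"
    using eigen_killed[OF f3(1)] by (simp add: power3_eq_cube)
  let ?c = "s * (q - inverse q)" let ?w = "PC + sm ?c PA"
  have "eigen 1 ?w"
    using eigen_v(2)[of s t] by (simp add: eigen_def s_plus_t)
  then obtain g2 where g2: "eigen 2 g2" "g2 * ?B = ?w * PD * ?B" using eigen_step by (force simp: eval_nat_numeral)
  obtain g3 where g3: "eigen 3 g3" "g3 * ?B = g2 * PD * ?B" using eigen_step[OF g2(1)] by (force simp: eval_nat_numeral)
  have "g3 * ?B = ?w * PD * PD * ?B" using g3(2) *[OF g2(2)] by simp
  also have "\<dots> = PC * PD ^ 2 * ?B + sm ?c (PA * PD * PD * ?B)"
    by (simp add: distrib_right mult.assoc power2_eq_square)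
  \<comment> \<open>The \<open>a\<close>-part of the first factor leaves \<open>d b^(N-1)\<close>,
    since \<open>a d - 1\<close> is a multiple of \<open>b c\<close> and \<open>b\<close> dies
    against \<open>b^(N-1)\<close>. That remainder is annihilated already.\<close>
  also have "PA * PD * PD * ?B = PD * ?B + sm (inverse q) (PB * PC * PD * ?B)"
    unfolding P_rels(6) by (simp add: distrib_right mult.assoc)
  also have "PB * PC * PD * ?B = 0"
  proof -
    have "PB * PC * PD * ?B = PC * (PB * PD) * ?B" by (simp add: P_rels(3)[symmetric] mult.assoc)
    also have "PB * PD = sm (inverse q) (PD * PB)" by (simp add: P_rels)
    finally show ?thesis using PB_N1 by (simp add: mult.assoc)
  qed
  finally have e: "g3 * ?B = PC * PD ^ 2 * ?B + sm ?c (PD * ?B)" by simp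
  show "pact charpoly (PC * PD ^ 2 * ?B) = 0"
    using eigen_killed[OF g3(1)] unfolding e by (simp only: pact_lin D1 sm_simps add_0_right) simp
qed

definition "PX = PB * PD ^ (N - 1)"

lemma PX_power: "\<exists>c. PX ^ m = sm c (PB ^ m * PD ^ ((N - 1) * m))"
proof (induction m)
  case 0
  show ?case by (rule exI[of _ 1]) simp
next
  case (Suc m)
  then obtain c where c: "PX ^ m = sm c (PB ^ m * PD ^ ((N - 1) * m))" by blast
  have "PX ^ Suc m = sm c (PB ^ m * (PD ^ ((N - 1) * m) * PB) * PD ^ (N - 1))"
    unfolding power_Suc2 c by (simp only: PX_def sm_mult_left mult.assoc)
  also have "\<dots> = sm (c * q ^ ((N - 1) * m)) (PB ^ m * PB * (PD ^ ((N - 1) * m) * PD ^ (N - 1)))"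
    unfolding PD_power_PB by (simp add: mult.assoc)
  also have "\<dots> = sm (c * q ^ ((N - 1) * m)) (PB ^ Suc m * PD ^ ((N - 1) * Suc m))"
    by (simp only: power_Suc2 power_add[symmetric] mult_Suc_right add.commute)
  finally show ?case by blast
qed

lemma killed_X:
  "pact charpoly (PX ^ (N - 1) * PD ^ 2) = 0" "pact charpoly (PX ^ (N - 1) * (PC * PD)) = 0"
proof -
  let ?B = "PB ^ (N - 1)"
  obtain c where c: "PX ^ (N - 1) = sm c (?B * PD ^ ((N - 1) * (N - 1)))" using PX_power by blast
  obtain n where n: "N = Suc (Suc n)" using N_gt_1 by (intro that[of "N - 2"]) simp
  \<comment> \<open>\<open>(N-1)^2\<close> is 1 modulo \<open>N\<close>, so \<open>x^(N-1)\<close>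
    is a multiple of \<open>b^(N-1) d\<close>; this is the source of the third factor in
    \<open>d^3\<close> and \<open>c d^2\<close>.\<close>
  have N: "(N - 1) * (N - 1) = N * (N - 2) + 1" unfolding n by simp
  have c: "PX ^ (N - 1) = sm c (?B * PD)" using c unfolding N PD_mod by simp
  have BC: "?B * PC = PC * ?B"
    using P_rels(3) by (metis power_commuting_commutes)
  define p where "p = inverse q ^ (N - 1)"
  have BD: "?B * PD = sm p (PD * ?B)" and BD': "?B * (PD * X) = sm p (PD * (?B * X))" for X
    using PB_power_PD[of "N - 1"] by (simp_all add: p_def mult.assoc[symmetric])
  have "PX ^ (N - 1) * PD ^ 2 = sm (c * p * p * p) (PD ^ 3 * ?B)"
    unfolding c by (simp add: power2_eq_square power3_eq_cube mult.assoc BD BD' del: One_nat_def)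
  then show "pact charpoly (PX ^ (N - 1) * PD ^ 2) = 0" by (simp only: pact_lin killed_D sm_simps)
  have "?B * PD * (PC * PD) = sm q (?B * PC * PD * PD)"
    using P_rels(5) by (simp add: mult.assoc[symmetric]) (simp add: mult.assoc)
  also have "\<dots> = sm (q * p * p) (PC * PD ^ 2 * ?B)"
    unfolding BC by (simp add: power2_eq_square mult.assoc BD BD' del: One_nat_def)
  finally have "PX ^ (N - 1) * (PC * PD) = sm (c * (q * p * p)) (PC * PD ^ 2 * ?B)"
    unfolding c by simp
  then show "pact charpoly (PX ^ (N - 1) * (PC * PD)) = 0" by (simp only: pact_lin killed_C sm_simps)
qed

lemma U_eigen_Lambda:
  assumes "pact charpoly Y = 0"
  shows "U (pact (psi_poly N q \<alpha> \<beta>) Y) = sm \<beta> (pact (psi_poly N q \<alpha> \<beta>) Y)"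
  using assms unfolding charpoly_eq pact_mult pact_linear_factor by simp

end

section \<open>Restriction to the Borel part\<close>

text \<open>The order of vanishing in \<open>x = b d\<^sup>-\<^sup>1\<close>, which the action of \<open>E\<close> lowers by one.\<close>

primrec vord :: "nat \<Rightarrow> 'k::field wdual \<Rightarrow> bool" where
  "vord 0 X \<longleftrightarrow> True"
| "vord (Suc m) X \<longleftrightarrow> res X = 0 \<and> vord m (rt LE X)"

lemma vord_lin: "vord m X \<Longrightarrow> vord m Y \<Longrightarrow> vord m (X + Y)" "vord m X \<Longrightarrow> vord m (sm c X)"
  "vord m X \<Longrightarrow> vord m Y \<Longrightarrow> vord m (X - Y)" "vord m 0"
  by (induction m arbitrary: X Y) simp_all

lemma vord_Suc: "vord (Suc m) X \<Longrightarrow> vord m X"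
  by (induction m arbitrary: X) auto

context coordinate_pairing
begin

definition Oset :: "'k wdual set" where
  "Oset = psi ` carrier (Oq N q)"

lemma Oset_eq: "Oset = range (\<lambda>f. Phi f)"
  by (auto simp: Oset_def carrier_pres_alg)

lemma Phi_Oset [simp, intro]: "Phi f \<in> Oset"
  by (auto simp: Oset_eq)

lemma P_Oset: "PA \<in> Oset" "PB \<in> Oset" "PC \<in> Oset" "PD \<in> Oset"
  by (simp_all add: P_defs)

lemma OsetE:
  assumes "X \<in> Oset"
  obtains f where "X = Phi f"
  using assms by (auto simp: Oset_eq)

lemma Oset_closed: "1 \<in> Oset" "X \<in> Oset \<Longrightarrow> Y \<in> Oset \<Longrightarrow> X + Y \<in> Oset"
  "X \<in> Oset \<Longrightarrow> Y \<in> Oset \<Longrightarrow> X - Y \<in> Oset" "X \<in> Oset \<Longrightarrow> Y \<in> Oset \<Longrightarrow> X * Y \<in> Oset"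
  "X \<in> Oset \<Longrightarrow> sm c X \<in> Oset"
  by (simp flip: Phi_one)
    ((elim OsetE; simp flip: Phi_add Phi_diff Phi_mult Phi_scal); fail)+

lemma rt_Oset: "X \<in> Oset \<Longrightarrow> rt l X \<in> Oset"
  unfolding Oset_def
  by (cases l) (auto simp: image_iff ract_gens[symmetric] intro!: bexI ract_carrier cls_carrier)

text \<open>The relations of the quantum group hold for functionals that come from the coordinate
  algebra, not for arbitrary functions on words; hence the restriction to
  \<open>Oset\<close>.\<close>

lemma rt_E_K: "X \<in> Oset \<Longrightarrow> rt LE (rt LK X) = sm (q\<^sup>2) (rt LK (rt LE X))"
proof -
  assume "X \<in> Oset"
  then obtain Y where Y: "Y \<in> carrier (Oq N q)" "X = psi Y" by (auto simp: Oset_def)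
  have "rt LE (rt LK X) = psi (ract N q \<phi> Y (cls RU (gen UK * gen UE)))"
    using Y by (simp add: ract_lin ract_gens ract_carrier)
  also have "cls RU (gen UK * gen UE) = cls RU (scal (q\<^sup>2) * (gen UE * gen UK))"
    by (rule cls_cong) (rule U_cls_rels)
  also have "psi (ract N q \<phi> Y \<dots>) = sm (q\<^sup>2) (rt LK (rt LE X))"
    using Y by (simp only: ract_lin(2) ract_lin(4)[of _ "gen UE"] ract_gens ract_carrier cls_carrier)
  finally show ?thesis .
qed

lemma rt_E_G:
  assumes "X \<in> Oset"
  shows "rt LE (rt LG X) = sm (q\<^sup>2) (rt LG (rt LE X)) + sm (- inverse (q - inverse q)) (rt LK (rt LK X) + sm (- 1) X)"
proof -
  obtain Y where Y: "Y \<in> carrier (Oq N q)" "X = psi Y" using assms by (auto simp: Oset_def)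
  let ?K = "gen UK :: ugen list \<Rightarrow>\<^sub>0 'k" and ?E = "gen UE :: ugen list \<Rightarrow>\<^sub>0 'k" and ?F = "gen UF :: ugen list \<Rightarrow>\<^sub>0 'k"
  let ?c = "inverse (q - inverse q)"
  have KN: "?K ^ N = ?K * ?K ^ (N - 1)" using N_gt_1 by (metis power_minus_mult power_commutes less_trans zero_less_one)
  have "?K * ?F * ?E - (scal (q\<^sup>2) * (?E * (?K * ?F)) + scal (- ?c) * (?K * ?K + scal (- 1) * 1))
    = (?K * ?E - scal (q\<^sup>2) * (?E * ?K)) * ?F - ?K * (?E * ?F - ?F * ?E - scal ?c * (?K - ?K ^ (N - 1)))
      + scal ?c * (?K ^ N - 1)"
    unfolding KN by (simp add: algebra_simps scal_minus scal_central_left[of ?K])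
  also have "\<dots> \<in> rel_ideal RU"
    by (intro rel_ideal_closed U_cls_rels)
  finally have e: "cls RU (?K * ?F * ?E) = cls RU (scal (q\<^sup>2) * (?E * (?K * ?F)) + scal (- ?c) * (?K * ?K + scal (- 1) * 1))"
    by (rule cls_cong)
  have "rt LE (rt LG X) = psi (ract N q \<phi> Y (cls RU (?K * ?F * ?E)))"
    using Y by (simp only: ract_lin(4)[of _ "?K * ?F"] ract_gens ract_carrier cls_carrier)
  also have "\<dots> = sm (q\<^sup>2) (psi (ract N q \<phi> Y (cls RU (?E * (?K * ?F)))))
    + sm (- ?c) (psi (ract N q \<phi> Y (cls RU (?K * ?K))) + sm (- 1) X)"
    unfolding e using Y by (simp only: ract_lin(1,2,3))
  also have "psi (ract N q \<phi> Y (cls RU (?E * (?K * ?F)))) = rt LG (rt LE X)"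
    using Y by (simp only: ract_lin(4)[of _ ?E] ract_gens ract_carrier cls_carrier)
  also have "psi (ract N q \<phi> Y (cls RU (?K * ?K))) = rt LK (rt LK X)"
    using Y by (simp only: ract_lin(4)[of _ ?K] ract_gens ract_carrier cls_carrier)
  finally show ?thesis .
qed

text \<open>Moving \<open>E\<close> past \<open>K\<close> costs a scalar, and past
  \<open>K F\<close> also a multiple of \<open>K^2 - 1\<close>, for which order \<open>m\<close> of
  \<open>X\<close> itself suffices. So neither letter lowers the order of vanishing.\<close>

lemma vord_K_G: "X \<in> Oset \<Longrightarrow> vord m X \<Longrightarrow> vord m (rt LK X) \<and> vord m (rt LG X)"
proof (induction m arbitrary: X)
  case (Suc m)
  then have IH: "vord m (rt LK (rt LE X))" "vord m (rt LG (rt LE X))" "vord m X"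
    using vord_Suc rt_Oset by auto
  then have "vord m (rt LK (rt LK X))" using Suc.IH[of X] Suc.IH[of "rt LK X"] Suc.prems rt_Oset by blast
  then show ?case
    using Suc.prems IH by (simp add: rt_res[symmetric] rt_E_K rt_E_G) (intro vord_lin conjI; assumption)
qed simp

end

context coideal_pairing
begin

lemma vord_U:
  assumes "X \<in> Oset" "vord (Suc m) X"
  shows "vord m (rU l X)" "vord (Suc m) (rU l X - rt LE X)"
proof -
  note v = vord_K_G[OF assms]
  then show 1: "vord (Suc m) (rU l X - rt LE X)"
    unfolding rU_def by (simp add: add_diff_eq[symmetric] add.assoc vord_lin del: vord.simps)
  have "vord m (rt LE X)" using assms by simp
  then have "vord m ((rU l X - rt LE X) + rt LE X)" by (rule vord_lin(1)[OF vord_Suc[OF 1]])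
  then show "vord m (rU l X)" by simp
qed

lemma rU_Oset: "X \<in> Oset \<Longrightarrow> rU l X \<in> Oset"
  unfolding rU_def by (intro Oset_closed rt_Oset)

lemma U_pow_Oset: "X \<in> Oset \<Longrightarrow> (U ^^ i) X \<in> Oset" "X \<in> Oset \<Longrightarrow> (rt LE ^^ i) X \<in> Oset"
  by (induction i) (simp_all add: rU_Oset rt_Oset)

section \<open>The eigenspace and its restriction to the Borel part\<close>

definition eqv :: "'k wdual set" where
  "eqv = {X \<in> Oset. U X = sm \<beta> X}"

lemma eqv_closed: "1 \<in> eqv" "X \<in> eqv \<Longrightarrow> Y \<in> eqv \<Longrightarrow> X + Y \<in> eqv" "X \<in> eqv \<Longrightarrow> Y \<in> eqv \<Longrightarrow> X - Y \<in> eqv"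
  "X \<in> eqv \<Longrightarrow> Y \<in> eqv \<Longrightarrow> X * Y \<in> eqv" "X \<in> eqv \<Longrightarrow> sm c X \<in> eqv"
  by (auto simp: eqv_def Oset_closed rU_one rU_eigen_mult sm_distrib mult.commute)

lemma eqv_power: "X \<in> eqv \<Longrightarrow> X ^ n \<in> eqv"
  by (induction n) (simp_all add: eqv_closed)

text \<open>On the eigenspace \<open>E\<close> acts as a combination of \<open>1\<close>,
  \<open>K\<close> and \<open>K F\<close>, none of which lowers the order. With zero restriction,
  order \<open>m\<close> therefore implies order \<open>m + 1\<close>. Elements of infinite order
  are stable under all letters and vanish at the empty word, hence at every word.\<close>

lemma res_eqv_eq_0:
  assumes X: "X \<in> eqv" and r: "res X = 0"
  shows "X = 0"
proof -
  have O: "X \<in> Oset" and U: "U X = sm \<beta> X" using X by (auto simp: eqv_def)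
  have "vord m X" for m
  proof (induction m)
    case (Suc m)
    have "rt LE X = sm \<beta> X - (sm (\<alpha> * (q - inverse q)) (rt LG X) + sm \<beta> (rt LK X))"
      unfolding U[symmetric] rU_def by simp
    also have "vord m \<dots>" using vord_K_G[OF O Suc] Suc by (intro vord_lin) auto
    finally show ?case using r by simp
  qed simp
  then have all: "\<forall>m. vord m X" by blast
  have "ev X w = 0" for w
    using O all
  proof (induction w arbitrary: X)
    case Nil
    have "vord (Suc 0) X" using Nil by blast
    then have "res X = 0" by simp
    then have "ev (res X) [] = 0" by simp
    then show ?case by (simp add: ev_res)
  next
    case (Cons l w)
    have "\<forall>m. vord m (rt l X)"
      using vord_K_G[OF Cons.prems(1)] Cons.prems(2) vord.simps(2)[of _ X] by (cases l) auto
    then have "ev (rt l X) w = 0" using Cons.IH Cons.prems(1) rt_Oset by blast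
    then show ?case by (simp add: ev_rt)
  qed
  then show ?thesis by (intro wdual_eqI) simp
qed

lemma res_eqv_inj: "X \<in> eqv \<Longrightarrow> Y \<in> eqv \<Longrightarrow> res X = res Y \<Longrightarrow> X = Y"
  using res_eqv_eq_0[of "X - Y"] by (simp add: eqv_closed)

text \<open>\<open>U - E\<close> does not lower the order of vanishing while \<open>E\<close> lowers
  it by at most one, so \<open>E^j\<close> is the leading term of \<open>U^j\<close>.\<close>

lemma U_pow_leading:
  assumes "Y \<in> Oset" "vord m Y" "j \<le> m"
  shows "vord (Suc (m - j)) ((U ^^ j) Y - (rt LE ^^ j) Y)" "vord (m - j) ((rt LE ^^ j) Y)"
  using assms(3)
proof (induction j)
  case 0
  case 1 show ?case by (simp add: vord_lin del: vord.simps(2))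
  case 2 show ?case using assms by simp
next
  case (Suc j)
  let ?W = "(U ^^ j) Y - (rt LE ^^ j) Y"
  {
    case 1
    then have s: "m - j = Suc (m - Suc j)" by simp
    have "vord (m - j) (U ?W)"
      using Suc(1) 1 by (intro vord_U(1)) (simp_all add: assms U_pow_Oset Oset_closed)
    moreover have "vord (m - j) (U ((rt LE ^^ j) Y) - rt LE ((rt LE ^^ j) Y))"
      using Suc(2) 1 unfolding s by (intro vord_U(2)) (simp_all add: assms U_pow_Oset)
    ultimately have "vord (m - j) (U ?W + (U ((rt LE ^^ j) Y) - rt LE ((rt LE ^^ j) Y)))"
      by (rule vord_lin)
    then show ?case unfolding s by simp
  next
    case 2
    then have s: "m - j = Suc (m - Suc j)" by simp
    show ?case using Suc(2) 2 unfolding s by simp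
  }
qed

lemma psi_poly_monic: "degree (psi_poly N q \<alpha> \<beta>) = N - 1" "poly.coeff (psi_poly N q \<alpha> \<beta>) (N - 1) = 1"
proof -
  show d: "degree (psi_poly N q \<alpha> \<beta>) = N - 1"
    unfolding psi_poly_def by (subst degree_prod_eq_sum_degree) (use odd_N in \<open>auto elim!: oddE\<close>)
  have "lead_coeff (psi_poly N q \<alpha> \<beta>) = 1"
    unfolding psi_poly_def lead_coeff_prod by (simp add: numeral_2_eq_2)
  then show "poly.coeff (psi_poly N q \<alpha> \<beta>) (N - 1) = 1" by (simp add: d)
qed

text \<open>Powers of \<open>u\<close> below the degree \<open>N - 1\<close> of the monic
  \<open>psi_poly\<close> leave a positive order of vanishing, hence restrict to zero.\<close>

lemma res_pact_psi:
  assumes "Y \<in> Oset" "vord (N - 1) Y"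
  shows "res (pact (psi_poly N q \<alpha> \<beta>) Y) = res ((rt LE ^^ (N - 1)) Y)"
proof -
  obtain n where n: "N - 1 = Suc n" using N_gt_1 by (metis Suc_diff_Suc)
  note lead = U_pow_leading[OF assms]
  have "res ((U ^^ j) Y) = res ((rt LE ^^ j) Y)" if "j \<le> N - 1" for j
    using lead(1)[OF that] by simp
  moreover have "res ((rt LE ^^ j) Y) = 0" if "j < N - 1" for j
  proof -
    have "N - 1 - j = Suc (N - 1 - Suc j)" using that by simp
    then show ?thesis using lead(2)[of j] that by (metis less_imp_le vord.simps(2))
  qed
  ultimately have z: "res ((U ^^ j) Y) = (if j = N - 1 then res ((rt LE ^^ (N - 1)) Y) else 0)" if "j \<le> N - 1" for j
    using that by auto
  have "res (pact (psi_poly N q \<alpha> \<beta>) Y) = (\<Sum>j\<le>N - 1. sm (poly.coeff (psi_poly N q \<alpha> \<beta>) j) (res ((U ^^ j) Y)))"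
    by (simp add: pact_def psi_poly_monic res_sum)
  also have "\<dots> = (\<Sum>j\<le>N - 1. if j = N - 1 then res ((rt LE ^^ (N - 1)) Y) else 0)"
    by (intro sum.cong refl) (auto simp: z psi_poly_monic simp del: One_nat_def)
  also have "\<dots> = res ((rt LE ^^ (N - 1)) Y)" by simp
  finally show ?thesis .
qed

lemma res_PB: "res PB = 0"
proof (rule wdual_eqI)
  have "LE \<notin> set w \<Longrightarrow> ev PB w = 0" for w
  proof (induction w)
    case Nil
    show ?case unfolding PB_def phi_gen by (simp add: rho_word_def mat_def)
  next
    case (Cons l w)
    have "ev PB (l # w) = ev (rt l PB) w" by (simp add: ev_rt)
    then show ?case using Cons by (cases l) (simp_all add: rt_gens)
  qed
  then show "ev (res PB) w = ev 0 w" for w by (simp add: ev_res)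
qed

lemma PX_facts: "rt LE PX = sm q 1" "rt LK PX = sm (q\<^sup>2) PX" "res PX = 0" "PX \<in> Oset"
proof -
  have "rt LE (PD ^ m) = 0" for m by (induction m) (simp_all add: rt_mult rt_gens)
  then have "rt LE PX = sm (inverse q ^ (N - 1)) (PD * PD ^ (N - 1))"
    by (simp add: PX_def rt_mult rt_gens rt_K_power sm_power)
  also have "PD * PD ^ (N - 1) = 1"
    using P_rels(9) N_gt_1 by (metis power_minus_mult power_commutes less_trans zero_less_one)
  also have "inverse q ^ (N - 1) = q" by (metis power_inverse q_power_N1 inverse_inverse_eq)
  finally show "rt LE PX = sm q 1" .
  show "rt LK PX = sm (q\<^sup>2) PX"
    using \<open>inverse q ^ (N - 1) = q\<close>
    by (simp add: PX_def rt_mult rt_gens rt_K_power sm_power power2_eq_square)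
  show "res PX = 0" by (simp add: PX_def res_PB)
  have "PD ^ m \<in> Oset" for m by (induction m) (simp_all add: Oset_closed P_Oset)
  then show "PX \<in> Oset" by (simp add: PX_def Oset_closed P_Oset)
qed

lemma rt_E_PX_power: "rt LE (PX ^ Suc m) = sm (q * q_num (q\<^sup>2) (Suc m)) (PX ^ m)"
proof (induction m)
  case (Suc m)
  have "rt LE (PX ^ Suc (Suc m)) = rt LE PX * rt LK (PX ^ Suc m) + PX * rt LE (PX ^ Suc m)"
    by (simp only: power_Suc[of PX "Suc m"] rt_mult)
  also have "\<dots> = sm (q * (q\<^sup>2) ^ Suc m) (PX ^ Suc m) + sm (q * q_num (q\<^sup>2) (Suc m)) (PX ^ Suc m)"
  proof -
    have "rt LK (PX ^ Suc m) = sm ((q\<^sup>2) ^ Suc m) (PX ^ Suc m)" by (simp only: rt_K_power PX_facts sm_power)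
    then show ?thesis
      unfolding Suc by (simp only: PX_facts sm_mult_left sm_mult_right sm_simps mult_1_left
          power_Suc[of PX m, symmetric] mult.commute[of "(q\<^sup>2) ^ Suc m" q])
  qed
  finally show ?case
    unfolding q_num_Suc_right[of "q\<^sup>2" "Suc m"] by (simp only: distrib_left sm_distrib add.commute)
qed (simp add: PX_facts q_num_Suc)

lemma rt_E_PX_power_mult:
  assumes "rt LE g = 0" "rt LK g = sm \<kappa> g"
  shows "rt LE (PX ^ Suc m * g) = sm (q * \<kappa> * q_num (q\<^sup>2) (Suc m)) (PX ^ m * g)"
  unfolding rt_mult assms rt_E_PX_power by (simp add: mult_ac)

lemma vord_PX_power:
  assumes "rt LE g = 0" "rt LK g = sm \<kappa> g"
  shows "vord m (PX ^ m * g)"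
proof (induction m)
  case (Suc m)
  then show ?case
    unfolding vord.simps(2) rt_E_PX_power_mult[OF assms] by (simp add: PX_facts vord_lin)
qed simp

text \<open>\<open>E\<close> acts on powers of \<open>x\<close> as a \<open>q^2\<close>-derivative.
  The weight \<kappa> of \<open>g\<close> under \<open>K\<close> enters once per step.\<close>

lemma rt_E_iter_PX_power:
  assumes "rt LE g = 0" "rt LK g = sm \<kappa> g"
  shows "(rt LE ^^ m) (PX ^ m * g) = sm (q ^ m * \<kappa> ^ m * q_fact (q\<^sup>2) m) g"
proof (induction m)
  case (Suc m)
  have lin: "(rt LE ^^ m) (sm c X) = sm c ((rt LE ^^ m) X)" for c and X :: "'k wdual"
    by (induction m) simp_all
  have "(rt LE ^^ Suc m) (PX ^ Suc m * g) = (rt LE ^^ m) (rt LE (PX ^ Suc m * g))"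
    by (simp only: funpow_Suc_right o_apply)
  also have "\<dots> = sm (q * \<kappa> * q_num (q\<^sup>2) (Suc m) * (q ^ m * \<kappa> ^ m * q_fact (q\<^sup>2) m)) g"
    unfolding rt_E_PX_power_mult[OF assms] lin Suc by simp
  also have "q * \<kappa> * q_num (q\<^sup>2) (Suc m) * (q ^ m * \<kappa> ^ m * q_fact (q\<^sup>2) m)
    = q ^ Suc m * \<kappa> ^ Suc m * q_fact (q\<^sup>2) (Suc m)"
    by (simp add: q_fact_def)
  finally show ?case .
qed (simp add: q_fact_def)

lemma q_fact_nz: "q_fact (q\<^sup>2) (N - 1) \<noteq> 0"
proof -
  have "q_num (q\<^sup>2) i \<noteq> 0" if "i \<in> {1..N - 1}" for i
    using q_num_geometric[of "q\<^sup>2" i] q2_prim[of i] that by auto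
  then show ?thesis by (simp add: q_fact_def)
qed

definition Lam :: "'k wdual \<Rightarrow> 'k wdual" where
  "Lam g = sm (inverse q / q_fact (q\<^sup>2) (N - 1)) (pact (psi_poly N q \<alpha> \<beta>) (PX ^ (N - 1) * g))"

lemma power_Oset: "X \<in> Oset \<Longrightarrow> X ^ n \<in> Oset"
  by (induction n) (simp_all add: Oset_closed)

lemma sum_Oset: "(\<And>i. i \<in> A \<Longrightarrow> f i \<in> Oset) \<Longrightarrow> sum f A \<in> Oset"
proof (induction A rule: infinite_finite_induct)
  case (insert x F)
  then show ?case by (simp add: Oset_closed)
qed (use Oset_closed(3)[OF Oset_closed(1,1)] in simp_all)

lemma res_Lam:
  assumes g: "g \<in> Oset" "rt LE g = 0" "rt LK g = sm (inverse (q\<^sup>2)) g"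
  shows "res (Lam g) = res g"
proof -
  let ?Y = "PX ^ (N - 1) * g"
  have "?Y \<in> Oset" by (intro Oset_closed power_Oset PX_facts g)
  then have "res (Lam g) = sm (inverse q / q_fact (q\<^sup>2) (N - 1)) (res ((rt LE ^^ (N - 1)) ?Y))"
    unfolding Lam_def res_simps by (subst res_pact_psi) (simp_all only: vord_PX_power[OF g(2,3)])
  also have "\<dots> = sm (inverse q / q_fact (q\<^sup>2) (N - 1) * (q ^ (N - 1) * inverse (q\<^sup>2) ^ (N - 1) * q_fact (q\<^sup>2) (N - 1))) (res g)"
    unfolding rt_E_iter_PX_power[OF g(2,3)] by simp
  \<comment> \<open>For weight \<open>q^-2\<close> the powers of \<open>q\<close> are
    \<open>q^-1\<close>, \<open>q^(N-1) = q^-1\<close> and \<open>q^(-2(N-1)) = q^2\<close>, which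
    explains the factor \<open>q^-1\<close> in \<open>y_elt\<close> and
    \<open>z_elt\<close>.\<close>
  also have "inverse q / q_fact (q\<^sup>2) (N - 1) * (q ^ (N - 1) * inverse (q\<^sup>2) ^ (N - 1) * q_fact (q\<^sup>2) (N - 1)) = 1"
    using q_fact_nz unfolding power_inverse q2_power_N1 q_power_N1
    by (simp add: field_simps power2_eq_square)
  finally show ?thesis by simp
qed

lemma Lam_eqv:
  assumes "g \<in> Oset" "pact charpoly (PX ^ (N - 1) * g) = 0"
  shows "Lam g \<in> eqv"
proof -
  have "Lam g \<in> Oset" unfolding Lam_def pact_def
    by (intro Oset_closed sum_Oset U_pow_Oset power_Oset PX_facts assms)
  then show ?thesis
    using U_eigen_Lambda[OF assms(2)] by (simp add: eqv_def Lam_def mult.commute)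
qed

section \<open>The functionals of \<open>y_elt\<close> and \<open>z_elt\<close> and their
  relations\<close>

definition "Yv = Lam (PC * PD)"
definition "Zv = Lam (PD\<^sup>2)"

lemma YZ_facts: "Yv \<in> eqv" "Zv \<in> eqv" "res Yv = res PC * res PD" "res Zv = (res PD)\<^sup>2"
proof -
  have O: "PC * PD \<in> Oset" "PD\<^sup>2 \<in> Oset" by (simp_all add: power2_eq_square Oset_closed P_Oset)
  show "Yv \<in> eqv" "Zv \<in> eqv"
    unfolding Yv_def Zv_def by (intro Lam_eqv O killed_X)+
  have "res Yv = res (PC * PD)" unfolding Yv_def
    by (rule res_Lam[OF O(1)]) (simp_all add: rt_mult rt_gens power2_eq_square)
  then show "res Yv = res PC * res PD" by simp
  have "res Zv = res (PD\<^sup>2)" unfolding Zv_def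
    by (rule res_Lam[OF O(2)]) (simp_all add: rt_mult rt_gens power2_eq_square)
  then show "res Zv = (res PD)\<^sup>2" by (simp add: res_power)
qed

lemma res_rels: "res PD * res PC = sm q (res PC * res PD)" "res PD * res PA = 1" "res PA * res PD = 1"
  "res PD ^ N = 1" "res PC ^ N = 0"
  using P_rels[THEN arg_cong[of _ _ res]] by (simp_all add: res_PB res_power)

text \<open>Both sides lie in the eigenspace, which is closed under products, so the relations may
  be tested after restriction. There \<open>y\<close> and \<open>z\<close> become \<open>c d\<close>
  and \<open>d^2\<close>.\<close>

lemma YZ_rels: "Zv * Yv = sm (q\<^sup>2) (Yv * Zv)" "Yv ^ N = 0" "Zv ^ N = 1"
proof -
  let ?C = "res PC" and ?D = "res PD"
  have DC: "?D * (?C * X) = sm q (?C * (?D * X))" for X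
    by (simp only: mult.assoc[symmetric] res_rels(1) sm_mult_left)
  show "Zv * Yv = sm (q\<^sup>2) (Yv * Zv)"
  proof (rule res_eqv_inj)
    show "Zv * Yv \<in> eqv" "sm (q\<^sup>2) (Yv * Zv) \<in> eqv" by (intro eqv_closed YZ_facts(1,2))+
    have "?D * ?C = sm q (?C * ?D)" by (rule res_rels)
    then show "res (Zv * Yv) = res (sm (q\<^sup>2) (Yv * Zv))"
      by (simp add: YZ_facts(3,4) power2_eq_square mult.assoc DC)
  qed
  have "\<exists>c. (?C * ?D) ^ m = sm c (?C ^ m * ?D ^ m)" for m
  proof (induction m)
    case 0
    show ?case by (rule exI[of _ 1]) simp
  next
    case (Suc m)
    then obtain c where c: "(?C * ?D) ^ m = sm c (?C ^ m * ?D ^ m)" by blast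
    have DkC: "?D ^ k * ?C = sm (q ^ k) (?C * ?D ^ k)" for k
    proof (induction k)
      case (Suc k)
      have "?D ^ Suc k * ?C = ?D * (?D ^ k * ?C)" by (simp add: mult.assoc)
      also have "\<dots> = sm (q ^ Suc k) (?C * ?D ^ Suc k)" unfolding Suc by (simp add: DC mult.commute)
      finally show ?case .
    qed simp
    have "(?C * ?D) ^ Suc m = sm c (?C ^ m * (?D ^ m * ?C) * ?D)"
      unfolding power_Suc2 c by (simp add: mult.assoc)
    also have "\<dots> = sm (c * q ^ m) (?C ^ Suc m * ?D ^ Suc m)"
      unfolding DkC power_Suc2 by (simp add: mult.assoc)
    finally show ?case by blast
  qed
  then have "(?C * ?D) ^ N = 0" using res_rels(5) by (metis mult_zero_left sm_simps(4))
  then show "Yv ^ N = 0"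
    by (intro res_eqv_eq_0[OF eqv_power[OF YZ_facts(1)]]) (simp add: res_power YZ_facts(3))
  show "Zv ^ N = 1"
  proof (rule res_eqv_inj)
    show "Zv ^ N \<in> eqv" "1 \<in> eqv" by (intro eqv_power eqv_closed(1) YZ_facts(2))+
    show "res (Zv ^ N) = res 1"
      unfolding res_power YZ_facts(4) power_mult[symmetric] mult.commute[of 2 N]
      by (simp add: power_mult res_rels)
  qed
qed

lemma rt_res_YZ: "rt LG (res Yv) = sm (inverse (q\<^sup>2)) 1" "rt LG (res Zv) = 0"
  "rt LK (res Yv) = sm (inverse (q\<^sup>2)) (res Yv)" "rt LK (res Zv) = sm (inverse (q\<^sup>2)) (res Zv)"
  "ev (res Zv) [] = 1"
proof -
  show "rt LG (res Yv) = sm (inverse (q\<^sup>2)) 1" "rt LG (res Zv) = 0"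
    "rt LK (res Yv) = sm (inverse (q\<^sup>2)) (res Yv)" "rt LK (res Zv) = sm (inverse (q\<^sup>2)) (res Zv)"
    unfolding YZ_facts by (simp_all add: rt_mult rt_res rt_gens res_PB res_rels power2_eq_square)
  show "ev (res Zv) [] = 1"
    unfolding YZ_facts by (simp add: power2_eq_square ev_res) (simp add: PD_def phi_gen rho_word_def mat_def)
qed

text \<open>
  Independence of the monomials \<open>y\<^sup>i z\<^sup>j\<close> on the Borel part: acting by \<open>K F\<close> lowers the degree
  in \<open>y\<close>, and the powers of \<open>z\<close> are distinct characters of \<open>K\<close>.
\<close>

lemma res_YZ_independent:
  assumes "n \<le> N" "(\<Sum>i<n. res Yv ^ i * (\<Sum>j<N. sm (c i j) (res Zv ^ j))) = 0" "i < n" "j < N"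
  shows "c i j = 0"
  using assms
proof (induction n arbitrary: c i j)
  case (Suc n)
  define p where "p = inverse (q\<^sup>2)"
  let ?Y = "res Yv" and ?Z = "res Zv"
  \<comment> \<open>The coefficient with which \<open>K F\<close> lowers \<open>y^m\<close>; it is
    nonzero for \<open>0 < m < N\<close> because \<open>q^-2\<close> is again a primitive
    root.\<close>
  define e where "e m = p * q_num p m" for m
  have p_prim: "p ^ m \<noteq> 1" if "0 < m" "m < N" for m
    using q2_prim[OF that] by (simp add: p_def power_inverse)
  have e_nz: "e (Suc m) \<noteq> 0" if "Suc m < N" for m
    using p_prim[of "Suc m"] q_num_geometric[of p "Suc m"] that by (auto simp: e_def p_def)
  note rt = rt_res_YZ[folded p_def]
  have rGZ: "rt LG (?Z ^ j) = 0" for j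
    by (induction j) (simp_all add: rt_mult rt)
  have rGY: "rt LG (?Y ^ Suc m) = sm (e (Suc m)) (?Y ^ m)" for m
  proof (induction m)
    case (Suc m)
    have "rt LG (?Y ^ Suc (Suc m)) = rt LG ?Y * rt LK (?Y ^ Suc m) + ?Y * rt LG (?Y ^ Suc m)"
      by (simp only: power_Suc[of ?Y "Suc m"] rt_mult)
    also have "\<dots> = sm (p * p ^ Suc m) (?Y ^ Suc m) + sm (e (Suc m)) (?Y ^ Suc m)"
    proof -
      have "rt LK (?Y ^ Suc m) = sm (p ^ Suc m) (?Y ^ Suc m)" by (simp only: rt_K_power rt sm_power)
      then show ?thesis
        unfolding Suc by (simp only: rt sm_mult_left sm_mult_right sm_simps mult_1_left
            power_Suc[of ?Y m, symmetric] mult.commute[of "p ^ Suc m" p])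
    qed
    finally show ?case
      unfolding e_def q_num_Suc_right[of p "Suc m"] by (simp only: distrib_left sm_distrib add.commute)
  qed (simp add: rt e_def q_num_Suc)
  let ?W = "\<lambda>c i. \<Sum>j<N. sm (c i j) (?Z ^ j)"
  \<comment> \<open>\<open>K F\<close> kills the part free of \<open>y\<close> and shifts the others
    down by one, where the induction hypothesis applies.\<close>
  have "0 = rt LG (\<Sum>i<Suc n. ?Y ^ i * ?W c i)" unfolding Suc.prems(2) by simp
  also have "\<dots> = rt LG (?W c 0) + (\<Sum>i<n. rt LG (?Y ^ Suc i * ?W c (Suc i)))"
    unfolding sum.lessThan_Suc_shift by (simp add: rt_sum)
  also have "rt LG (?W c 0) = 0" by (simp add: rt_sum rGZ)
  also have "(\<Sum>i<n. rt LG (?Y ^ Suc i * ?W c (Suc i)))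
    = (\<Sum>i<n. ?Y ^ i * ?W (\<lambda>i j. e (Suc i) * c (Suc i) j * p ^ j) i)"
  proof (rule sum.cong[OF refl])
    fix i
    have "rt LG (?Y ^ Suc i * ?W c (Suc i)) = sm (e (Suc i)) (?Y ^ i) * rt LK (?W c (Suc i))"
      unfolding rt_mult(3) rGY by (simp add: rt_sum rGZ del: power_Suc)
    also have "rt LK (?W c (Suc i)) = ?W (\<lambda>i j. c i j * p ^ j) (Suc i)"
      by (simp add: rt_sum rt_K_power rt sm_power)
    finally show "rt LG (?Y ^ Suc i * ?W c (Suc i)) = ?Y ^ i * ?W (\<lambda>i j. e (Suc i) * c (Suc i) j * p ^ j) i"
      by (simp add: sum_distrib_left sm_sum mult_ac)
  qed
  finally have "(\<Sum>i<n. ?Y ^ i * ?W (\<lambda>i j. e (Suc i) * c (Suc i) j * p ^ j) i) = 0" by simp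
  from Suc.IH[OF _ this] Suc.prems(1)
  have "e (Suc i) * c (Suc i) j * p ^ j = 0" if "i < n" "j < N" for i j using that by simp
  then have hi: "c (Suc i) j = 0" if "i < n" "j < N" for i j
    using that e_nz Suc.prems(1) by (fastforce simp: p_def)
  have W0: "?W c 0 = 0"
    using Suc.prems(2) unfolding sum.lessThan_Suc_shift by (simp add: hi)
  define f where "f = (\<Sum>j<N. monom (c 0 j) j)"
  have ev: "ev (?Z ^ j) (replicate l LK) = (p ^ l) ^ j" for j l
  proof (induction l)
    case 0
    show ?case by (induction j) (simp_all add: rt)
  next
    case (Suc l)
    have "ev (?Z ^ j) (replicate (Suc l) LK) = ev (rt LK (?Z ^ j)) (replicate l LK)"
      by (simp add: ev_rt)
    then show ?case using Suc by (simp add: rt_K_power rt sm_power power_mult_distrib)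
  qed
  have root: "poly f (p ^ l) = 0" for l
  proof -
    have "poly f (p ^ l) = ev (?W c 0) (replicate l LK)"
      by (simp add: f_def poly_sum poly_monom ev_sum ev)
    then show ?thesis unfolding W0 by simp
  qed
  \<comment> \<open>A polynomial of degree below \<open>N\<close> that vanishes at the
    \<open>N\<close> distinct values \<open>p^l\<close> is zero; the values come from evaluating at
    powers of \<open>K\<close>.\<close>
  have "f = 0"
  proof (rule ccontr)
    assume "f \<noteq> 0"
    have "inj_on (\<lambda>l. p ^ l) {..<N}"
    proof (rule linorder_inj_onI)
      fix x y assume xy: "x < y" "x \<in> {..<N}" "y \<in> {..<N}"
      then have "p ^ (y - x) \<noteq> 1" using p_prim[of "y - x"] by simp
      then show "p ^ x \<noteq> p ^ y"
        using xy(1) by (metis add_diff_inverse_nat less_imp_not_less mult_cancel_left1 p_def power_add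
            inverse_nonzero_iff_nonzero power_not_zero q_nz)
    qed auto
    then have "N = card ((\<lambda>l. p ^ l) ` {..<N})" by (simp add: card_image)
    also have "\<dots> \<le> card {x. poly f x = 0}"
      by (rule card_mono) (use poly_roots_finite[OF \<open>f \<noteq> 0\<close>] root in auto)
    also have "\<dots> \<le> degree f" by (rule card_poly_roots_bound[OF \<open>f \<noteq> 0\<close>])
    also have "\<dots> \<le> N - 1"
      unfolding f_def by (rule degree_sum_le) (auto intro: order_trans[OF degree_monom_le])
    finally show False using N_gt_1 by simp
  qed
  moreover have "poly.coeff f j = c 0 j" if "j < N" for j
    using that by (simp add: f_def coeff_sum)
  ultimately have "c 0 j = 0" if "j < N" for j using that by simp
  with hi Suc.prems show ?case by (cases i) auto
qed simp

end

section \<open>The Taft algebra\<close>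

context root_of_unity
begin

abbreviation "RT \<equiv> T_rels N N (q\<^sup>2)"
abbreviation Tmon :: "nat \<Rightarrow> nat \<Rightarrow> tgen list \<Rightarrow>\<^sub>0 'k" where
  "Tmon i j \<equiv> gen Tx ^ i * gen Tg ^ j"

lemma T_cls_rels: "cls RT (gen Tx ^ N) = cls RT 0" "cls RT (gen Tg ^ N) = cls RT 1"
  "cls RT (gen Tg * gen Tx) = cls RT (scal (q\<^sup>2) * (gen Tx * gen Tg))"
  unfolding cls_eq_iff by (rule rel_ideal_self, simp add: T_rels_def mult.assoc)+

text \<open>A prepended \<open>g\<close> passes the power of \<open>x\<close> at the cost of a
  scalar, and the exponents are reduced by \<open>x^N = 0\<close> and
  \<open>g^N = 1\<close>.\<close>

lemma T_word: "\<exists>d i j. i < N \<and> j < N \<and> cls RT (Poly_Mapping.single w 1) = cls RT (scal d * Tmon i j)"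
proof (induction w)
  case Nil
  have "Poly_Mapping.single [] 1 = scal 1 * Tmon 0 0"
    by (metis mult_1_right power_0 scal_1 single_one zero_list_def)
  then show ?case using N_gt_1 by (intro exI[of _ 1] exI[of _ 0]) auto
next
  case (Cons a w)
  then obtain d i j where ij: "i < N" "j < N"
    and w: "cls RT (Poly_Mapping.single w 1) = cls RT (scal d * Tmon i j)" by blast
  have "Poly_Mapping.single (a # w) 1 = gen a * (Poly_Mapping.single w 1 :: tgen list \<Rightarrow>\<^sub>0 'k)"
    by (simp add: gen_def mult_single plus_list_def)
  then have "cls RT (Poly_Mapping.single (a # w) 1) = cls RT (gen a * (scal d * Tmon i j))"
    using cls_mult_cong[OF refl w] by metis
  also have "gen a * (scal d * Tmon i j) = scal d * (gen a * Tmon i j)"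
    by (rule scal_central_left)
  finally have e: "cls RT (Poly_Mapping.single (a # w) 1) = cls RT (scal d * (gen a * Tmon i j))" .
  show ?case
  proof (cases a)
    case Tx
    show ?thesis
    proof (cases "Suc i < N")
      case True
      then show ?thesis using e ij Tx by (intro exI[of _ d] exI[of _ "Suc i"] exI[of _ j]) (simp add: mult.assoc)
    next
      case False
      then have "gen a * Tmon i j = gen Tx ^ N * gen Tg ^ j"
        using ij Tx by (metis Suc_lessI mult.assoc power_Suc)
      then have "cls RT (scal d * (gen a * Tmon i j)) = cls RT (scal d * (0 * gen Tg ^ j))"
        using cls_mult_cong[OF refl cls_mult_cong[OF T_cls_rels(1) refl]] by metis
      \<comment> \<open>The word represents zero, so the coefficient is 0 and any exponents in range
        serve as witnesses.\<close>
      then show ?thesis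
        using e ij by (intro exI[of _ 0] exI[of _ i] exI[of _ j]) simp
    qed
  next
    case Tg
    have "cls RT (scal d * (gen a * Tmon i j)) = cls RT (scal d * (gen Tg * gen Tx ^ i * gen Tg ^ j))"
      by (simp add: Tg mult.assoc)
    also have "\<dots> = cls RT (scal d * (scal ((q\<^sup>2) ^ i) * (gen Tx ^ i * gen Tg) * gen Tg ^ j))"
      by (intro cls_mult_cong refl q_commute_power T_cls_rels)
    also have "scal d * (scal ((q\<^sup>2) ^ i) * (gen Tx ^ i * gen Tg) * gen Tg ^ j)
      = scal (d * (q\<^sup>2) ^ i) * (gen Tx ^ i * gen Tg ^ Suc j)"
      by (simp add: scal_mult mult.assoc)
    finally have e: "cls RT (Poly_Mapping.single (a # w) 1) = cls RT (scal (d * (q\<^sup>2) ^ i) * (gen Tx ^ i * gen Tg ^ Suc j))"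
      using e by simp
    show ?thesis
    proof (cases "Suc j < N")
      case True
      then show ?thesis using e ij by blast
    next
      case False
      then have "Suc j = N" using ij by simp
      then have "cls RT (scal (d * (q\<^sup>2) ^ i) * (gen Tx ^ i * gen Tg ^ Suc j)) = cls RT (scal (d * (q\<^sup>2) ^ i) * (gen Tx ^ i * 1))"
        using cls_mult_cong[OF refl cls_mult_cong[OF refl T_cls_rels(2)]] by metis
      then show ?thesis
        using e ij N_gt_1 by (intro exI[of _ "d * (q\<^sup>2) ^ i"] exI[of _ i] exI[of _ 0]) simp
    qed
  qed
qed

lemma T_span: "\<exists>c. cls RT p = cls RT (\<Sum>i<N. \<Sum>j<N. scal (c i j) * Tmon i j)"
proof (induction p rule: pm_induct)
  case (single w a)
  obtain d i j where ij: "i < N" "j < N"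
    and w: "cls RT (Poly_Mapping.single w 1) = cls RT (scal d * Tmon i j)" using T_word by blast
  let ?c = "\<lambda>i' j'. if i' = i then if j' = j then a * d else 0 else 0"
  have "Poly_Mapping.single w a = scal a * Poly_Mapping.single w 1" by (simp add: scal_mult_single)
  then have "cls RT (Poly_Mapping.single w a) = cls RT (scal a * (scal d * Tmon i j))"
    using cls_mult_cong[OF refl w] by metis
  also have "scal a * (scal d * Tmon i j) = scal (a * d) * Tmon i j"
    by (simp only: scal_mult mult.assoc)
  also have "\<dots> = (\<Sum>i'<N. \<Sum>j'<N. scal (?c i' j') * Tmon i' j')"
  proof -
    have "(\<Sum>j'<N. scal (?c i' j') * Tmon i' j') = (if i' = i then scal (a * d) * Tmon i j else 0)" for i'
    proof (cases "i' = i")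
      case True
      then have "(\<Sum>j'<N. scal (?c i' j') * Tmon i' j') = (\<Sum>j'<N. if j' = j then scal (a * d) * Tmon i j else 0)"
        by (intro sum.cong) auto
      then show ?thesis using ij True by simp
    qed simp
    then show ?thesis using ij by simp
  qed
  finally show ?case by (rule exI[of _ ?c])
next
  case (add p r)
  then obtain c c' where "cls RT p = cls RT (\<Sum>i<N. \<Sum>j<N. scal (c i j) * Tmon i j)"
    "cls RT r = cls RT (\<Sum>i<N. \<Sum>j<N. scal (c' i j) * Tmon i j)" by blast
  from cls_add_cong[OF this] show ?case
    by (intro exI[of _ "\<lambda>i j. c i j + c' i j"]) (simp add: scal_add distrib_right sum.distrib)
qed

end

section \<open>The isomorphism\<close>

context coideal_pairing
begin

lemma psi_smult:
  assumes "X \<in> carrier (Oq N q)"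
  shows "psi (c \<odot>\<^bsub>Oq N q\<^esub> X) = sm c (psi X)" "c \<odot>\<^bsub>Oq N q\<^esub> X \<in> carrier (Oq N q)"
  using assms by (auto simp: carrier_pres_alg Phi_scal)

lemma ract_smult:
  assumes "X \<in> carrier (Oq N q)"
  shows "psi (ract N q \<phi> (c \<odot>\<^bsub>Oq N q\<^esub> X) (cls RU p)) = sm c (psi (ract N q \<phi> X (cls RU p)))"
  using phi_props(5)[OF assms assms cls_carrier] assms
  by (intro wdual_eqI) (simp add: ev_psi_ract psi_smult)

lemma ract_zero: "X \<in> carrier (Oq N q) \<Longrightarrow> psi (ract N q \<phi> X (cls RU 0)) = 0"
  using ract_lin(2)[of X 0 0] by simp

lemma ract_u:
  assumes "X \<in> carrier (Oq N q)"
  shows "psi (ract N q \<phi> X (cls RU (u_rep q \<alpha> \<beta>))) = U (psi X)"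
  unfolding u_rep_def mult.assoc by (simp add: assms ract_lin(1,2) ract_gens rU_def)

lemma ract_u_power:
  assumes "X \<in> carrier (Oq N q)"
  shows "psi (ract N q \<phi> X (cls RU (u_rep q \<alpha> \<beta> ^ i))) = (U ^^ i) (psi X)"
proof (induction i)
  case (Suc i)
  then show ?case
    unfolding power_Suc2 using assms by (simp add: ract_lin(4) ract_u ract_carrier)
qed (simp add: assms ract_lin)

lemma ract_Lambda:
  assumes "X \<in> carrier (Oq N q)"
  shows "psi (ract N q \<phi> X (Lambda N q \<alpha> \<beta>)) = pact (psi_poly N q \<alpha> \<beta>) (psi X)"
proof -
  have "psi (ract N q \<phi> X (cls RU (\<Sum>i\<in>A. scal (c i) * u_rep q \<alpha> \<beta> ^ i))) = (\<Sum>i\<in>A. sm (c i) ((U ^^ i) (psi X)))"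
    for A :: "nat set" and c
    by (induction A rule: infinite_finite_induct)
      (simp_all add: assms ract_zero ract_lin(1,2) ract_u_power)
  then show ?thesis by (simp add: Lambda_def pact_def)
qed

lemma psi_x_rep: "Phi (x_rep N) = PX"
  by (simp add: x_rep_def PX_def Phi_simps P_defs)

lemma psi_y_z: "psi (y_elt N q \<phi> \<alpha> \<beta>) = Yv" "psi (z_elt N q \<phi> \<alpha> \<beta>) = Zv"
  "y_elt N q \<phi> \<alpha> \<beta> \<in> carrier (Oq N q)" "z_elt N q \<phi> \<alpha> \<beta> \<in> carrier (Oq N q)"
proof -
  have c: "ract N q \<phi> (cls RO f) (Lambda N q \<alpha> \<beta>) \<in> carrier (Oq N q)" for f
    unfolding Lambda_def by (intro ract_carrier cls_carrier)
  then show "y_elt N q \<phi> \<alpha> \<beta> \<in> carrier (Oq N q)" "z_elt N q \<phi> \<alpha> \<beta> \<in> carrier (Oq N q)"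
    unfolding y_elt_def z_elt_def by (simp_all only: psi_smult)
  show "psi (y_elt N q \<phi> \<alpha> \<beta>) = Yv" "psi (z_elt N q \<phi> \<alpha> \<beta>) = Zv"
    unfolding y_elt_def z_elt_def Yv_def Zv_def Lam_def psi_smult(1)[OF c] ract_Lambda[OF cls_carrier]
    by (simp_all only: Phi_mult Phi_power psi_x_rep P_defs)
qed

lemma u_counit: "counit U_eps (u_elt N q \<alpha> \<beta>) = \<beta>"
  by (simp add: u_elt_def U_counit u_rep_def scal_id.free_hom_simps)

text \<open>The elements acting on a fixed \<open>X\<close> through the counit form a unital
  subalgebra, and \<open>u\<close> has counit \<open>\<beta>\<close>, so the condition on the
  generated subalgebra reduces to one on \<open>u\<close>.\<close>

lemma dagger_eq:
  "dagger N q \<phi> (gen_subalg (Uq N q) {u_elt N q \<alpha> \<beta>}) = {X \<in> carrier (Oq N q). psi X \<in> eqv}"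
proof (intro equalityI subsetI)
  fix X assume X: "X \<in> dagger N q \<phi> (gen_subalg (Uq N q) {u_elt N q \<alpha> \<beta>})"
  then have c: "X \<in> carrier (Oq N q)" by (simp add: dagger_def)
  have "u_elt N q \<alpha> \<beta> \<in> gen_subalg (Uq N q) {u_elt N q \<alpha> \<beta>}" by (auto simp: gen_subalg_def)
  then have "ract N q \<phi> X (u_elt N q \<alpha> \<beta>) = \<beta> \<odot>\<^bsub>Oq N q\<^esub> X" using X by (simp add: dagger_def u_counit)
  then have "U (psi X) = sm \<beta> (psi X)"
    using ract_u[OF c] psi_smult(1)[OF c] by (simp add: u_elt_def)
  then show "X \<in> {X \<in> carrier (Oq N q). psi X \<in> eqv}" using c by (simp add: eqv_def Oset_def)
next
  fix X assume "X \<in> {X \<in> carrier (Oq N q). psi X \<in> eqv}"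
  then have c: "X \<in> carrier (Oq N q)" and u: "U (psi X) = sm \<beta> (psi X)" by (auto simp: eqv_def)
  let ?e = "free_hom (\<lambda>c. c) U_eps"
  let ?B = "{h \<in> carrier (Uq N q). ract N q \<phi> X h = counit U_eps h \<odot>\<^bsub>Oq N q\<^esub> X}"
  have B: "cls RU p \<in> ?B \<longleftrightarrow> psi (ract N q \<phi> X (cls RU p)) = sm (?e p) (psi X)" for p
    using psi_inj[of "ract N q \<phi> X (cls RU p)" "?e p \<odot>\<^bsub>Oq N q\<^esub> X"] psi_smult[OF c] ract_carrier[OF c]
    by (auto simp: U_counit)
  have B_eq: "ract N q \<phi> X (cls RU p) = ?e p \<odot>\<^bsub>Oq N q\<^esub> X" if "cls RU p \<in> ?B" for p
    using that by (simp add: U_counit)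
  have "unital_subalg (Uq N q) ?B"
    unfolding unital_subalg_def
  proof (intro conjI ballI allI)
    show "?B \<subseteq> carrier (Uq N q)" by auto
    show "\<one>\<^bsub>Uq N q\<^esub> \<in> ?B"
      unfolding pres_alg_one B by (simp add: ract_lin c scal_id.free_hom_one)
    fix h assume h: "h \<in> ?B"
    then obtain p where p: "h = cls RU p" by (auto simp: carrier_pres_alg)
    note hp = h[unfolded p]
    {
      fix k assume k: "k \<in> ?B"
      then obtain r where r: "k = cls RU r" by (auto simp: carrier_pres_alg)
      note kr = k[unfolded r]
      show "h \<oplus>\<^bsub>Uq N q\<^esub> k \<in> ?B"
        using hp kr unfolding p r pres_alg_add B
        by (simp add: ract_lin(1) c scal_id.free_hom_add sm_distrib)
      have "psi (ract N q \<phi> X (cls RU (p * r))) = sm (?e p) (psi (ract N q \<phi> X (cls RU r)))"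
        unfolding ract_lin(4)[OF c] B_eq[OF hp] ract_smult[OF c] ..
      also have "\<dots> = sm (?e (p * r)) (psi X)"
        using kr unfolding B by (simp add: scal_id.free_hom_mult)
      finally show "h \<otimes>\<^bsub>Uq N q\<^esub> k \<in> ?B" unfolding p r pres_alg_mult B .
    }
    fix d
    show "d \<odot>\<^bsub>Uq N q\<^esub> h \<in> ?B"
      using hp unfolding p pres_alg_smult B
      by (simp add: ract_lin(2) c scal_id.free_hom_mult scal_id.free_hom_scal)
  qed
  moreover have "u_elt N q \<alpha> \<beta> \<in> ?B"
    unfolding u_elt_def B using u_counit by (simp add: ract_u c u u_elt_def U_counit)
  ultimately have "gen_subalg (Uq N q) {u_elt N q \<alpha> \<beta>} \<subseteq> ?B"
    unfolding gen_subalg_def by (intro Inter_lower) simp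
  then show "X \<in> dagger N q \<phi> (gen_subalg (Uq N q) {u_elt N q \<alpha> \<beta>})"
    using c by (auto simp: dagger_def)
qed

text \<open>A lift of the desired map to free algebras. Its values on generators are chosen
  representatives; another choice alters \<open>eta\<close> only modulo the relation ideal.\<close>

definition eta :: "(tgen list \<Rightarrow>\<^sub>0 'k) \<Rightarrow> ogen list \<Rightarrow>\<^sub>0 'k" where
  "eta = free_hom scal (\<lambda>g. case g of Tx \<Rightarrow> SOME f. cls RO f = y_elt N q \<phi> \<alpha> \<beta>
     | Tg \<Rightarrow> SOME f. cls RO f = z_elt N q \<phi> \<alpha> \<beta>)"

lemma cls_eta: "cls RO (eta (gen Tx)) = y_elt N q \<phi> \<alpha> \<beta>" "cls RO (eta (gen Tg)) = z_elt N q \<phi> \<alpha> \<beta>"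
proof -
  have "\<exists>f. cls RO f = y_elt N q \<phi> \<alpha> \<beta>" "\<exists>f. cls RO f = z_elt N q \<phi> \<alpha> \<beta>"
    using psi_y_z(3,4) by (auto simp: carrier_pres_alg)
  from this[THEN someI_ex]
  show "cls RO (eta (gen Tx)) = y_elt N q \<phi> \<alpha> \<beta>" "cls RO (eta (gen Tg)) = z_elt N q \<phi> \<alpha> \<beta>"
    by (simp_all add: eta_def scal.free_hom_gen)
qed

lemma eta_simps: "eta (p + r) = eta p + eta r" "eta (p * r) = eta p * eta r" "eta 1 = 1"
  "eta (scal c) = scal c" "eta (p - r) = eta p - eta r" "eta (p ^ n) = eta p ^ n"
  by (simp_all add: eta_def scal.free_hom_simps)

abbreviation "F p \<equiv> Phi (eta p)"

lemma F_gen: "F (gen Tx) = Yv" "F (gen Tg) = Zv"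
  by (simp_all add: cls_eta psi_y_z)

lemma F_eqv: "F p \<in> eqv"
proof (induction p rule: pm_induct)
  case (single w c)
  have "F (prod_list (map gen w)) \<in> eqv"
  proof (induction w)
    case (Cons a w)
    have "F (gen a) \<in> eqv" by (cases a) (simp_all add: F_gen YZ_facts)
    then show ?case using Cons by (simp add: eta_simps Phi_mult eqv_closed)
  qed (simp add: eta_simps Phi_one eqv_closed)
  then show ?case by (simp add: single_word eta_simps Phi_scal eqv_closed)
qed (simp add: eta_simps Phi_add eqv_closed)

lemma F_rels: "p \<in> rel_ideal RT \<Longrightarrow> F p = 0"
proof -
  have "F r \<in> {0}" if "r \<in> RT" for r
    using that unfolding T_rels_def
    by (auto simp: eta_simps Phi_simps F_gen YZ_rels mult.assoc)
  moreover assume "p \<in> rel_ideal RT"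
  ultimately have "F p \<in> {0}"
    by (intro rel_ideal_hom[of F "{0}" RT p]) (auto simp: eta_simps Phi_simps two_sided_def)
  then show "F p = 0" by simp
qed

text \<open>Modulo the relators \<open>p\<close> is a combination of monomials
  \<open>x^i g^j\<close>, and \<open>res_YZ_independent\<close> forces its coefficients to
  vanish.\<close>

lemma F_kernel:
  assumes "F p = 0"
  shows "p \<in> rel_ideal RT"
proof -
  obtain c where c: "cls RT p = cls RT (\<Sum>i<N. \<Sum>j<N. scal (c i j) * Tmon i j)" using T_span by blast
  have F_sum: "F (sum f A) = (\<Sum>i\<in>A. F (f i))" for f and A :: "nat set"
    by (induction A rule: infinite_finite_induct)
      (use F_rels[OF rel_ideal_closed(1)] in \<open>simp_all add: eta_simps Phi_simps\<close>)
  have "F (p - (\<Sum>i<N. \<Sum>j<N. scal (c i j) * Tmon i j)) = 0"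
    using c by (intro F_rels) (simp add: cls_eq_iff)
  then have "(\<Sum>i<N. \<Sum>j<N. F (scal (c i j) * Tmon i j)) = 0"
    using assms by (simp add: eta_simps(5) Phi_diff F_sum)
  then have "res (\<Sum>i<N. \<Sum>j<N. sm (c i j) (Yv ^ i * Zv ^ j)) = 0"
    by (simp add: eta_simps Phi_simps F_gen)
  then have "(\<Sum>i<N. res Yv ^ i * (\<Sum>j<N. sm (c i j) (res Zv ^ j))) = 0"
    by (simp add: res_sum res_power sum_distrib_left)
  from res_YZ_independent[OF order_refl this]
  have "(\<Sum>i<N. \<Sum>j<N. scal (c i j) * Tmon i j) = 0" by simp
  then show ?thesis using c by (simp add: cls_eq_0_iff)
qed

text \<open>By \<open>res_eqv_inj\<close> it suffices to match restrictions. For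
  \<open>N = 2 m + 1\<close> the inverse of \<open>d\<close> restricts to \<open>z^m\<close>, so
  \<open>a = d^-1\<close>, \<open>c = y d^-1\<close>, \<open>d = z d^-1\<close> and
  \<open>b = 0\<close> are all reached on the Borel part.\<close>

lemma F_surj:
  assumes "X \<in> carrier (Oq N q)" "psi X \<in> eqv"
  shows "\<exists>p. cls RO (eta p) = X"
proof -
  let ?S = "range (\<lambda>p. res (F p))"
  have S: "a + b \<in> ?S" "a * b \<in> ?S" if "a \<in> ?S" "b \<in> ?S" for a b
  proof -
    from that obtain p r where "a = res (F p)" "b = res (F r)" by auto
    then have "a + b = res (F (p + r))" "a * b = res (F (p * r))"
      by (simp_all add: eta_simps Phi_simps)
    then show "a + b \<in> ?S" "a * b \<in> ?S" by blast+
  qed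
  have S_sm: "sm c 1 \<in> ?S" for c
  proof -
    have "sm c 1 = res (F (scal c))" by (simp add: eta_simps Phi_simps)
    then show ?thesis by blast
  qed
  have S_pow: "a ^ n \<in> ?S" if "a \<in> ?S" for a n
    by (induction n) (use S S_sm[of 1] that in simp_all)
  have Y: "res Yv \<in> ?S" and Z: "res Zv \<in> ?S"
    by (metis F_gen(1) rangeI, metis F_gen(2) rangeI)
  let ?A = "res PA" and ?C = "res PC" and ?D = "res PD"
  obtain m where m: "N = 2 * m + 1" using odd_N by (auto elim: oddE)
  have "?D ^ (2 * m) = res Zv ^ m" by (simp add: YZ_facts power_mult)
  then have D2m: "?D ^ (2 * m) \<in> ?S" using S_pow[OF Z] by simp
  have DN: "?D * ?D ^ (2 * m) = 1" using res_rels(4) by (simp add: m)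
  have A: "?A \<in> ?S"
  proof -
    have "?A = ?A * ?D * ?D ^ (2 * m)" by (simp add: mult.assoc DN)
    then show ?thesis using D2m by (simp add: res_rels)
  qed
  have C: "?C \<in> ?S"
  proof -
    have "?C = res Yv * ?D ^ (2 * m)" by (simp add: YZ_facts mult.assoc DN)
    then show ?thesis using S(2)[OF Y D2m] by simp
  qed
  have D: "?D \<in> ?S"
  proof -
    have "?D = ?D * (?D * ?D ^ (2 * m))" by (simp add: DN)
    also have "\<dots> = res Zv * ?D ^ (2 * m)" by (simp add: YZ_facts power2_eq_square mult.assoc)
    finally show ?thesis using S(2)[OF Z D2m] by simp
  qed
  have B: "res PB \<in> ?S" using S_sm[of 0] by (simp add: res_PB)
  have "res (Phi f) \<in> ?S" for f
  proof (induction f rule: pm_induct)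
    case (single w c)
    have "res (Phi (prod_list (map gen w))) \<in> ?S"
    proof (induction w)
      case (Cons a w)
      have "res (Phi (gen a)) \<in> ?S"
        using A B C D by (cases a) (simp_all only: P_defs)
      from S(2)[OF this Cons] show ?case by (simp add: Phi_mult)
    qed (use S_sm[of 1] in \<open>simp add: Phi_one\<close>)
    from S(2)[OF S_sm[of c] this] show ?case by (simp add: single_word Phi_scal)
  next
    case (add a b)
    from S(1)[OF this] show ?case by (simp add: Phi_add)
  qed
  moreover obtain f where f: "X = cls RO f" using assms(1) by (auto simp: carrier_pres_alg)
  ultimately obtain p where "res (Phi f) = res (F p)" by blast
  then have "Phi f = F p" using assms(2) by (intro res_eqv_inj[OF _ F_eqv]) (simp_all add: f)
  then have "X = cls RO (eta p)" unfolding f by (intro psi_inj) auto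
  then show ?thesis by blast
qed

definition theta :: "(tgen list \<Rightarrow>\<^sub>0 'k) set \<Rightarrow> (ogen list \<Rightarrow>\<^sub>0 'k) set" where
  "theta X = the_elem ((\<lambda>p. cls RO (eta p)) ` X)"

lemma theta_cls: "theta (cls RT p) = cls RO (eta p)"
  unfolding theta_def
proof (rule the_elem_cls)
  fix i assume "i \<in> rel_ideal RT"
  then have "eta i \<in> rel_ideal RO" using F_rels Phi_eq_0_iff by blast
  then show "cls RO (eta (i + p)) = cls RO (eta p)" by (simp add: eta_simps cls_eq_iff)
qed

lemma theta_iso:
  "theta \<in> alg_iso (pres_alg RT)
     ((Oq N q)\<lparr>carrier := dagger N q \<phi> (gen_subalg (Uq N q) {u_elt N q \<alpha> \<beta>})\<rparr>)"
  unfolding dagger_eq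
proof -
  let ?D = "{X \<in> carrier (Oq N q). psi X \<in> eqv}"
  have im: "theta ` range (cls RT) = ?D"
    using F_surj F_eqv by (auto simp: theta_cls image_iff) (metis theta_cls)
  have inj: "inj_on theta (range (cls RT))"
  proof (rule inj_onI, clarsimp simp: theta_cls)
    fix p r assume "cls RO (eta p) = cls RO (eta r)"
    then have "F (p - r) = 0" by (simp add: eta_simps Phi_diff)
    then show "cls RT p = cls RT r" by (simp add: cls_eq_iff F_kernel)
  qed
  show "theta \<in> alg_iso (pres_alg RT) ((Oq N q)\<lparr>carrier := ?D\<rparr>)"
    unfolding alg_iso_def ring_iso_def ring_hom_def bij_betw_def
    using im inj
    by (auto simp: carrier_pres_alg theta_cls eta_simps)
qed

end

theorem theorem5p7:
  fixes N :: nat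
    and q \<alpha> \<beta> :: "'k :: {alg_closed_field, field_char_0}"
    and \<phi> :: "(ogen list \<Rightarrow>\<^sub>0 'k) set \<Rightarrow> (ugen list \<Rightarrow>\<^sub>0 'k) set \<Rightarrow> 'k"
  assumes "N > 1" and "odd N"
    and "q ^ N = 1" and "\<And>m. 0 < m \<Longrightarrow> m < N \<Longrightarrow> q ^ m \<noteq> 1"
    and "is_phi N q \<phi>"
  shows "\<exists>\<theta> \<in> alg_iso (pres_alg (T_rels N N (q\<^sup>2)))
      ((Oq N q)\<lparr>carrier := dagger N q \<phi> (gen_subalg (Uq N q) {u_elt N q \<alpha> \<beta>})\<rparr>).
    \<theta> (cls (T_rels N N (q\<^sup>2)) (gen Tx)) = y_elt N q \<phi> \<alpha> \<beta> \<and>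
    \<theta> (cls (T_rels N N (q\<^sup>2)) (gen Tg)) = z_elt N q \<phi> \<alpha> \<beta>"
proof -
  \<comment> \<open>The roots of this polynomial are the parameters \<open>s\<close> and
    \<open>t = \<beta> - s\<close>; algebraic closedness supplies them.\<close>
  let ?f = "[: \<alpha> / (1 - q\<^sup>2), - \<beta>, 1 :]"
  obtain s where s: "poly ?f s = 0"
    using alg_closed_imp_poly_has_root[of ?f] by auto
  then have st: "s * (\<beta> - s) = \<alpha> / (1 - q\<^sup>2)" by (simp add: algebra_simps)
  interpret coideal_pairing N q \<phi> \<alpha> \<beta> s "\<beta> - s"
    by unfold_locales (use assms st in auto)
  show ?thesis
    using theta_iso theta_cls cls_eta by metis
qed

end
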